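(* Let $L>0$, $\beta>0$, $\lambda\in\mathbb R$, $\alpha\in\mathbb R$, $k\in\frac{2\pi}{L}\mathbb Z$, and consider the cubic nonlinear Schrödinger equation $$i\partial_tu(t,x)+\beta\partial_{xx}^2u(t,x)+\lambda|u(t,x)|^2u(t,x)=0$$ on the one-dimensional torus $\mathbb T_L$ of length $L$, with phase space $E=H^1(\mathbb T_L,\mathbb C)$. Let $$\mathcal O=\{x\mapsto\alpha e^{i\gamma}e^{-ik(x-a)}\mid (a,\gamma)\in\mathbb R\times\mathbb R\}\subset E.$$ If $\beta\left(\frac{2\pi}{L}\right)^2-2\lambda|\alpha|^2>0$, then all $u\in\mathcal O$ are orbitally stable relative equilibria.
   Context: $E=H^1(\mathbb T_L,\mathbb C)$ is viewed as a real Hilbert space with $(u,v)_E=\mathrm{Re}\int_0^L(\partial_xu\,\partial_x\bar v+u\bar v)\,\mathrm dx$ and distance $\mathrm d(u,v)=\|u-v\|_E$, $\mathrm d(u,S)=\inf_{w\in S}\mathrm d(u,w)$. The equation is globally well posed in $E$ (Bourgain); $v(t)\in E$ denotes the solution at time $t\in\mathbb R$ with initial datum $v\in E$. The symmetry group is $G=\mathbb R\times\mathbb R$ acting by $(\Phi_{a,\gamma}(u))(x)=e^{i\gamma}u(x-a)$, which commutes with the flow; $\mathcal O_u$ denotes the $G$-orbit of $u$. The set $\mathcal O$ is the $G$-orbit of the initial condition $\alpha e^{-ikx}$ of the plane wave solution $u_{\alpha,k}(t,x)=\alpha e^{-ikx}e^{i\xi t}$, where $\xi+\beta k^2=\lambda|\alpha|^2$.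 $u$ is a relative equilibrium if $u(t)\in\mathcal O_u$ for all $t\in\mathbb R$. $u$ is orbitally stable if for all $\epsilon>0$ there is $\delta>0$ such that for all $v\in E$: $\mathrm d(v,u)\le\delta\Rightarrow\forall t\in\mathbb R,\ \inf_{t'\in\mathbb R}\mathrm d(v(t),\mathcal O_{u(t')})\le\epsilon$ (for relative equilibria, $\mathcal O_{u(t')}=\mathcal O_u$). *)

theory Defs
  imports "HOL-Analysis.Analysis"
begin

text \<open>
  Functions on the torus of length \<open>L\<close> are \<open>L\<close>-periodic functions on the real line.
\<close>

definition torus_periodic :: "real \<Rightarrow> (real \<Rightarrow> complex) \<Rightarrow> bool" where
  "torus_periodic L f \<longleftrightarrow> (\<forall>x. f (x + L) = f x)"

definition torus_integral :: "real \<Rightarrow> (real \<Rightarrow> complex) \<Rightarrow> complex" where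
  "torus_integral L f = (LINT x:{0..L}|lborel. f x)"

definition L2_torus :: "real \<Rightarrow> (real \<Rightarrow> complex) set" where
  "L2_torus L = {g. g \<in> borel_measurable borel \<and> torus_periodic L g \<and>
     set_integrable lborel {0..L} (\<lambda>x. (cmod (g x))\<^sup>2)}"

text \<open>
  The weak derivative. A smooth periodic test function is given with all its derivatives:
  \<open>D n\<close> is the \<open>n\<close>-th derivative of \<open>D 0\<close>.
\<close>

definition weak_deriv :: "real \<Rightarrow> (real \<Rightarrow> complex) \<Rightarrow> (real \<Rightarrow> complex) \<Rightarrow> bool" where
  "weak_deriv L u g \<longleftrightarrow>
     (\<forall>D :: nat \<Rightarrow> real \<Rightarrow> complex.
        torus_periodic L (D 0) \<longrightarrow>
        (\<forall>n x. (D n has_vector_derivative D (Suc n) x) (at x)) \<longrightarrow>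
        torus_integral L (\<lambda>x. u x * D 1 x) = - torus_integral L (\<lambda>x. g x * D 0 x))"

text \<open>
  The Sobolev space of square integrable functions with square integrable weak derivative.
  In dimension one every class modulo null sets has exactly one continuous representative,
  and the class is identified with it; so equality in the space is equality of functions.
\<close>

definition H1_torus :: "real \<Rightarrow> (real \<Rightarrow> complex) set" where
  "H1_torus L = {u. continuous_on UNIV u \<and> u \<in> L2_torus L \<and> (\<exists>g\<in>L2_torus L. weak_deriv L u g)}"

text \<open>The derivative is determined only up to null sets; it is only used under integrals.\<close>

definition h1_deriv :: "real \<Rightarrow> (real \<Rightarrow> complex) \<Rightarrow> real \<Rightarrow> complex" where
  "h1_deriv L u = (SOME g. g \<in> L2_torus L \<and> weak_deriv L u g)"

definition h1_inner :: "real \<Rightarrow> (real \<Rightarrow> complex) \<Rightarrow> (real \<Rightarrow> complex) \<Rightarrow> real" where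
  "h1_inner L u v =
     Re (torus_integral L (\<lambda>x. h1_deriv L u x * cnj (h1_deriv L v x) + u x * cnj (v x)))"

definition h1_norm :: "real \<Rightarrow> (real \<Rightarrow> complex) \<Rightarrow> real" where
  "h1_norm L u = sqrt (h1_inner L u u)"

definition h1_dist :: "real \<Rightarrow> (real \<Rightarrow> complex) \<Rightarrow> (real \<Rightarrow> complex) \<Rightarrow> real" where
  "h1_dist L u v = h1_norm L (\<lambda>x. u x - v x)"

definition h1_setdist :: "real \<Rightarrow> (real \<Rightarrow> complex) \<Rightarrow> (real \<Rightarrow> complex) set \<Rightarrow> real" where
  "h1_setdist L u S = (INF w\<in>S. h1_dist L u w)"

definition sym_action :: "real \<Rightarrow> real \<Rightarrow> (real \<Rightarrow> complex) \<Rightarrow> real \<Rightarrow> complex" where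
  "sym_action a \<gamma> u = (\<lambda>x. exp (\<i> * of_real \<gamma>) * u (x - a))"

definition sym_orbit :: "(real \<Rightarrow> complex) \<Rightarrow> (real \<Rightarrow> complex) set" where
  "sym_orbit u = {sym_action a \<gamma> u | a \<gamma>. True}"

text \<open>
  Global solutions with values in the phase space: norm-continuous curves that satisfy
  \<open>i \<partial>\<^sub>t u + \<beta> \<partial>\<^sub>x\<^sub>x u + lam |u|\<^sup>2 u = 0\<close> in the dual of the phase space, that is, tested
  against every \<open>\<phi>\<close> in the phase space, with one space derivative moved onto \<open>\<phi>\<close>.
\<close>

definition nls_solution ::
  "real \<Rightarrow> real \<Rightarrow> real \<Rightarrow> (real \<Rightarrow> complex) \<Rightarrow> (real \<Rightarrow> real \<Rightarrow> complex) \<Rightarrow> bool" where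
  "nls_solution L \<beta> lam v w \<longleftrightarrow>
     w 0 = v \<and>
     (\<forall>t. w t \<in> H1_torus L) \<and>
     (\<forall>t. ((\<lambda>s. h1_dist L (w s) (w t)) \<longlongrightarrow> 0) (at t)) \<and>
     (\<forall>\<phi>\<in>H1_torus L. \<forall>t. \<exists>d.
        ((\<lambda>s. torus_integral L (\<lambda>x. w s x * cnj (\<phi> x))) has_vector_derivative d) (at t) \<and>
        \<i> * d
        - of_real \<beta> * torus_integral L (\<lambda>x. h1_deriv L (w t) x * cnj (h1_deriv L \<phi> x))
        + of_real lam * torus_integral L (\<lambda>x. of_real ((cmod (w t x))\<^sup>2) * w t x * cnj (\<phi> x))
        = 0)"

text \<open>
  The equation is globally well posed in the phase space, so \<open>U\<close> and \<open>V\<close> below are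
  the unique solutions with initial data \<open>u\<close> and \<open>v\<close>. The definitions do not build
  uniqueness in: they ask for the property of every solution with the given datum.
\<close>

definition relative_equilibrium ::
  "real \<Rightarrow> real \<Rightarrow> real \<Rightarrow> (real \<Rightarrow> complex) \<Rightarrow> bool" where
  "relative_equilibrium L \<beta> lam u \<longleftrightarrow>
     u \<in> H1_torus L \<and>
     (\<exists>U. nls_solution L \<beta> lam u U) \<and>
     (\<forall>U. nls_solution L \<beta> lam u U \<longrightarrow> (\<forall>t. U t \<in> sym_orbit u))"

definition orbitally_stable ::
  "real \<Rightarrow> real \<Rightarrow> real \<Rightarrow> (real \<Rightarrow> complex) \<Rightarrow> bool" where
  "orbitally_stable L \<beta> lam u \<longleftrightarrow>
     (\<forall>\<epsilon>>0. \<exists>\<delta>>0. \<forall>v\<in>H1_torus L. h1_dist L v u \<le> \<delta> \<longrightarrow>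
        (\<forall>U V. nls_solution L \<beta> lam u U \<longrightarrow> nls_solution L \<beta> lam v V \<longrightarrow>
           (\<forall>t. (INF t'. h1_setdist L (V t) (sym_orbit (U t'))) \<le> \<epsilon>)))"

end

theory Submission
  imports Defs
begin

text \<open>
  Mass, energy and momentum are conserved along every weak solution, and no well-posedness theory
  is needed. For two solutions \<open>p\<close> and \<open>r\<close> the dispersive terms cancel in
  \<open>d/dt \<langle>p, r\<rangle> = \<i> lam \<integral> (|p|\<^sup>2 - |r|\<^sup>2) p cnj r\<close>. Taking \<open>p = r\<close> gives the mass, taking for \<open>p\<close> a space
  translate of \<open>r\<close> by \<open>\<eta> \<rightarrow> 0\<close> gives the momentum, and a time translate gives the energy.

  Write \<open>v = c e + f\<close> where \<open>e\<close> is the exponential of the plane wave, \<open>c\<close> the corresponding Fourier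
  coefficient of \<open>v\<close>, and \<open>\<rho>\<close> the mean of \<open>|v|\<^sup>2\<close>. The conserved quantity
  \<open>\<beta>/2 \<parallel>\<partial> v + \<i> k v\<parallel>\<^sup>2 - lam/4 \<integral> (|v|\<^sup>2 - \<rho>)\<^sup>2\<close> is coercive near the orbit: by the sharp Wirtinger inequality
  \<open>\<integral> (|v|\<^sup>2 - \<rho>)\<^sup>2 \<le> (2 |c| + sup |f|)\<^sup>2 \<parallel>f\<parallel>\<^sup>2 \<le> (2 |c| + sup |f|)\<^sup>2 (L / 2\<pi>)\<^sup>2 \<parallel>\<partial> v + \<i> k v\<parallel>\<^sup>2\<close>.
  A continuity argument in time then traps \<open>\<parallel>\<partial> v + \<i> k v\<parallel>\<close>, and conservation of mass fixes \<open>|c|\<close>.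
\<close>

text \<open>A weak solution is differentiable in time only when paired with a fixed element of H1,
  so the usual conservation proofs, which test the equation with a derivative of the solution, make
  no sense here. A finite increment, the difference of a solution and its translate, is an
  admissible substitute. The argument closes by polarization: the time derivative of the imaginary
  part of the pairing is lam/2 times the difference of the two fourth-power integrals minus a rest
  quadratic in the increment. That difference is zero for space translates and an exact time
  derivative for time translates, and the rest is small compared with the step.

  The threshold is the coercivity estimate at f = 0 and |c| = |\<alpha>|: \<beta>/2 - lam \<alpha>^2
  (L/2\<pi>)^2 > 0 is the hypothesis rewritten. Centring at the mean \<rho> of the solution itself
  makes the functional vanish on plane waves of this wave number and any amplitude, so perturbations
  that change the mass are treated like all others. Since the definitions quantify over all
  solutions with a datum, invariance of the orbit is itself an instance of the estimate, with zero
  initial deviation.\<close>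

lemma has_vector_derivative_iff_quotient:
  "(f has_vector_derivative d) (at x) \<longleftrightarrow> ((\<lambda>h. (f (x + h) - f x) /\<^sub>R h) \<longlongrightarrow> d) (at 0)"
proof -
  have "((\<lambda>h. (f (x + h) - f x) /\<^sub>R h) \<longlongrightarrow> d) (at 0) \<longleftrightarrow>
      ((\<lambda>h. norm ((f (x + h) - f x) /\<^sub>R h - d)) \<longlongrightarrow> 0) (at 0)"
    by (simp only: tendsto_norm_zero_iff LIM_zero_iff)
  also have "\<dots> \<longleftrightarrow> ((\<lambda>h. norm (f (x + h) - f x - h *\<^sub>R d) / norm h) \<longlongrightarrow> 0) (at 0)"
  proof (rule filterlim_cong[OF refl refl])
    have "norm ((f (x + h) - f x) /\<^sub>R h - d) = norm (f (x + h) - f x - h *\<^sub>R d) / norm h" if "h \<noteq> 0" for h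
    proof -
      have "(f (x + h) - f x) /\<^sub>R h - d = (f (x + h) - f x - h *\<^sub>R d) /\<^sub>R h"
        using that by (simp add: scaleR_right_diff_distrib)
      then show ?thesis by (simp add: divide_inverse mult.commute)
    qed
    then show "eventually (\<lambda>h. norm ((f (x + h) - f x) /\<^sub>R h - d) = norm (f (x + h) - f x - h *\<^sub>R d) / norm h) (at 0)"
      by (auto simp: eventually_at_filter)
  qed
  also have "\<dots> \<longleftrightarrow> (f has_vector_derivative d) (at x)"
    unfolding has_vector_derivative_def has_derivative_at by (simp add: bounded_linear_scaleR_left)
  finally show ?thesis ..
qed

lemma continuous_on_Icc_bounded:
  fixes h :: "real \<Rightarrow> complex"
  assumes "continuous_on {a..b} h"
  obtains B where "\<And>x. x \<in> {a..b} \<Longrightarrow> cmod (h x) \<le> B" "B > 0"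
proof -
  have "bounded (h ` {a..b})" using assms by (intro compact_imp_bounded compact_continuous_image) auto
  then obtain B where "B > 0" "\<forall>y\<in>h ` {a..b}. cmod y \<le> B" unfolding bounded_pos by blast
  then show thesis using that by blast
qed

text \<open>A chord is at most its arc, since |e^{it} - 1| = 2 |sin (t/2)|. In Fourier terms this
  compares a translation with a derivative.\<close>

lemma cmod_cis_minus_1: "cmod (cis t - 1) \<le> \<bar>t\<bar>"
proof (rule power2_le_imp_le)
  have "(cmod (cis t - 1))\<^sup>2 = (cos t - 1)\<^sup>2 + (sin t)\<^sup>2" by (simp add: cmod_power2)
  also have "\<dots> = (cos t)\<^sup>2 + (sin t)\<^sup>2 + 1 - 2 * cos t" by (simp add: power2_diff)
  also have "\<dots> = 2 - 2 * cos (2 * (t / 2))" by simp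
  also have "\<dots> = (2 * sin (t / 2))\<^sup>2" unfolding cos_double_sin by (simp add: power_mult_distrib)
  also have "\<dots> \<le> \<bar>t\<bar>\<^sup>2"
    unfolding abs_le_square_iff[symmetric] using abs_sin_x_le_abs_x[of "t / 2"] by simp
  finally show "(cmod (cis t - 1))\<^sup>2 \<le> \<bar>t\<bar>\<^sup>2" .
qed simp

lemma deriv_bound_diff:
  fixes J :: "real \<Rightarrow> real"
  assumes "a < b" "\<And>t. (J has_real_derivative J' t) (at t)" "\<And>t. t \<in> {a..b} \<Longrightarrow> \<bar>J' t\<bar> \<le> K"
  shows "\<bar>J b - J a\<bar> \<le> K * (b - a)"
proof -
  obtain z where z: "a < z" "z < b" "J b - J a = (b - a) * J' z"
    using MVT2[of a b J J'] assms by blast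
  then show ?thesis using assms(3)[of z] assms(1) by (simp add: abs_mult mult.commute)
qed

text \<open>In terms of the Fourier coefficient the symmetry orbit is the circle of radius
  |\<alpha>|; the point of it with the argument of \<open>c\<close> is the nearest one.\<close>

lemma phase_alignment: "\<exists>\<theta>. cmod (c - of_real \<alpha> * cis \<theta>) = \<bar>cmod c - \<bar>\<alpha>\<bar>\<bar>"
proof -
  have c: "c = of_real (cmod c) * cis (Arg c)" using rcis_cmod_Arg[of c] by (simp add: rcis_def)
  have "\<exists>\<theta>. of_real \<alpha> * cis \<theta> = of_real \<bar>\<alpha>\<bar> * cis (Arg c)"
  proof (cases "0 \<le> \<alpha>")
    case True then show ?thesis by (intro exI[of _ "Arg c"]) simp
  next
    case False
    \<comment> \<open>Half a turn compensates the sign of a negative \<alpha>.\<close>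
    then show ?thesis by (intro exI[of _ "Arg c + pi"]) (simp add: cis_mult[symmetric])
  qed
  then obtain \<theta> where "of_real \<alpha> * cis \<theta> = of_real \<bar>\<alpha>\<bar> * cis (Arg c)" by blast
  then have "c - of_real \<alpha> * cis \<theta> = of_real (cmod c - \<bar>\<alpha>\<bar>) * cis (Arg c)"
    using c by (metis left_diff_distrib of_real_diff)
  then show ?thesis by (metis norm_mult norm_of_real norm_cis mult_1_right)
qed

subsection \<open>Square-integrable functions on the torus\<close>

locale torus =
  fixes L :: real
  assumes L_pos: "0 < L"
begin

abbreviation "L2 \<equiv> L2_torus L"
abbreviation "H1 \<equiv> H1_torus L"
text \<open>A finite measure in its own right, so that finite and product measure facts apply
  without indicators. The seam is counted at both ends, which costs only a null set.\<close>

abbreviation "TL \<equiv> restrict_space lborel {0..L}"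

lemma torus_integral_eq: "torus_integral L f = integral\<^sup>L TL f"
  by (simp add: torus_integral_def set_lebesgue_integral_def integral_restrict_space)

lemma L2_iff: "g \<in> L2 \<longleftrightarrow> g \<in> borel_measurable borel \<and> (\<forall>x. g (x + L) = g x) \<and>
    integrable TL (\<lambda>x. (cmod (g x))\<^sup>2)"
  by (simp add: L2_torus_def torus_periodic_def set_integrable_def integrable_restrict_space)

lemma finite_measure_TL: "finite_measure TL"
  by (rule finite_measureI) (simp add: emeasure_restrict_space space_restrict_space emeasure_lborel_Icc_eq)

lemma measure_TL [simp]: "measure TL {0..L} = L"
  using L_pos by (simp add: measure_restrict_space space_restrict_space)

lemma space_TL [simp]: "space TL = {0..L}"
  by (simp add: space_restrict_space)

lemma measurable_TL: "f \<in> borel_measurable borel \<Longrightarrow> f \<in> borel_measurable TL"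
  by (rule measurable_restrict_space1) simp

lemma cont_integrable:
  fixes f :: "real \<Rightarrow> 'a::{banach,second_countable_topology}"
  assumes "continuous_on UNIV f"
  shows "integrable TL f"
proof -
  have "set_integrable lborel {0..L} f"
    by (rule borel_integrable_compact[unfolded set_integrable_def[symmetric]])
       (use assms continuous_on_subset in auto)
  then show ?thesis
    by (simp add: set_integrable_def integrable_restrict_space)
qed

lemma L2_measurable: "f \<in> L2 \<Longrightarrow> f \<in> borel_measurable borel"
  by (simp add: L2_iff)

lemma L2_measurable_TL: "f \<in> L2 \<Longrightarrow> f \<in> borel_measurable TL"
  by (simp add: L2_iff measurable_TL)

lemma L2_periodic: "f \<in> L2 \<Longrightarrow> f (x + L) = f x"
  by (simp add: L2_iff)

lemma L2_sq: "f \<in> L2 \<Longrightarrow> integrable TL (\<lambda>x. (cmod (f x))\<^sup>2)"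
  by (simp add: L2_iff)

lemma L2_continuous:
  assumes "continuous_on UNIV f" "\<And>x. f (x + L) = f x"
  shows "f \<in> L2"
  unfolding L2_iff
  using assms by (auto intro!: borel_measurable_continuous_onI cont_integrable continuous_intros)

lemma L2_cmult: "f \<in> L2 \<Longrightarrow> (\<lambda>x. c * f x) \<in> L2"
  unfolding L2_iff by (auto simp: norm_mult power_mult_distrib)

lemma L2_add:
  assumes "f \<in> L2" "g \<in> L2"
  shows "(\<lambda>x. f x + g x) \<in> L2"
proof -
  have "integrable TL (\<lambda>x. (cmod (f x + g x))\<^sup>2)"
  proof (rule Bochner_Integration.integrable_bound)
    show "integrable TL (\<lambda>x. 2 * (cmod (f x))\<^sup>2 + 2 * (cmod (g x))\<^sup>2)"
      using assms by (intro Bochner_Integration.integrable_add integrable_mult_right L2_sq) auto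
    show "(\<lambda>x. (cmod (f x + g x))\<^sup>2) \<in> borel_measurable TL"
      using assms[THEN L2_measurable_TL] by measurable
    have "(cmod (f x + g x))\<^sup>2 \<le> 2 * (cmod (f x))\<^sup>2 + 2 * (cmod (g x))\<^sup>2" for x
    proof -
      have "(cmod (f x + g x))\<^sup>2 \<le> (cmod (f x) + cmod (g x))\<^sup>2"
        by (intro power_mono norm_triangle_ineq) auto
      also have "\<dots> \<le> 2 * (cmod (f x))\<^sup>2 + 2 * (cmod (g x))\<^sup>2"
        using sum_squares_bound[of "cmod (f x)" "cmod (g x)"] by (simp add: power2_sum)
      finally show ?thesis .
    qed
    then show "AE x in TL. norm ((cmod (f x + g x))\<^sup>2) \<le> norm (2 * (cmod (f x))\<^sup>2 + 2 * (cmod (g x))\<^sup>2)"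
      by (auto intro!: AE_I2 simp: abs_of_nonneg)
  qed
  then show ?thesis using assms unfolding L2_iff by auto
qed

lemma L2_diff:
  assumes "f \<in> L2" "g \<in> L2"
  shows "(\<lambda>x. f x - g x) \<in> L2"
  using L2_add[OF assms(1) L2_cmult[OF assms(2), of "-1"]] by simp

lemma L2_cmod_mult_integrable:
  assumes "f \<in> L2" "g \<in> L2"
  shows "integrable TL (\<lambda>x. cmod (f x) * cmod (g x))"
proof (rule Bochner_Integration.integrable_bound)
  show "integrable TL (\<lambda>x. (cmod (f x))\<^sup>2 + (cmod (g x))\<^sup>2)"
    using assms by (intro Bochner_Integration.integrable_add L2_sq) auto
  show "(\<lambda>x. cmod (f x) * cmod (g x)) \<in> borel_measurable TL"
    using assms[THEN L2_measurable_TL] by measurable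
  have "cmod (f x) * cmod (g x) \<le> (cmod (f x))\<^sup>2 + (cmod (g x))\<^sup>2" for x
  proof -
    have "0 \<le> cmod (f x) * cmod (g x)" by simp
    then show ?thesis using sum_squares_bound[of "cmod (f x)" "cmod (g x)"] by linarith
  qed
  then show "AE x in TL. norm (cmod (f x) * cmod (g x)) \<le> norm ((cmod (f x))\<^sup>2 + (cmod (g x))\<^sup>2)"
    by (auto intro!: AE_I2 simp: abs_of_nonneg)
qed

lemma L2_mult_integrable:
  assumes "f \<in> L2" "g \<in> L2"
  shows "integrable TL (\<lambda>x. f x * g x)"
proof (rule Bochner_Integration.integrable_bound[OF L2_cmod_mult_integrable[OF assms]])
  show "(\<lambda>x. f x * g x) \<in> borel_measurable TL"
    using assms[THEN L2_measurable_TL] by measurable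
qed (auto simp: norm_mult)

lemma L2_cnj: "f \<in> L2 \<Longrightarrow> (\<lambda>x. cnj (f x)) \<in> L2"
  unfolding L2_iff
  by (auto intro: measurable_compose[OF _ borel_measurable_continuous_onI] continuous_intros)

lemma ip_integrable: "f \<in> L2 \<Longrightarrow> g \<in> L2 \<Longrightarrow> integrable TL (\<lambda>x. f x * cnj (g x))"
  by (intro L2_mult_integrable L2_cnj)

lemma L2_integrable: "f \<in> L2 \<Longrightarrow> integrable TL f"
  using L2_mult_integrable[of f "\<lambda>_. 1"] L2_continuous[of "\<lambda>_. 1"] by simp

definition ip :: "(real \<Rightarrow> complex) \<Rightarrow> (real \<Rightarrow> complex) \<Rightarrow> complex" where
  "ip f g = torus_integral L (\<lambda>x. f x * cnj (g x))"

lemma ip_eq: "ip f g = integral\<^sup>L TL (\<lambda>x. f x * cnj (g x))"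
  by (simp add: ip_def torus_integral_eq)

lemma ip_cnj: "cnj (ip f g) = ip g f"
  unfolding ip_eq by (simp add: Bochner_Integration.integral_cnj[symmetric] mult.commute del: Bochner_Integration.integral_cnj)

lemma ip_add_left: "f \<in> L2 \<Longrightarrow> g \<in> L2 \<Longrightarrow> h \<in> L2 \<Longrightarrow> ip (\<lambda>x. f x + g x) h = ip f h + ip g h"
  unfolding ip_eq by (simp add: distrib_right Bochner_Integration.integral_add ip_integrable)

lemma ip_diff_left: "f \<in> L2 \<Longrightarrow> g \<in> L2 \<Longrightarrow> h \<in> L2 \<Longrightarrow> ip (\<lambda>x. f x - g x) h = ip f h - ip g h"
  unfolding ip_eq by (simp add: left_diff_distrib Bochner_Integration.integral_diff ip_integrable)

lemma ip_cmult_left: "ip (\<lambda>x. c * f x) h = c * ip f h"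
  unfolding ip_eq by (simp add: mult.assoc)

lemma ip_add_right: "f \<in> L2 \<Longrightarrow> g \<in> L2 \<Longrightarrow> h \<in> L2 \<Longrightarrow> ip h (\<lambda>x. f x + g x) = ip h f + ip h g"
  using arg_cong[OF ip_add_left[of f g h], of cnj] by (simp add: ip_cnj)

lemma ip_diff_right: "f \<in> L2 \<Longrightarrow> g \<in> L2 \<Longrightarrow> h \<in> L2 \<Longrightarrow> ip h (\<lambda>x. f x - g x) = ip h f - ip h g"
  using arg_cong[OF ip_diff_left[of f g h], of cnj] by (simp add: ip_cnj)

lemma ip_cmult_right: "ip h (\<lambda>x. c * f x) = cnj c * ip h f"
  using arg_cong[OF ip_cmult_left[of c f h], of cnj] by (simp add: ip_cnj)

lemma ip_self: "ip f f = of_real (integral\<^sup>L TL (\<lambda>x. (cmod (f x))\<^sup>2))"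
  unfolding ip_eq complex_norm_square[symmetric] by (rule integral_complex_of_real)

definition nrm :: "(real \<Rightarrow> complex) \<Rightarrow> real" where
  "nrm f = sqrt (Re (ip f f))"

lemma Re_ip_self: "Re (ip f f) = integral\<^sup>L TL (\<lambda>x. (cmod (f x))\<^sup>2)"
  by (simp add: ip_self)

lemma Re_ip_nonneg: "0 \<le> Re (ip f f)"
  by (simp add: Re_ip_self)

lemma nrm_nonneg [simp]: "0 \<le> nrm f"
  by (simp add: nrm_def Re_ip_nonneg)

lemma nrm_sq: "(nrm f)\<^sup>2 = integral\<^sup>L TL (\<lambda>x. (cmod (f x))\<^sup>2)"
  using Re_ip_nonneg[of f] by (simp add: nrm_def Re_ip_self)

lemma ip_self_nrm: "ip f f = of_real ((nrm f)\<^sup>2)"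
  by (simp add: ip_self nrm_sq)

text \<open>Integrate 2ab \<le> s a^2 + b^2/s and choose s = \<open>nrm g / nrm f\<close>. If one
  norm vanishes there is no such s, and letting s tend to 0 or to infinity gives the bound.\<close>

lemma Cauchy_Schwarz_cmod:
  assumes "f \<in> L2" "g \<in> L2"
  shows "integral\<^sup>L TL (\<lambda>x. cmod (f x) * cmod (g x)) \<le> nrm f * nrm g"
proof -
  let ?I = "integral\<^sup>L TL (\<lambda>x. cmod (f x) * cmod (g x))"
  have *: "2 * ?I \<le> s * (nrm f)\<^sup>2 + (nrm g)\<^sup>2 / s" if "s > 0" for s
  proof -
    have pw: "2 * (a * b) \<le> s * a\<^sup>2 + b\<^sup>2 / s" for a b :: real
    proof -
      have "0 \<le> (s * a - b)\<^sup>2 / s" using that by simp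
      also have "(s * a - b)\<^sup>2 / s = s * a\<^sup>2 + b\<^sup>2 / s - 2 * (a * b)"
        using that by (simp add: power2_eq_square field_simps)
      finally show ?thesis by simp
    qed
    have "2 * ?I = integral\<^sup>L TL (\<lambda>x. 2 * (cmod (f x) * cmod (g x)))" by simp
    also have "\<dots> \<le> integral\<^sup>L TL (\<lambda>x. s * (cmod (f x))\<^sup>2 + (cmod (g x))\<^sup>2 / s)"
      using assms pw by (intro integral_mono integrable_mult_right L2_cmod_mult_integrable
          Bochner_Integration.integrable_add integrable_divide L2_sq) auto
    also have "\<dots> = s * (nrm f)\<^sup>2 + (nrm g)\<^sup>2 / s"
      using assms by (simp add: nrm_sq Bochner_Integration.integral_add L2_sq)
    finally show ?thesis .
  qed
  \<comment> \<open>The limit s to 0 in elementary form: the choice s = x / (c + 1) makes the right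
    side at most x.\<close>
  have **: "2 * x \<le> 0" if "\<And>s. s > 0 \<Longrightarrow> 2 * x \<le> s * c" "c \<ge> 0" for x c :: real
  proof (rule ccontr)
    assume "\<not> 2 * x \<le> 0"
    then have "x > 0" by simp
    then have "2 * x \<le> x / (c + 1) * c" using that(1)[of "x / (c+1)"] that(2) by simp
    also have "\<dots> \<le> x" using \<open>x > 0\<close> that(2) by (simp add: field_simps)
    finally show False using \<open>x > 0\<close> by simp
  qed
  show ?thesis
  proof (cases "nrm f = 0")
    case True
    have "2 * ?I \<le> 0"
      using *[of "inverse s" for s] True by (intro **[of ?I "(nrm g)\<^sup>2"]) (auto simp: divide_inverse mult.commute)
    then show ?thesis using True by simp
  next
    case f0: False
    show ?thesis
    proof (cases "nrm g = 0")
      case True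
      have "2 * ?I \<le> 0" using * True by (intro **[of ?I "(nrm f)\<^sup>2"]) auto
      then show ?thesis using True by simp
    next
      case False
      then have "nrm f > 0" "nrm g > 0" using f0 nrm_nonneg[of f] nrm_nonneg[of g] by linarith+
      then show ?thesis using *[of "nrm g / nrm f"] by (simp add: power2_eq_square field_simps)
    qed
  qed
qed

lemma Cauchy_Schwarz:
  assumes "f \<in> L2" "g \<in> L2"
  shows "cmod (ip f g) \<le> nrm f * nrm g"
proof -
  have "cmod (ip f g) \<le> integral\<^sup>L TL (\<lambda>x. cmod (f x * cnj (g x)))"
    unfolding ip_eq by (rule integral_norm_bound)
  then show ?thesis using Cauchy_Schwarz_cmod[OF assms] by (simp add: norm_mult)
qed

lemma nrm_cmult: "nrm (\<lambda>x. c * f x) = cmod c * nrm f"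
proof -
  have "ip (\<lambda>x. c * f x) (\<lambda>x. c * f x) = of_real ((cmod c * nrm f)\<^sup>2)"
    using complex_norm_square[of c]
    by (simp add: ip_cmult_left ip_cmult_right ip_self_nrm power_mult_distrib flip: mult.assoc)
  then have "Re (ip (\<lambda>x. c * f x) (\<lambda>x. c * f x)) = (cmod c * nrm f)\<^sup>2"
    by (metis Re_complex_of_real)
  then show ?thesis unfolding nrm_def[of "\<lambda>x. c * f x"] by (simp add: abs_mult)
qed

lemma nrm_add_sq:
  assumes "f \<in> L2" "g \<in> L2"
  shows "(nrm (\<lambda>x. f x + g x))\<^sup>2 = (nrm f)\<^sup>2 + (nrm g)\<^sup>2 + 2 * Re (ip f g)"
proof -
  have sq: "(nrm h)\<^sup>2 = Re (ip h h)" for h by (simp add: ip_self_nrm)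
  have "Re (ip g f) = Re (ip f g)" using ip_cnj[of f g] by (metis cnj.simps(1))
  then show ?thesis
    unfolding sq ip_add_left[OF assms L2_add[OF assms]] ip_add_right[OF assms assms(1)]
      ip_add_right[OF assms assms(2)] by simp
qed

lemma nrm_triangle:
  assumes "f \<in> L2" "g \<in> L2"
  shows "nrm (\<lambda>x. f x + g x) \<le> nrm f + nrm g"
proof (rule power2_le_imp_le)
  have "Re (ip f g) \<le> nrm f * nrm g"
    using Cauchy_Schwarz[OF assms] complex_Re_le_cmod[of "ip f g"] by linarith
  then show "(nrm (\<lambda>x. f x + g x))\<^sup>2 \<le> (nrm f + nrm g)\<^sup>2"
    unfolding nrm_add_sq[OF assms] by (simp add: power2_sum)
qed auto

lemma nrm_diff_commute: "nrm (\<lambda>x. f x - g x) = nrm (\<lambda>x. g x - f x)"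
  by (simp add: nrm_def Re_ip_self norm_minus_commute)

lemma nrm_diff_le:
  assumes "f \<in> L2" "g \<in> L2"
  shows "\<bar>nrm f - nrm g\<bar> \<le> nrm (\<lambda>x. f x - g x)"
  using nrm_triangle[OF L2_diff[OF assms] assms(2)] nrm_triangle[OF L2_diff[OF assms(2,1)] assms(1)]
  unfolding nrm_diff_commute[of g f] by simp

lemma integral_TL_mono_const:
  fixes f :: "real \<Rightarrow> real"
  assumes "f \<in> borel_measurable TL" "\<And>x. x \<in> {0..L} \<Longrightarrow> f x \<le> B" "0 \<le> B"
  shows "integral\<^sup>L TL f \<le> B * L"
proof -
  interpret finite_measure TL by (rule finite_measure_TL)
  have "integral\<^sup>L TL f \<le> integral\<^sup>L TL (\<lambda>_. B)"
    by (rule Bochner_Integration.integral_mono_AE') (use assms in \<open>auto intro!: AE_I2\<close>)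
  then show ?thesis by (simp add: mult.commute)
qed

lemma nrm_le_sup:
  assumes "f \<in> L2" "\<And>x. cmod (f x) \<le> B"
  shows "nrm f \<le> B * sqrt L"
proof -
  have B: "0 \<le> B" using assms(2)[of 0] norm_ge_zero order_trans by blast
  have "(nrm f)\<^sup>2 \<le> B\<^sup>2 * L"
    unfolding nrm_sq
    by (rule integral_TL_mono_const)
       (use assms L2_measurable_TL[OF assms(1)] B in \<open>auto intro!: power_mono\<close>)
  then have "(nrm f)\<^sup>2 \<le> (B * sqrt L)\<^sup>2" using L_pos by (simp add: power_mult_distrib)
  then show ?thesis by (rule power2_le_imp_le) (use B L_pos in auto)
qed

lemma L2_bounded_mult:
  assumes "f \<in> borel_measurable borel" "\<And>x. f (x + L) = f x" "\<And>x. cmod (f x) \<le> B" "g \<in> L2"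
  shows "(\<lambda>x. f x * g x) \<in> L2" "nrm (\<lambda>x. f x * g x) \<le> B * nrm g"
proof -
  have B: "0 \<le> B" using assms(3)[of 0] norm_ge_zero order_trans by blast
  have bd: "(cmod (f x * g x))\<^sup>2 \<le> B\<^sup>2 * (cmod (g x))\<^sup>2" for x
    unfolding norm_mult power_mult_distrib by (intro mult_right_mono power_mono assms) auto
  have int: "integrable TL (\<lambda>x. B\<^sup>2 * (cmod (g x))\<^sup>2)" using L2_sq[OF assms(4)] by simp
  have int': "integrable TL (\<lambda>x. (cmod (f x * g x))\<^sup>2)"
  proof (rule Bochner_Integration.integrable_bound[OF int])
    show "(\<lambda>x. (cmod (f x * g x))\<^sup>2) \<in> borel_measurable TL"
      using measurable_TL[OF assms(1)] L2_measurable_TL[OF assms(4)] by measurable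
    show "AE x in TL. norm ((cmod (f x * g x))\<^sup>2) \<le> norm (B\<^sup>2 * (cmod (g x))\<^sup>2)"
      using bd by (auto intro!: AE_I2)
  qed
  then show L: "(\<lambda>x. f x * g x) \<in> L2"
    using assms unfolding L2_iff by auto
  have "(nrm (\<lambda>x. f x * g x))\<^sup>2 \<le> (B * nrm g)\<^sup>2"
    using integral_mono[OF int' int bd] by (simp add: nrm_sq power_mult_distrib)
  then show "nrm (\<lambda>x. f x * g x) \<le> B * nrm g" by (rule power2_le_imp_le) (use B in auto)
qed

lemma square_integral_eq_0D:
  assumes "continuous_on {0..L} f" "integral\<^sup>L TL (\<lambda>x. (cmod (f x))\<^sup>2) = 0" "x \<in> {0..L}"
  shows "f x = 0"
proof -
  have c: "continuous_on {0..L} (\<lambda>x. (cmod (f x))\<^sup>2)"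
    by (intro continuous_intros assms)
  have i0: "integral\<^sup>L lborel (\<lambda>x. indicator {0..L} x *\<^sub>R (cmod (f x))\<^sup>2) = 0"
    using assms(2) by (simp add: integral_restrict_space)
  have "set_integrable lborel {0..L} (\<lambda>x. (cmod (f x))\<^sup>2)"
    unfolding set_integrable_def by (rule borel_integrable_compact) (use c in auto)
  from set_borel_integral_eq_integral[OF this]
  have "((\<lambda>x. (cmod (f x))\<^sup>2) has_integral 0) {0..L}"
    using i0 by (simp add: set_lebesgue_integral_def has_integral_iff)
  with c L_pos assms(3) have "(cmod (f x))\<^sup>2 = 0"
    using has_integral_0_cbox_imp_0[of 0 L "\<lambda>x. (cmod (f x))\<^sup>2" x] by auto
  then show ?thesis by simp
qed

lemma periodic_of_int:
  assumes "\<And>x. f (x + L) = f x"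
  shows "f (x + of_int n * L) = f x"
proof (induction n rule: int_induct[where k = 0])
  case (step1 i) then show ?case using assms[of "x + of_int i * L"] by (simp add: algebra_simps)
next
  case (step2 i) then show ?case using assms[of "x + of_int (i-1) * L"] by (simp add: algebra_simps)
qed auto

lemma reduce_to_period: obtains n :: int where "x + of_int n * L \<in> {0..<L}"
proof -
  have "of_int \<lfloor>x / L\<rfloor> \<le> x / L" "x / L < of_int \<lfloor>x / L\<rfloor> + 1" by linarith+
  then have "of_int \<lfloor>x / L\<rfloor> * L \<le> x" "x < (of_int \<lfloor>x / L\<rfloor> + 1) * L"
    unfolding pos_le_divide_eq[OF L_pos] pos_divide_less_eq[OF L_pos] by blast+
  then have "x + of_int (- \<lfloor>x / L\<rfloor>) * L \<in> {0..<L}" by (simp add: algebra_simps)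
  then show thesis by (rule that)
qed

text \<open>Elements of the phase space are functions rather than classes, so orbit membership asks
  for pointwise equality; this extracts it from a vanishing norm.\<close>

lemma nrm_zero_continuous:
  assumes "continuous_on UNIV f" "\<And>x. f (x + L) = f x" "nrm f = 0"
  shows "f x = 0"
proof -
  obtain n where "x + of_int n * L \<in> {0..<L}" by (rule reduce_to_period)
  then have "f (x + of_int n * L) = 0"
    using assms nrm_sq[of f] by (intro square_integral_eq_0D) (auto intro: continuous_on_subset)
  then show ?thesis using periodic_of_int[of f x n] assms(2) by simp
qed

subsection \<open>Trigonometric polynomials\<close>

definition expo :: "int \<Rightarrow> real \<Rightarrow> complex" where
  "expo n x = cis (2 * pi / L * of_int n * x)"

lemma expo_add: "expo (m + n) x = expo m x * expo n x"
  by (simp add: expo_def cis_mult algebra_simps add_divide_distrib)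

lemma expo_0 [simp]: "expo 0 x = 1"
  by (simp add: expo_def)

lemma cnj_expo [simp]: "cnj (expo n x) = expo (- n) x"
  by (simp add: expo_def cis_cnj)

lemma cmod_expo [simp]: "cmod (expo n x) = 1"
  by (simp add: expo_def)

lemma expo_at_0 [simp]: "expo n 0 = 1"
  by (simp add: expo_def)

lemma expo_shift: "expo n (x + y) = expo n x * expo n y"
  by (simp add: expo_def cis_mult algebra_simps add_divide_distrib)

lemma expo_L [simp]: "expo n L = 1"
proof -
  have "expo n L = cis (2 * pi * of_int n)" using L_pos by (simp add: expo_def)
  then show ?thesis by (simp add: cis_multiple_2pi)
qed

lemma expo_periodic: "expo n (x + L) = expo n x"
  by (simp add: expo_shift)

lemma expo_deriv:
  "(expo n has_vector_derivative (\<i> * of_real (2 * pi / L * of_int n)) * expo n x) (at x)"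
proof -
  have "((\<lambda>t. exp (\<i> * of_real (2 * pi / L * of_int n) * of_real t)) has_vector_derivative
      (\<i> * of_real (2 * pi / L * of_int n)) * exp (\<i> * of_real (2 * pi / L * of_int n) * of_real x)) (at x)"
    by (rule has_vector_derivative_real_field) (use L_pos in \<open>auto intro!: derivative_eq_intros\<close>)
  then show ?thesis
    by (simp add: expo_def[abs_def] cis_conv_exp mult.assoc)
qed

lemma continuous_expo: "continuous_on S (expo n)"
  unfolding expo_def[abs_def] by (intro continuous_intros)

lemma L2_expo: "expo n \<in> L2"
  by (rule L2_continuous) (auto simp: continuous_expo expo_periodic)

text \<open>The variable lower limit \<open>a\<close> is meant for the inner integral over the
  triangle in \<open>integral_by_parts_primitive\<close>.\<close>

lemma integral_TL_deriv:
  fixes F f :: "real \<Rightarrow> complex"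
  assumes "\<And>x. (F has_vector_derivative f x) (at x)" "continuous_on UNIV f" "0 \<le> a" "a \<le> L"
  shows "integral\<^sup>L TL (\<lambda>x. indicator {a..} x *\<^sub>R f x) = F L - F a"
proof -
  have "integral\<^sup>L TL (\<lambda>x. indicator {a..} x *\<^sub>R f x) = integral\<^sup>L lborel (\<lambda>x. indicator {a..L} x *\<^sub>R f x)"
    by (subst integral_restrict_space)
       (use assms in \<open>auto intro!: Bochner_Integration.integral_cong simp: indicator_def\<close>)
  also have "\<dots> = integral {a..L} f"
  proof -
    have "set_integrable lborel {a..L} f"
      unfolding set_integrable_def
      by (rule borel_integrable_compact) (use assms(2) continuous_on_subset in auto)
    then show ?thesis by (simp add: set_borel_integral_eq_integral(2)[symmetric] set_lebesgue_integral_def)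
  qed
  also have "\<dots> = F L - F a"
    by (intro integral_unique fundamental_theorem_of_calculus assms)
       (use assms in \<open>auto intro: has_vector_derivative_at_within\<close>)
  finally show ?thesis .
qed

lemma integral_TL_deriv0:
  fixes F f :: "real \<Rightarrow> complex"
  assumes "\<And>x. (F has_vector_derivative f x) (at x)" "continuous_on UNIV f"
  shows "integral\<^sup>L TL f = F L - F 0"
proof -
  have "integral\<^sup>L TL f = integral\<^sup>L TL (\<lambda>x. indicator {0..} x *\<^sub>R f x)"
    by (intro Bochner_Integration.integral_cong) auto
  then show ?thesis using integral_TL_deriv[OF assms, of 0] L_pos by simp
qed

lemma integral_expo: "integral\<^sup>L TL (expo n) = (if n = 0 then of_real L else 0)"
proof (cases "n = 0")
  case True
  then have "integral\<^sup>L TL (expo n) = integral\<^sup>L TL (\<lambda>x. 1)"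
    by (intro Bochner_Integration.integral_cong) auto
  also have "\<dots> = of_real L" by (simp add: scaleR_conv_of_real)
  finally show ?thesis using True by simp
next
  case False
  define c where "c = \<i> * complex_of_real (2 * pi / L * of_int n)"
  have c: "c \<noteq> 0" using False L_pos by (simp add: c_def)
  have "c * integral\<^sup>L TL (expo n) = integral\<^sup>L TL (\<lambda>x. c * expo n x)" by simp
  also have "\<dots> = expo n L - expo n 0"
    using expo_deriv[of n] unfolding c_def[symmetric]
    by (intro integral_TL_deriv0) (auto intro!: continuous_intros continuous_expo)
  finally show ?thesis using c False by simp
qed

lemma ip_expo_expo: "ip (expo m) (expo n) = (if m = n then of_real L else 0)"
proof -
  have "ip (expo m) (expo n) = integral\<^sup>L TL (expo (m - n))"
    unfolding ip_eq by (intro Bochner_Integration.integral_cong) (auto simp: expo_add[symmetric])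
  then show ?thesis by (simp add: integral_expo)
qed

text \<open>Generation by rules gives an induction principle for linear and limit statements;
  \<open>trig_representation\<close> passes to a sum over distinct frequencies where orthogonality
  is used.\<close>

inductive trig :: "(real \<Rightarrow> complex) \<Rightarrow> bool" where
  trig_expo: "trig (\<lambda>x. c * expo n x)"
| trig_add: "trig f \<Longrightarrow> trig g \<Longrightarrow> trig (\<lambda>x. f x + g x)"

lemma trig_mult:
  assumes "trig f" "trig g"
  shows "trig (\<lambda>x. f x * g x)"
  using assms
proof (induction f)
  case (trig_expo c n)
  from \<open>trig g\<close> show ?case
  proof (induction g)
    case (trig_expo d m)
    have "(\<lambda>x. c * expo n x * (d * expo m x)) = (\<lambda>x. (c * d) * expo (n + m) x)"
      by (auto simp: expo_add)
    then show ?case using trig.trig_expo by simp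
  next
    case (trig_add f g)
    then show ?case using trig.trig_add by (simp add: distrib_left)
  qed
next
  case (trig_add f g)
  then show ?case using trig.trig_add by (simp add: distrib_right)
qed

lemma trig_const: "trig (\<lambda>x. c)"
  using trig_expo[of c 0] by simp

lemma trig_cmult: "trig f \<Longrightarrow> trig (\<lambda>x. c * f x)"
  by (intro trig_mult trig_const)

lemma trig_representation:
  assumes "trig f"
  shows "\<exists>I a. finite I \<and> f = (\<lambda>x. \<Sum>n\<in>I. a n * expo n x)"
  using assms
proof induction
  case (trig_expo c n)
  show ?case by (intro exI[of _ "{n}"] exI[of _ "\<lambda>_. c"]) simp
next
  case (trig_add f g)
  then obtain I a J b where I: "finite I" "f = (\<lambda>x. \<Sum>n\<in>I. a n * expo n x)"
    and J: "finite J" "g = (\<lambda>x. \<Sum>n\<in>J. b n * expo n x)" by blast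
  let ?a = "\<lambda>n. (if n \<in> I then a n else 0) + (if n \<in> J then b n else 0)"
  have 1: "f x = (\<Sum>n\<in>I \<union> J. (if n \<in> I then a n else 0) * expo n x)" for x
    unfolding I(2) using I J by (intro sum.mono_neutral_cong_left) auto
  have 2: "g x = (\<Sum>n\<in>I \<union> J. (if n \<in> J then b n else 0) * expo n x)" for x
    unfolding J(2) using I J by (intro sum.mono_neutral_cong_left) auto
  have "(\<lambda>x. f x + g x) = (\<lambda>x. \<Sum>n\<in>I \<union> J. ?a n * expo n x)"
  proof (rule ext)
    fix x show "f x + g x = (\<Sum>n\<in>I \<union> J. ?a n * expo n x)"
      unfolding 1[of x] 2[of x] sum.distrib[symmetric] distrib_right[symmetric] ..
  qed
  with I(1) J(1) show ?case by (intro exI[of _ "I \<union> J"] exI[of _ ?a] conjI) simp_all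
qed

lemma continuous_trig: "trig f \<Longrightarrow> continuous_on S f"
  by (induction rule: trig.induct) (auto intro!: continuous_intros continuous_expo)

lemma L2_trig: "trig f \<Longrightarrow> f \<in> L2"
  by (induction rule: trig.induct) (auto intro!: L2_cmult L2_expo L2_add)

text \<open>On the unit circle a linear form in Re z and Im z is a combination of the frequencies 1
  and -1, and products stay trigonometric. Stone-Weierstrass on the circle thereby yields
  trigonometric approximants.\<close>

lemma trig_real_polynomial:
  assumes "real_polynomial_function g"
  shows "trig (\<lambda>x. of_real (g (cis (2 * pi / L * x))))"
  using assms
proof induction
  case (linear f)
  interpret bounded_linear f by fact
  define a b where "a = complex_of_real (f 1)" "b = complex_of_real (f \<i>)"
  have f: "f z = Re z * f 1 + Im z * f \<i>" for z
  proof -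
    have "z = Re z *\<^sub>R 1 + Im z *\<^sub>R \<i>" by (simp add: complex_eq_iff)
    then have "f z = f (Re z *\<^sub>R 1 + Im z *\<^sub>R \<i>)" by simp
    then show ?thesis by (simp add: add scaleR)
  qed
  have "of_real (f (cis (2 * pi / L * x))) =
      (a / 2 - \<i> * b / 2) * expo 1 x + (a / 2 + \<i> * b / 2) * expo (- 1) x" for x
    unfolding f[of "cis _"] a_b_def by (simp add: expo_def complex_eq_iff algebra_simps)
  then show ?case using trig_add[OF trig_expo trig_expo] by simp
next
  case (const c)
  then show ?case by (rule trig_const)
next
  case (add f g)
  then show ?case using trig_add by simp
next
  case (mult f g)
  then show ?case using trig_mult by simp
qed

text \<open>A function with equal values at the end points factors through the circle.\<close>

lemma trig_dense_real:
  fixes f :: "real \<Rightarrow> real"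
  assumes f: "continuous_on {0..L} f" "f 0 = f L" and e: "e > 0"
  obtains p where "trig p" "\<And>x. x \<in> {0..L} \<Longrightarrow> cmod (of_real (f x) - p x) < e"
proof -
  define h where "h z = f (L * Arg2pi z / (2 * pi))" for z
  let ?c = "\<lambda>x. cis (2 * pi / L * x)"
  have c_Arg: "?c (L * Arg2pi z / (2 * pi)) = z" if "z \<in> sphere 0 1" for z
    using Arg2pi[of z] that L_pos by (simp add: is_Arg_def cis_conv_exp)
  have Arg_in: "L * Arg2pi z / (2 * pi) \<in> {0..<L}" for z
    using Arg2pi[of z] L_pos by (simp add: field_simps)
  have h_c: "h (?c x) = f x" if x: "x \<in> {0..L}" for x
  proof -
    define y where "y = L * Arg2pi (?c x) / (2 * pi)"
    have "?c y = ?c x" unfolding y_def by (rule c_Arg) simp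
    then have "exp (\<i> * of_real (2 * pi / L * y)) = exp (\<i> * of_real (2 * pi / L * x))"
      by (simp add: cis_conv_exp)
    then obtain n :: int where "\<i> * complex_of_real (2 * pi / L * y) = \<i> * complex_of_real (2 * pi / L * x) + of_int (2 * n) * pi * \<i>"
      unfolding exp_eq by blast
    then have "Im (\<i> * complex_of_real (2 * pi / L * y)) = Im (\<i> * complex_of_real (2 * pi / L * x) + of_int (2 * n) * pi * \<i>)"
      by simp
    then have "2 * pi / L * y = 2 * pi / L * x + of_int (2 * n) * pi" by simp
    then have "2 * pi * y = 2 * pi * (x + of_int n * L)" using L_pos by (simp add: field_simps)
    then have y: "y = x + of_int n * L" by simp
    have yi: "0 \<le> y" "y < L" using Arg_in[of "?c x"] by (auto simp: y_def)
    have "of_int n * L < 1 * L" "of_int n * L \<ge> (- 1) * L" using yi y x unfolding atLeastAtMost_iff by linarith+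
    then have "of_int n < (1::real)" "of_int n \<ge> (- 1 :: real)"
      using L_pos by (simp_all only: mult_less_cancel_right_pos mult_le_cancel_right_pos)
    then have "n < 1" "- 1 \<le> n" by linarith+
    then have "n = 0 \<or> n = - 1" by linarith
    then have "f y = f x"
    proof
      \<comment> \<open>Arguments lie in the half-open cell, so only x = L is represented by a
        different point, namely 0; here the equal end values enter.\<close>
      assume "n = - 1"
      then have "x = L" "y = 0" using y yi x by auto
      then show ?thesis using f by simp
    qed (use y in simp)
    then show ?thesis by (simp add: h_def y_def)
  qed
  \<comment> \<open>\<open>Arg2pi\<close> jumps at 1, so \<open>h\<close> is not visibly continuous
    as a composition. Instead the preimage of a closed set is recognised as the image of a compact
    subset of the cell.\<close>
  have "continuous_on (sphere 0 1) h"
    unfolding continuous_on_closed_invariant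
  proof (intro allI impI)
    fix B :: "real set" assume B: "closed B"
    let ?A = "?c ` ({0..L} \<inter> f -` B)"
    have "closed ({0..L} \<inter> f -` B)"
      using continuous_closed_preimage[OF f(1) _ B] by (simp add: Int_commute)
    then have "compact ({0..L} \<inter> f -` B)"
      using compact_Int_closed[of "{0..L}" "{0..L} \<inter> f -` B"] by (simp add: Int_assoc[symmetric])
    then have "compact ?A"
      by (intro compact_continuous_image continuous_intros)
    moreover have "?A \<inter> sphere 0 1 = h -` B \<inter> sphere 0 1"
    proof (intro equalityI subsetI)
      fix z assume "z \<in> ?A \<inter> sphere 0 1"
      then show "z \<in> h -` B \<inter> sphere 0 1" using h_c by auto
    next
      fix z assume z: "z \<in> h -` B \<inter> sphere 0 1"
      then have "L * Arg2pi z / (2 * pi) \<in> {0..L} \<inter> f -` B"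
        using Arg_in[of z] by (auto simp: h_def)
      then show "z \<in> ?A \<inter> sphere 0 1" using z c_Arg[of z] by (auto intro!: image_eqI)
    qed
    ultimately show "\<exists>A. closed A \<and> A \<inter> sphere 0 1 = h -` B \<inter> sphere 0 1"
      using compact_imp_closed by blast
  qed
  then obtain g where g: "real_polynomial_function g" "\<And>z. z \<in> sphere 0 1 \<Longrightarrow> \<bar>h z - g z\<bar> < e"
    using Stone_Weierstrass_real_polynomial_function[of "sphere 0 1" h e] e by auto
  have "cmod (of_real (f x) - of_real (g (?c x))) < e" if "x \<in> {0..L}" for x
    using g(2)[of "?c x"] h_c[OF that] by (simp flip: of_real_diff)
  with trig_real_polynomial[OF g(1)] show thesis by (rule that)
qed

lemma trig_dense:
  fixes f :: "real \<Rightarrow> complex"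
  assumes f: "continuous_on {0..L} f" "f 0 = f L" and e: "e > 0"
  obtains p where "trig p" "\<And>x. x \<in> {0..L} \<Longrightarrow> cmod (f x - p x) < e"
proof -
  obtain p where p: "trig p" "\<And>x. x \<in> {0..L} \<Longrightarrow> cmod (of_real (Re (f x)) - p x) < e/2"
    by (rule trig_dense_real[of "\<lambda>x. Re (f x)" "e/2"]) (use f e in \<open>auto intro!: continuous_intros\<close>)
  obtain q where q: "trig q" "\<And>x. x \<in> {0..L} \<Longrightarrow> cmod (of_real (Im (f x)) - q x) < e/2"
    by (rule trig_dense_real[of "\<lambda>x. Im (f x)" "e/2"]) (use f e in \<open>auto intro!: continuous_intros\<close>)
  have "cmod (f x - (p x + \<i> * q x)) < e" if "x \<in> {0..L}" for x
  proof -
    have "f x - (p x + \<i> * q x) = (of_real (Re (f x)) - p x) + \<i> * (of_real (Im (f x)) - q x)"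
      by (simp add: complex_eq_iff)
    then have "cmod (f x - (p x + \<i> * q x)) \<le> cmod (of_real (Re (f x)) - p x) + cmod (\<i> * (of_real (Im (f x)) - q x))"
      using norm_triangle_ineq by metis
    then have "cmod (f x - (p x + \<i> * q x)) \<le> cmod (of_real (Re (f x)) - p x) + cmod (of_real (Im (f x)) - q x)"
      unfolding norm_mult by simp
    then show ?thesis using p(2)[OF that] q(2)[OF that] by linarith
  qed
  with trig_add[OF p(1) trig_cmult[OF q(1)]] show thesis by (rule that)
qed

subsection \<open>Fourier coefficients and weak derivatives\<close>

lemma L2_sum_expo: "(\<lambda>x. \<Sum>n\<in>I. a n * expo n x) \<in> L2"
proof (induction I rule: infinite_finite_induct)
  case (insert n I)
  then show ?case using L2_add[OF L2_cmult[OF L2_expo]] by simp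
qed (auto intro!: L2_continuous)

lemma ip_minus_sum_expo:
  assumes "f \<in> L2" "finite I" "m \<notin> I"
  shows "ip (\<lambda>x. f x - (\<Sum>n\<in>I. a n * expo n x)) (expo m) = ip f (expo m)"
  using assms(2,3)
proof (induction I)
  case empty
  then show ?case by simp
next
  case (insert k I)
  have "(\<lambda>x. f x - (\<Sum>n\<in>insert k I. a n * expo n x)) =
      (\<lambda>x. (f x - (\<Sum>n\<in>I. a n * expo n x)) - a k * expo k x)"
    using insert by (auto simp: algebra_simps)
  moreover have "ip (\<lambda>x. (f x - (\<Sum>n\<in>I. a n * expo n x)) - a k * expo k x) (expo m)
      = ip (\<lambda>x. f x - (\<Sum>n\<in>I. a n * expo n x)) (expo m) - a k * ip (expo k) (expo m)"
    by (subst ip_diff_left) (auto intro!: L2_diff assms L2_sum_expo L2_cmult L2_expo simp: ip_cmult_left)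
  ultimately show ?case using insert by (simp add: ip_expo_expo)
qed

definition fcoeff :: "(real \<Rightarrow> complex) \<Rightarrow> int \<Rightarrow> complex" where
  "fcoeff f n = ip f (expo n) / of_real L"

text \<open>Each coefficient contributes a completed square. The identity is used with the Fourier
  coefficients themselves (Bessel), with the coefficients of an arbitrary approximant, and with a
  single frequency to split the mass of a perturbed plane wave.\<close>

lemma nrm_minus_sum_expo:
  assumes "f \<in> L2" "finite I"
  shows "(nrm (\<lambda>x. f x - (\<Sum>n\<in>I. a n * expo n x)))\<^sup>2 =
    (nrm f)\<^sup>2 + L * (\<Sum>n\<in>I. (cmod (a n - fcoeff f n))\<^sup>2 - (cmod (fcoeff f n))\<^sup>2)"
  using assms(2)
proof (induction I)
  case empty
  then show ?case by simp
next
  case (insert k I)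
  let ?g = "\<lambda>x. f x - (\<Sum>n\<in>I. a n * expo n x)"
  let ?h = "\<lambda>x. (- a k) * expo k x"
  have g: "?g \<in> L2" "?h \<in> L2"
    by (rule L2_diff[OF assms(1) L2_sum_expo], rule L2_cmult[OF L2_expo])
  have eq: "(\<lambda>x. f x - (\<Sum>n\<in>insert k I. a n * expo n x)) = (\<lambda>x. ?g x + ?h x)"
    using insert by (auto simp: algebra_simps)
  have ipg: "ip ?g ?h = - cnj (a k) * (of_real L * fcoeff f k)"
    using ip_minus_sum_expo[OF assms(1) insert(1,2), of a] L_pos
    unfolding ip_cmult_right by (simp add: fcoeff_def)
  have "ip (expo k) (expo k) = of_real ((nrm (expo k))\<^sup>2)" by (rule ip_self_nrm)
  then have "(nrm (expo k))\<^sup>2 = L" by (simp add: ip_expo_expo flip: of_real_power)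
  then have nh: "(nrm ?h)\<^sup>2 = (cmod (a k))\<^sup>2 * L"
    unfolding nrm_cmult by (simp add: power_mult_distrib)
  have alg: "(cmod (u - v))\<^sup>2 - (cmod v)\<^sup>2 = (cmod u)\<^sup>2 - 2 * Re (cnj u * v)" for u v
    unfolding cmod_power2 by (simp add: power2_eq_square algebra_simps)
  have "Re (ip ?g ?h) = - (L * Re (cnj (a k) * fcoeff f k))"
    unfolding ipg by (simp add: algebra_simps)
  then have "(nrm (\<lambda>x. ?g x + ?h x))\<^sup>2 = (nrm ?g)\<^sup>2 +
      L * ((cmod (a k - fcoeff f k))\<^sup>2 - (cmod (fcoeff f k))\<^sup>2)"
    unfolding nrm_add_sq[OF g] nh alg by (simp add: algebra_simps)
  then show ?case unfolding eq using insert by (simp add: algebra_simps)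
qed

lemma Bessel:
  assumes "f \<in> L2" "finite I"
  shows "L * (\<Sum>n\<in>I. (cmod (fcoeff f n))\<^sup>2) \<le> (nrm f)\<^sup>2"
proof -
  have "0 \<le> (nrm (\<lambda>x. f x - (\<Sum>n\<in>I. fcoeff f n * expo n x)))\<^sup>2" by simp
  then show ?thesis unfolding nrm_minus_sum_expo[OF assms] by (simp add: sum_negf)
qed

text \<open>Serves as a Poincare inequality with sharp constant and as a bound for difference quotients.\<close>

lemma nrm_le_by_coeffs:
  assumes f: "continuous_on UNIV f" "\<And>x. f (x + L) = f x" and q: "q \<in> L2" and A: "0 \<le> A"
    and le: "\<And>n. cmod (ip f (expo n)) \<le> A * cmod (ip q (expo n))"
  shows "nrm f \<le> A * nrm q"
proof -
  have fL: "f \<in> L2" using f by (rule L2_continuous)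
  have "(nrm f)\<^sup>2 \<le> (A * nrm q)\<^sup>2 + e * L" if "e > 0" for e
  proof -
    have "continuous_on {0..L} f" "f 0 = f L" "0 < sqrt e"
      using f(1) f(2)[of 0] that continuous_on_subset[of UNIV f] by auto
    then obtain p where p: "trig p" "\<And>x. x \<in> {0..L} \<Longrightarrow> cmod (f x - p x) < sqrt e"
      using trig_dense by metis
    obtain I a where I: "finite I" "p = (\<lambda>x. \<Sum>n\<in>I. a n * expo n x)"
      using trig_representation[OF p(1)] by blast
    have "(nrm (\<lambda>x. f x - p x))\<^sup>2 \<le> e * L"
      unfolding nrm_sq
    proof (rule integral_TL_mono_const)
      show "(\<lambda>x. (cmod (f x - p x))\<^sup>2) \<in> borel_measurable TL"
        using L2_measurable_TL[OF fL] L2_measurable_TL[OF L2_trig[OF p(1)]] by measurable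
      fix x assume "x \<in> {0..L}"
      then have "(cmod (f x - p x))\<^sup>2 \<le> (sqrt e)\<^sup>2"
        using p(2)[of x] by (intro power_mono) auto
      then show "(cmod (f x - p x))\<^sup>2 \<le> e" using that by simp
    qed (use that in simp)
    then have "(nrm f)\<^sup>2 + L * (\<Sum>n\<in>I. (cmod (a n - fcoeff f n))\<^sup>2 - (cmod (fcoeff f n))\<^sup>2) \<le> e * L"
      unfolding I(2) nrm_minus_sum_expo[OF fL I(1)] .
    \<comment> \<open>Dropping the squares of \<open>a n - fcoeff f n\<close> shows that the
      frequencies of any good uniform approximant carry all but \<open>e * L\<close> of the squared
      norm; this stands in for Parseval's identity.\<close>
    moreover have "L * (\<Sum>n\<in>I. (cmod (a n - fcoeff f n))\<^sup>2 - (cmod (fcoeff f n))\<^sup>2) \<ge>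
        - (L * (\<Sum>n\<in>I. (cmod (fcoeff f n))\<^sup>2))"
      using L_pos unfolding sum_subtractf right_diff_distrib by (simp add: sum_nonneg)
    moreover have "L * (\<Sum>n\<in>I. (cmod (fcoeff f n))\<^sup>2) \<le> L * (\<Sum>n\<in>I. A\<^sup>2 * (cmod (fcoeff q n))\<^sup>2)"
    proof (intro mult_left_mono sum_mono)
      fix n
      have "cmod (fcoeff f n) \<le> A * cmod (fcoeff q n)"
        using le[of n] L_pos by (simp add: fcoeff_def norm_divide divide_right_mono)
      then have "(cmod (fcoeff f n))\<^sup>2 \<le> (A * cmod (fcoeff q n))\<^sup>2" by (intro power_mono) auto
      then show "(cmod (fcoeff f n))\<^sup>2 \<le> A\<^sup>2 * (cmod (fcoeff q n))\<^sup>2" by (simp add: power_mult_distrib)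
    qed (use L_pos in simp)
    moreover have "L * (\<Sum>n\<in>I. A\<^sup>2 * (cmod (fcoeff q n))\<^sup>2) = A\<^sup>2 * (L * (\<Sum>n\<in>I. (cmod (fcoeff q n))\<^sup>2))"
      by (simp add: sum_distrib_left[symmetric] algebra_simps)
    moreover have "A\<^sup>2 * (L * (\<Sum>n\<in>I. (cmod (fcoeff q n))\<^sup>2)) \<le> A\<^sup>2 * (nrm q)\<^sup>2"
      by (intro mult_left_mono Bessel q I) auto
    ultimately show ?thesis unfolding power_mult_distrib by linarith
  qed
  then have "(nrm f)\<^sup>2 \<le> (A * nrm q)\<^sup>2 + e" if "e > 0" for e
    using that L_pos by (metis divide_pos_pos nonzero_divide_eq_eq less_irrefl)
  then have "(nrm f)\<^sup>2 \<le> (A * nrm q)\<^sup>2" by (rule field_le_epsilon)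
  then show ?thesis by (rule power2_le_imp_le) (use A in auto)
qed

text \<open>As \<open>h\<close> is orthogonal to every trigonometric p, its squared norm is the
  pairing with h - p, at most sup |h| times sup |h - p| times L. The hypotheses live on the closed
  cell because the lemma is meant for a primitive \<open>integral {0..x} g\<close>, which can fail
  to be periodic on the whole line.\<close>

lemma continuous_zero_if_orthogonal:
  assumes h: "continuous_on {0..L} h" "h 0 = h L" and orth: "\<And>n. ip h (expo n) = 0" and x: "x \<in> {0..L}"
  shows "h x = 0"
proof -
  interpret finite_measure TL by (rule finite_measure_TL)
  obtain B where B: "\<And>x. x \<in> {0..L} \<Longrightarrow> cmod (h x) \<le> B" "B > 0"
    using continuous_on_Icc_bounded[OF h(1)] by blast
  have int: "integrable TL (\<lambda>x. h x * cnj (p x))" if p: "continuous_on {0..L} p" for p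
  proof -
    have "set_integrable lborel {0..L} (\<lambda>x. h x * cnj (p x))"
      unfolding set_integrable_def
      by (rule borel_integrable_compact) (auto intro!: continuous_intros h p)
    then show ?thesis by (simp add: set_integrable_def integrable_restrict_space)
  qed
  have orth': "ip h p = 0" if "trig p" for p
    using that
  proof induction
    case (trig_expo c n)
    then show ?case by (simp add: ip_cmult_right orth)
  next
    case (trig_add f g)
    then show ?case
      unfolding ip_eq using int[OF continuous_trig, of f] int[OF continuous_trig, of g]
      by (simp add: distrib_left)
  qed
  have le: "integral\<^sup>L TL (\<lambda>x. (cmod (h x))\<^sup>2) \<le> e" if e: "e > 0" for e
  proof -
    define e' where "e' = e / (B * L)"
    have e': "e' > 0" using e B L_pos by (simp add: e'_def)
    obtain p where p: "trig p" "\<And>x. x \<in> {0..L} \<Longrightarrow> cmod (h x - p x) < e'"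
      using trig_dense[OF h e'] by blast
    have "complex_of_real (integral\<^sup>L TL (\<lambda>x. (cmod (h x))\<^sup>2)) = ip h h" by (rule ip_self[symmetric])
    also have "\<dots> = ip h h - ip h p" using orth'[OF p(1)] by simp
    also have "\<dots> = integral\<^sup>L TL (\<lambda>x. h x * cnj (h x) - h x * cnj (p x))"
      unfolding ip_eq by (rule Bochner_Integration.integral_diff[symmetric]) (intro int h continuous_trig p)+
    finally have "\<bar>integral\<^sup>L TL (\<lambda>x. (cmod (h x))\<^sup>2)\<bar> = cmod (integral\<^sup>L TL (\<lambda>x. h x * cnj (h x) - h x * cnj (p x)))"
      by (metis norm_of_real real_norm_def)
    also have "\<dots> \<le> integral\<^sup>L TL (\<lambda>x. cmod (h x * cnj (h x) - h x * cnj (p x)))"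
      by (rule integral_norm_bound)
    also have "\<dots> \<le> (B * e') * L"
    proof (rule integral_TL_mono_const)
      have "(\<lambda>x. h x * cnj (h x) - h x * cnj (p x)) \<in> borel_measurable TL"
        by (intro borel_measurable_integrable Bochner_Integration.integrable_diff int h continuous_trig p)
      then show "(\<lambda>x. cmod (h x * cnj (h x) - h x * cnj (p x))) \<in> borel_measurable TL"
        by measurable
      fix x assume x: "x \<in> {0..L}"
      have "cmod (h x * cnj (h x) - h x * cnj (p x)) = cmod (h x) * cmod (h x - p x)"
        by (simp flip: right_diff_distrib complex_cnj_diff add: norm_mult del: complex_cnj_diff)
      also have "\<dots> \<le> B * e'" using B(1)[OF x] p(2)[OF x] B(2) by (intro mult_mono) auto
      finally show "cmod (h x * cnj (h x) - h x * cnj (p x)) \<le> B * e'" .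
    qed (use B e' in auto)
    also have "\<dots> = e" using B L_pos by (simp add: e'_def)
    finally show ?thesis by simp
  qed
  have "integral\<^sup>L TL (\<lambda>x. (cmod (h x))\<^sup>2) \<le> 0"
    by (rule field_le_epsilon) (simp add: le)
  moreover have "0 \<le> integral\<^sup>L TL (\<lambda>x. (cmod (h x))\<^sup>2)"
    by (rule integral_nonneg_AE) simp
  ultimately have "integral\<^sup>L TL (\<lambda>x. (cmod (h x))\<^sup>2) = 0" by linarith
  then show ?thesis using h(1) x by (intro square_integral_eq_0D) auto
qed

section \<open>Weak derivatives: Fourier coefficients, primitives, uniqueness\<close>

definition has_weak_deriv :: "(real \<Rightarrow> complex) \<Rightarrow> (real \<Rightarrow> complex) \<Rightarrow> bool" where
  "has_weak_deriv u g \<longleftrightarrow> g \<in> L2 \<and> weak_deriv L u g"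

text \<open>The conjugate exponential is an admissible test function; \<open>weak_deriv\<close> asks
  for the whole sequence of its derivatives, which is geometric.\<close>

lemma weak_deriv_expo:
  assumes "has_weak_deriv u g"
  shows "ip g (expo n) = \<i> * of_real (2 * pi / L * of_int n) * ip u (expo n)"
proof -
  define c where "c = \<i> * complex_of_real (2 * pi / L * of_int (- n))"
  define D where "D j x = c ^ j * expo (- n) x" for j :: nat and x
  have "torus_periodic L (D 0)" by (simp add: torus_periodic_def D_def expo_periodic)
  moreover have "(D j has_vector_derivative D (Suc j) x) (at x)" for j x
  proof -
    have "((\<lambda>x. c ^ j * expo (- n) x) has_vector_derivative c ^ j * (c * expo (- n) x)) (at x)"
      unfolding c_def by (intro has_vector_derivative_mult_right expo_deriv)
    then show ?thesis by (simp add: D_def[abs_def] mult_ac)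
  qed
  ultimately have "torus_integral L (\<lambda>x. u x * D 1 x) = - torus_integral L (\<lambda>x. g x * D 0 x)"
    using assms unfolding has_weak_deriv_def weak_deriv_def by blast
  moreover have "torus_integral L (\<lambda>x. u x * D 1 x) = c * ip u (expo n)"
    unfolding torus_integral_eq ip_eq D_def integral_mult_right_zero[symmetric]
    by (intro Bochner_Integration.integral_cong) auto
  moreover have "torus_integral L (\<lambda>x. g x * D 0 x) = ip g (expo n)"
    unfolding torus_integral_eq ip_eq D_def by simp
  ultimately show ?thesis by (simp add: c_def)
qed

lemma L2_set_integrable:
  assumes "g \<in> L2" "x \<le> L"
  shows "set_integrable lborel {0..x} g"
proof -
  have "set_integrable lborel {0..L} g"
    using L2_integrable[OF assms(1)] by (simp add: set_integrable_def integrable_restrict_space)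
  then show ?thesis by (rule set_integrable_subset) (use assms(2) in auto)
qed

lemma integral_indicator_TL:
  assumes "g \<in> L2" "x \<in> {0..L}"
  shows "integral\<^sup>L TL (\<lambda>y. indicator {..x} y *\<^sub>R g y) = integral {0..x} g"
proof -
  have "integral\<^sup>L TL (\<lambda>y. indicator {..x} y *\<^sub>R g y) = integral\<^sup>L lborel (\<lambda>y. indicator {0..x} y *\<^sub>R g y)"
    by (subst integral_restrict_space)
       (use assms in \<open>auto intro!: Bochner_Integration.integral_cong simp: indicator_def\<close>)
  also have "\<dots> = integral {0..x} g"
    using set_borel_integral_eq_integral(2)[OF L2_set_integrable[OF assms(1)]] assms(2)
    by (simp add: set_lebesgue_integral_def)
  finally show ?thesis .
qed

text \<open>Fubini on the triangle y \<le> x: the inner integral in y is the primitive of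
  \<open>g\<close>, the one in x is \<open>D L - D y\<close>.\<close>

lemma integral_by_parts_primitive:
  assumes g: "g \<in> L2" and D: "\<And>x. (D has_vector_derivative E x) (at x)" and E: "continuous_on UNIV E"
  shows "integral\<^sup>L TL (\<lambda>x. integral {0..x} g * E x) = integral\<^sup>L TL (\<lambda>y. g y * (D L - D y))"
proof -
  interpret T: finite_measure TL by (rule finite_measure_TL)
  interpret pair_sigma_finite TL TL ..
  define f where "f y x = indicator {..x} y *\<^sub>R (g y * E x)" for y x :: real
  have gm: "g \<in> borel_measurable TL" using g by (rule L2_measurable_TL)
  have Em: "E \<in> borel_measurable TL" using E by (intro measurable_TL borel_measurable_continuous_onI)
  have idsnd: "(\<lambda>z. snd z) \<in> borel_measurable (TL \<Otimes>\<^sub>M TL)" "(\<lambda>z. fst z) \<in> borel_measurable (TL \<Otimes>\<^sub>M TL)"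
    by (rule measurable_compose[OF measurable_snd], rule measurable_TL, simp)
       (rule measurable_compose[OF measurable_fst], rule measurable_TL, simp)
  have fm: "case_prod f \<in> borel_measurable (TL \<Otimes>\<^sub>M TL)"
  proof -
    have eq: "case_prod f = (\<lambda>z. if fst z \<le> snd z then g (fst z) * E (snd z) else 0)"
      by (auto simp: f_def fun_eq_iff)
    have 1: "(\<lambda>z. g (fst z)) \<in> borel_measurable (TL \<Otimes>\<^sub>M TL)" "(\<lambda>z. E (snd z)) \<in> borel_measurable (TL \<Otimes>\<^sub>M TL)"
      by (rule measurable_compose[OF measurable_fst gm], rule measurable_compose[OF measurable_snd Em])
    have 2: "{z \<in> space (TL \<Otimes>\<^sub>M TL). fst z \<le> snd z} \<in> sets (TL \<Otimes>\<^sub>M TL)"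
      using idsnd by measurable
    show ?thesis unfolding eq using 1 2 by (intro measurable_If borel_measurable_times) auto
  qed
  obtain B where B: "\<And>x. x \<in> {0..L} \<Longrightarrow> cmod (E x) \<le> B" "B > 0"
    using continuous_on_Icc_bounded[OF continuous_on_subset[OF E]] by blast
  have fB: "norm (f y x) \<le> cmod (g y) * B" if "x \<in> {0..L}" for x y
    using B(1)[OF that] B(2) by (auto simp: f_def indicator_def norm_mult intro: mult_left_mono)
  have fym: "(\<lambda>x. f y x) \<in> borel_measurable TL" if "y \<in> {0..L}" for y
    using measurable_Pair2[OF fm, of y] that by simp
  have "integrable (TL \<Otimes>\<^sub>M TL) (case_prod f)"
  proof (rule Fubini_integrable[OF fm])
    have *: "(\<lambda>y. \<integral>x. norm (case_prod f (y, x)) \<partial>TL) \<in> borel_measurable TL"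
    proof -
      have "(\<lambda>z. norm (case_prod f z)) \<in> borel_measurable (TL \<Otimes>\<^sub>M TL)" using fm by measurable
      moreover have "(\<lambda>z. norm (case_prod f z)) = case_prod (\<lambda>y x. norm (f y x))" by auto
      ultimately show ?thesis using T.borel_measurable_lebesgue_integral[of "\<lambda>y x. norm (f y x)" TL] by simp
    qed
    show "integrable TL (\<lambda>y. \<integral>x. norm (case_prod f (y, x)) \<partial>TL)"
    proof (rule Bochner_Integration.integrable_bound[OF _ *])
      show "integrable TL (\<lambda>y. (cmod (g y) * B) * L)"
        using integrable_norm[OF L2_integrable[OF g]] by simp
      have "\<bar>\<integral>x. norm (f y x) \<partial>TL\<bar> \<le> \<bar>cmod (g y) * B * L\<bar>" if "y \<in> {0..L}" for y
      proof -
        have "(\<integral>x. norm (f y x) \<partial>TL) \<le> (cmod (g y) * B) * L"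
          using B(2) fB fym[OF that] by (intro integral_TL_mono_const) auto
        then show ?thesis using B(2) L_pos by (simp add: integral_nonneg_AE)
      qed
      then show "AE y in TL. norm (\<integral>x. norm (case_prod f (y, x)) \<partial>TL) \<le> norm (cmod (g y) * B * L)"
        by (intro AE_I2) simp
    qed
    have "integrable TL (\<lambda>x. f y x)" if "y \<in> {0..L}" for y
      using fB by (intro T.integrable_const_bound[of _ "cmod (g y) * B"] fym that AE_I2) auto
    then show "AE y in TL. integrable TL (\<lambda>x. case_prod f (y, x))"
      by (intro AE_I2) simp
  qed
  from Fubini_integral[OF this]
  have "(\<integral>x. (\<integral>y. f y x \<partial>TL) \<partial>TL) = (\<integral>y. (\<integral>x. f y x \<partial>TL) \<partial>TL)" .
  moreover have "(\<integral>x. (\<integral>y. f y x \<partial>TL) \<partial>TL) = integral\<^sup>L TL (\<lambda>x. integral {0..x} g * E x)"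
  proof (rule Bochner_Integration.integral_cong)
    fix x assume "x \<in> space TL"
    then have "integral\<^sup>L TL (\<lambda>y. indicator {..x} y *\<^sub>R g y) * E x = integral {0..x} g * E x"
      by (simp add: integral_indicator_TL[OF g])
    then show "(\<integral>y. f y x \<partial>TL) = integral {0..x} g * E x"
      unfolding f_def by (simp only: mult_scaleR_left[symmetric] integral_mult_left_zero)
  qed simp
  moreover have "(\<integral>y. (\<integral>x. f y x \<partial>TL) \<partial>TL) = integral\<^sup>L TL (\<lambda>y. g y * (D L - D y))"
  proof (rule Bochner_Integration.integral_cong)
    fix y assume "y \<in> space TL"
    then have "g y * integral\<^sup>L TL (\<lambda>x. indicator {y..} x *\<^sub>R E x) = g y * (D L - D y)"
      by (simp add: integral_TL_deriv[OF D E])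
    moreover have "f y x = g y * (indicator {y..} x *\<^sub>R E x)" for x
      by (simp add: f_def indicator_def)
    ultimately show "(\<integral>x. f y x \<partial>TL) = g y * (D L - D y)"
      by (simp only: integral_mult_right_zero)
  qed simp
  ultimately show ?thesis by simp
qed

text \<open>Integration by parts shows that \<open>u\<close> and the primitive of \<open>g\<close>
  have equal Fourier coefficients at all nonzero frequencies, so they differ by a constant on the
  cell.\<close>

lemma weak_deriv_FTC:
  assumes u: "continuous_on UNIV u" "\<And>x. u (x + L) = u x" and g: "has_weak_deriv u g" and x: "x \<in> {0..L}"
  shows "u x = u 0 + integral {0..x} g"
proof -
  have gL: "g \<in> L2" using g by (simp add: has_weak_deriv_def)
  have uL: "u \<in> L2" using u by (rule L2_continuous)
  define G where "G x = integral {0..x} g" for x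
  have G: "continuous_on {0..L} G"
    unfolding G_def using set_borel_integral_eq_integral(1)[OF L2_set_integrable[OF gL, of L]]
    by (intro indefinite_integral_continuous_1) auto
  have "ip g (expo 0) = 0" using weak_deriv_expo[OF g, of 0] by simp
  moreover have "ip g (expo 0) = integral\<^sup>L TL (\<lambda>y. indicator {..L} y *\<^sub>R g y)"
    unfolding ip_eq by (intro Bochner_Integration.integral_cong) auto
  \<comment> \<open>The mean of a weak derivative vanishes, so the primitive closes up and the
    uniqueness lemma for Fourier coefficients can be applied to it.\<close>
  ultimately have GL: "G L = 0" using integral_indicator_TL[OF gL, of L] L_pos by (simp add: G_def)
  have Gint: "integrable TL (\<lambda>x. G x * cnj (expo n x))" for n
  proof -
    have "set_integrable lborel {0..L} (\<lambda>x. G x * cnj (expo n x))"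
      unfolding set_integrable_def
      by (rule borel_integrable_compact) (auto intro!: continuous_intros G continuous_expo)
    then show ?thesis by (simp add: set_integrable_def integrable_restrict_space)
  qed
  have ipG: "ip G (expo n) = ip u (expo n)" if n: "n \<noteq> 0" for n
  proof -
    define c where "c = \<i> * complex_of_real (2 * pi / L * of_int (- n))"
    have c: "c \<noteq> 0" using n L_pos by (simp add: c_def)
    have "c * ip G (expo n) = integral\<^sup>L TL (\<lambda>x. G x * (c * expo (- n) x))"
      unfolding ip_eq integral_mult_right_zero[symmetric]
      by (intro Bochner_Integration.integral_cong) auto
    also have "\<dots> = integral\<^sup>L TL (\<lambda>y. g y * (expo (- n) L - expo (- n) y))"
      unfolding G_def
    proof (rule integral_by_parts_primitive[OF gL])
      show "(expo (- n) has_vector_derivative c * expo (- n) x) (at x)" for x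
        unfolding c_def by (rule expo_deriv)
      show "continuous_on UNIV (\<lambda>x. c * expo (- n) x)" by (intro continuous_intros continuous_expo)
    qed
    also have "\<dots> = ip g (expo 0) - ip g (expo n)"
    proof -
      have "ip g (expo 0) - ip g (expo n) = integral\<^sup>L TL (\<lambda>y. g y * cnj (expo 0 y) - g y * cnj (expo n y))"
        unfolding ip_eq by (intro Bochner_Integration.integral_diff[symmetric] ip_integrable gL L2_expo)
      then show ?thesis by (simp add: right_diff_distrib)
    qed
    also have "\<dots> = c * ip u (expo n)"
      using \<open>ip g (expo 0) = 0\<close> weak_deriv_expo[OF g, of n] by (simp add: c_def)
    finally show ?thesis using c by simp
  qed
  \<comment> \<open>The mean of u - G, which corrects the one frequency that integration by parts
    leaves undetermined.\<close>
  define m where "m = (ip u (expo 0) - ip G (expo 0)) / of_real L"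
  define h where "h x = u x - G x - m" for x
  have h0: "h x = 0" if x: "x \<in> {0..L}" for x
  proof (rule continuous_zero_if_orthogonal[OF _ _ _ x])
    show "continuous_on {0..L} h"
      unfolding h_def by (intro continuous_intros G continuous_on_subset[OF u(1)]) auto
    show "h 0 = h L" using u(2)[of 0] GL by (simp add: h_def G_def)
    fix n
    have "ip h (expo n) = ip u (expo n) - ip G (expo n) - m * ip (expo 0) (expo n)"
    proof -
      have "integrable TL (\<lambda>x. m * (expo 0 x * cnj (expo n x)))"
        by (intro integrable_mult_right ip_integrable L2_expo)
      then have "ip u (expo n) - ip G (expo n) - m * ip (expo 0) (expo n) = integral\<^sup>L TL (\<lambda>x. u x * cnj (expo n x)
          - G x * cnj (expo n x) - m * (expo 0 x * cnj (expo n x)))"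
        unfolding ip_eq integral_mult_right_zero[symmetric]
        using ip_integrable[OF uL L2_expo, of n] Gint[of n]
        by (subst Bochner_Integration.integral_diff Bochner_Integration.integral_diff;
            (intro Bochner_Integration.integrable_diff)?; simp)
      also have "\<dots> = ip h (expo n)" unfolding ip_eq h_def
        by (intro Bochner_Integration.integral_cong) (auto simp: algebra_simps)
      finally show ?thesis ..
    qed
    then show "ip h (expo n) = 0"
      using ipG[of n] L_pos unfolding ip_expo_expo by (cases "n = 0") (auto simp: m_def)
  qed
  show ?thesis using h0[OF x] h0[of 0] L_pos by (simp add: h_def G_def algebra_simps)
qed

text \<open>By \<open>weak_deriv_FTC\<close> two weak derivatives have equal integrals over all
  initial segments; these are stable under intersection and generate the Borel sets, so the
  integrals agree on every Borel set. As \<open>h1_deriv\<close> is a choice, this is what makes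
  statements about it independent of the choice.\<close>

lemma weak_deriv_unique_AE:
  assumes u: "continuous_on UNIV u" "\<And>x. u (x + L) = u x"
    and g: "has_weak_deriv u g" and g': "has_weak_deriv u g'"
  shows "AE x in TL. g x = g' x"
proof -
  define r where "r x = g x - g' x" for x
  have gL: "g \<in> L2" "g' \<in> L2" using g g' by (auto simp: has_weak_deriv_def)
  have rL: "r \<in> L2" unfolding r_def using gL by (rule L2_diff)
  have r_int: "integrable TL r" by (rule L2_integrable[OF rL])
  have set_int: "set_integrable TL A r" if "A \<in> sets TL" for A
    using integrable_mult_indicator[OF that r_int] by (simp add: set_integrable_def)
  have r0: "integral {0..x} r = 0" if x: "x \<in> {0..L}" for x
  proof -
    have "integral {0..x} g = integral {0..x} g'"
      using weak_deriv_FTC[OF u g x] weak_deriv_FTC[OF u g' x] by simp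
    moreover have "g integrable_on {0..x}" "g' integrable_on {0..x}"
      using gL[THEN L2_set_integrable, THEN set_borel_integral_eq_integral(1)] x by auto
    ultimately show ?thesis unfolding r_def by (simp add: Henstock_Kurzweil_Integration.integral_diff)
  qed
  have atMost0: "set_lebesgue_integral TL {..x} r = 0" if "0 \<le> x" for x
  proof -
    have "set_lebesgue_integral TL {..x} r = integral\<^sup>L TL (\<lambda>y. indicator {..min x L} y *\<^sub>R r y)"
      unfolding set_lebesgue_integral_def
      by (intro Bochner_Integration.integral_cong) (auto simp: indicator_def)
    then show ?thesis using integral_indicator_TL[OF rL, of "min x L"] r0[of "min x L"] that L_pos by simp
  qed
  have bor: "A \<in> sets borel \<Longrightarrow> A \<inter> {0..L} \<in> sets TL" for A :: "real set"
    by (subst sets_restrict_space) auto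
  have zero: "set_lebesgue_integral TL (A \<inter> {0..L}) r = 0" if "A \<in> sets borel" for A
  proof -
    have nls_gen: "sets borel = sigma_sets UNIV (range (\<lambda>a::real. {..a}))"
      unfolding borel_eq_atMost by (rule sets_measure_of) simp
    have st: "Int_stable (range (\<lambda>a::real. {..a}))"
      by (auto simp: Int_stable_def)
    have cl: "range (\<lambda>a::real. {..a}) \<subseteq> Pow UNIV" by simp
    have "A \<in> sigma_sets UNIV (range (\<lambda>a::real. {..a}))" using that nls_gen by simp
    from st cl this show ?thesis
    proof (induction rule: sigma_sets_induct_disjoint)
      case (basic A)
      then obtain a where A: "A = {..a}" by auto
      have eq: "set_lebesgue_integral TL ({..a} \<inter> {0..L}) r = set_lebesgue_integral TL {..a} r"
        unfolding set_lebesgue_integral_def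
        by (intro Bochner_Integration.integral_cong) (auto simp: indicator_def)
      show ?case
      proof (cases "0 \<le> a")
        case True
        then show ?thesis unfolding A eq by (rule atMost0)
      next
        case False
        then have "{..a} \<inter> {0..L} = {}" by auto
        then show ?thesis unfolding A by (simp add: set_lebesgue_integral_def)
      qed
    next
      case empty
      then show ?case by (simp add: set_lebesgue_integral_def)
    next
      case (compl A)
      then have A: "A \<in> sets borel" using nls_gen by simp
      have "set_lebesgue_integral TL ((A \<inter> {0..L}) \<union> ((UNIV - A) \<inter> {0..L})) r =
          set_lebesgue_integral TL (A \<inter> {0..L}) r + set_lebesgue_integral TL ((UNIV - A) \<inter> {0..L}) r"
        by (intro set_integral_Un set_int bor) (use A in auto)
      moreover have "(A \<inter> {0..L}) \<union> ((UNIV - A) \<inter> {0..L}) = {0..L}" by auto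
      moreover have "set_lebesgue_integral TL {0..L} r = set_lebesgue_integral TL {..L} r"
        unfolding set_lebesgue_integral_def
        by (intro Bochner_Integration.integral_cong) (auto simp: indicator_def)
      ultimately show ?case using compl(2) atMost0[of L] L_pos by simp
    next
      case (union A)
      then have A: "A i \<in> sets borel" for i using nls_gen by (simp add: range_subsetD)
      have "set_lebesgue_integral TL (\<Union>i. A i \<inter> {0..L}) r = (\<Sum>i. set_lebesgue_integral TL (A i \<inter> {0..L}) r)"
      proof (rule lebesgue_integral_countable_add)
        show "A i \<inter> {0..L} \<in> sets TL" for i by (rule bor[OF A])
        show "A i \<inter> {0..L} \<inter> (A j \<inter> {0..L}) = {}" if "i \<noteq> j" for i j
          using union(1) that by (auto simp: disjoint_family_on_def)
        show "set_integrable TL (\<Union>i. A i \<inter> {0..L}) r"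
          by (intro set_int sets.countable_UN) (auto intro: bor A)
      qed
      also have "\<dots> = 0" using union(3) by simp
      also have "(\<Union>i. A i \<inter> {0..L}) = (\<Union>i. A i) \<inter> {0..L}" by auto
      finally show ?case .
    qed
  qed
  interpret T: finite_measure TL by (rule finite_measure_TL)
  have "AE x in TL. r x = 0"
  proof (rule T.density_zero[OF r_int])
    fix A assume "A \<in> sets TL"
    then obtain B where "B \<in> sets borel" "A = {0..L} \<inter> B" by (auto simp: sets_restrict_space)
    then show "set_lebesgue_integral TL A r = 0" using zero[of B] by (simp add: Int_commute)
  qed
  then show ?thesis by (simp add: r_def)
qed

lemma ip_cong_AE:
  assumes "AE x in TL. g x = g' x" "g \<in> L2" "g' \<in> L2" "h \<in> L2"
  shows "ip g h = ip g' h"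
  unfolding ip_eq
proof (rule integral_cong_AE)
  show "AE x in TL. g x * cnj (h x) = g' x * cnj (h x)" using assms(1) by (rule eventually_mono) simp
qed (use assms in \<open>auto intro!: borel_measurable_integrable ip_integrable\<close>)

lemma nrm_cong_AE:
  assumes "AE x in TL. g x = g' x" "g \<in> L2" "g' \<in> L2"
  shows "nrm g = nrm g'"
proof -
  have "ip g g = ip g' g" using assms by (intro ip_cong_AE)
  also have "\<dots> = cnj (ip g g')" by (rule ip_cnj[symmetric])
  also have "ip g g' = ip g' g'" using assms by (intro ip_cong_AE)
  finally show ?thesis by (simp add: nrm_def)
qed

text \<open>Only the first member of a test sequence is required to be periodic; translation
  commutes with differentiation, so the others inherit it.\<close>

lemma test_function_L2:
  assumes "torus_periodic L (D 0)" and D: "\<And>n x. (D n has_vector_derivative D (Suc n) x) (at x)"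
  shows "D n \<in> L2"
proof -
  have "D n (x + L) = D n x" for x
  proof (induction n arbitrary: x)
    case 0 then show ?case using assms(1) by (simp add: torus_periodic_def)
  next
    case (Suc n)
    have "((D n \<circ> (\<lambda>x. x + L)) has_vector_derivative 1 *\<^sub>R D (Suc n) (x + L)) (at x)"
      by (rule vector_diff_chain_at) (auto intro!: derivative_eq_intros D)
    moreover have "D n \<circ> (\<lambda>x. x + L) = D n" using Suc by auto
    ultimately show ?case using vector_derivative_unique_at[OF _ D[of n x]] by simp
  qed
  moreover have "continuous_on UNIV (D n)"
    using D by (intro continuous_at_imp_continuous_on) (auto intro: has_vector_derivative_continuous)
  ultimately show ?thesis by (intro L2_continuous)
qed

lemma has_weak_deriv_L2: "has_weak_deriv u g \<Longrightarrow> g \<in> L2"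
  by (simp add: has_weak_deriv_def)

lemma has_weak_deriv_cmult:
  assumes "has_weak_deriv u g"
  shows "has_weak_deriv (\<lambda>x. c * u x) (\<lambda>x. c * g x)"
  using assms unfolding has_weak_deriv_def weak_deriv_def torus_integral_eq
  by (auto intro!: L2_cmult simp: mult.assoc)

lemma has_weak_deriv_diff:
  assumes "has_weak_deriv u g" "has_weak_deriv v h" "u \<in> L2" "v \<in> L2"
  shows "has_weak_deriv (\<lambda>x. u x - v x) (\<lambda>x. g x - h x)"
  unfolding has_weak_deriv_def weak_deriv_def
proof (intro conjI allI impI)
  show "(\<lambda>x. g x - h x) \<in> L2" using assms(1,2)[THEN has_weak_deriv_L2] by (rule L2_diff)
  fix D assume D: "torus_periodic L (D 0)" "\<forall>n x. (D n has_vector_derivative D (Suc n) x) (at x)"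
  have DL: "D n \<in> L2" for n using test_function_L2[of D n] D by simp
  have "torus_integral L (\<lambda>x. (u x - v x) * D 1 x) = torus_integral L (\<lambda>x. u x * D 1 x) - torus_integral L (\<lambda>x. v x * D 1 x)"
    unfolding torus_integral_eq left_diff_distrib
    by (intro Bochner_Integration.integral_diff L2_mult_integrable assms DL)
  moreover have "torus_integral L (\<lambda>x. (g x - h x) * D 0 x) = torus_integral L (\<lambda>x. g x * D 0 x) - torus_integral L (\<lambda>x. h x * D 0 x)"
    unfolding torus_integral_eq left_diff_distrib
    by (intro Bochner_Integration.integral_diff L2_mult_integrable DL) (use assms in \<open>auto intro: has_weak_deriv_L2\<close>)
  moreover have "torus_integral L (\<lambda>x. u x * D 1 x) = - torus_integral L (\<lambda>x. g x * D 0 x)"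
    "torus_integral L (\<lambda>x. v x * D 1 x) = - torus_integral L (\<lambda>x. h x * D 0 x)"
    using assms(1,2) D unfolding has_weak_deriv_def weak_deriv_def by blast+
  ultimately show "torus_integral L (\<lambda>x. (u x - v x) * D 1 x) = - torus_integral L (\<lambda>x. (g x - h x) * D 0 x)"
    by simp
qed

lemma has_weak_deriv_expo:
  "has_weak_deriv (expo m) (\<lambda>x. \<i> * of_real (2 * pi / L * of_int m) * expo m x)"
  unfolding has_weak_deriv_def weak_deriv_def
proof (intro conjI allI impI)
  let ?c = "\<i> * complex_of_real (2 * pi / L * of_int m)"
  show "(\<lambda>x. ?c * expo m x) \<in> L2" by (intro L2_cmult L2_expo)
  fix D assume D: "torus_periodic L (D 0)" "\<forall>n x. (D n has_vector_derivative D (Suc n) x) (at x)"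
  have DL: "D n \<in> L2" for n using test_function_L2[of D n] D by simp
  have Dc: "continuous_on UNIV (D n)" for n
    using D by (intro continuous_at_imp_continuous_on) (auto intro: has_vector_derivative_continuous)
  have "integral\<^sup>L TL (\<lambda>x. expo m x * D 1 x + ?c * expo m x * D 0 x) = expo m L * D 0 L - expo m 0 * D 0 0"
  proof (rule integral_TL_deriv0)
    show "((\<lambda>x. expo m x * D 0 x) has_vector_derivative expo m x * D 1 x + ?c * expo m x * D 0 x) (at x)" for x
      using D by (intro has_vector_derivative_mult expo_deriv) simp
    show "continuous_on UNIV (\<lambda>x. expo m x * D 1 x + ?c * expo m x * D 0 x)"
      by (intro continuous_intros continuous_expo Dc)
  qed
  also have "\<dots> = 0" using D(1)[unfolded torus_periodic_def, rule_format, of 0] by simp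
  finally show "torus_integral L (\<lambda>x. expo m x * D 1 x) = - torus_integral L (\<lambda>x. ?c * expo m x * D 0 x)"
    unfolding torus_integral_eq
    by (subst (asm) Bochner_Integration.integral_add)
       (auto intro!: L2_mult_integrable DL L2_expo L2_cmult simp: add_eq_0_iff2)
qed

section \<open>Translations of periodic functions\<close>

lemma has_bochner_integral_TL:
  fixes f :: "real \<Rightarrow> 'a::{banach,second_countable_topology}"
  assumes f: "f \<in> borel_measurable borel"
    and int: "has_bochner_integral lborel (\<lambda>x. indicator {0..<L} x *\<^sub>R f x) v"
  shows "has_bochner_integral TL f v"
proof -
  have ae: "AE x in lborel. indicator {0..L} x *\<^sub>R f x = indicator {0..<L} x *\<^sub>R f x"
    using AE_lborel_singleton[of L] by (rule eventually_mono) (auto simp: indicator_def)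
  have "has_bochner_integral lborel (\<lambda>x. indicator {0..L} x *\<^sub>R f x) v"
    using int by (subst has_bochner_integral_cong_AE[OF _ _ ae]) (use f in measurable)
  then show ?thesis
    by (simp add: has_bochner_integral_iff integrable_restrict_space integral_restrict_space)
qed

text \<open>The half-open cell is cut at L - \<eta>; translation carries the left piece to the right
  end, and the other one, wrapped around by periodicity, to the left end.
  \<open>has_bochner_integral\<close> delivers integrability and value together.\<close>

lemma has_bochner_integral_TL_shift:
  fixes f :: "real \<Rightarrow> 'a::{banach,second_countable_topology}"
  assumes f: "integrable TL f" "f \<in> borel_measurable borel" "\<And>x. f (x + L) = f x"
    and \<eta>: "0 \<le> \<eta>" "\<eta> \<le> L"
  shows "has_bochner_integral TL (\<lambda>x. f (x - \<eta>)) (integral\<^sup>L TL f)"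
proof -
  have "set_integrable lborel {0..L} f"
    using f(1) by (simp add: set_integrable_def integrable_restrict_space)
  then have "set_integrable lborel {L-\<eta>..<L} f" "set_integrable lborel {0..<L-\<eta>} f"
    by (rule set_integrable_subset; use \<eta> in auto)+
  then obtain a b where
    a: "has_bochner_integral lborel (\<lambda>x. indicator {L-\<eta>..<L} x *\<^sub>R f x) a" and
    b: "has_bochner_integral lborel (\<lambda>x. indicator {0..<L-\<eta>} x *\<^sub>R f x) b"
    unfolding set_integrable_def using has_bochner_integral_integrable by blast
  have "has_bochner_integral lborel (\<lambda>x. indicator {0..<L} x *\<^sub>R f x) (a + b)"
  proof -
    have "(\<lambda>x. indicator {0..<L} x *\<^sub>R f x) =
        (\<lambda>x. indicator {L-\<eta>..<L} x *\<^sub>R f x + indicator {0..<L-\<eta>} x *\<^sub>R f x)"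
      using \<eta> by (auto simp: indicator_def fun_eq_iff)
    then show ?thesis using has_bochner_integral_add[OF a b] by simp
  qed
  then have ab: "integral\<^sup>L TL f = a + b"
    using has_bochner_integral_TL[OF f(2)] has_bochner_integral_integral_eq by blast
  have a': "has_bochner_integral lborel (\<lambda>x. indicator {0..<\<eta>} x *\<^sub>R f (x - \<eta>)) a"
  proof -
    have "indicator {L-\<eta>..<L} ((L - \<eta>) + 1 * x) *\<^sub>R f ((L - \<eta>) + 1 * x) = indicator {0..<\<eta>} x *\<^sub>R f (x - \<eta>)" for x
      using f(3)[of "x - \<eta>"] by (auto simp: indicator_def algebra_simps)
    then show ?thesis
      using lborel_has_bochner_integral_real_affine_iff[of 1 "\<lambda>x. indicator {L-\<eta>..<L} x *\<^sub>R f x" a "L - \<eta>"] a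
      by simp
  qed
  have b': "has_bochner_integral lborel (\<lambda>x. indicator {\<eta>..<L} x *\<^sub>R f (x - \<eta>)) b"
  proof -
    have "indicator {0..<L-\<eta>} ((- \<eta>) + 1 * x) *\<^sub>R f ((- \<eta>) + 1 * x) = indicator {\<eta>..<L} x *\<^sub>R f (x - \<eta>)" for x
      by (auto simp: indicator_def algebra_simps)
    then have eq: "(\<lambda>x. indicator {0..<L-\<eta>} ((- \<eta>) + 1 * x) *\<^sub>R f ((- \<eta>) + 1 * x)) =
        (\<lambda>x. indicator {\<eta>..<L} x *\<^sub>R f (x - \<eta>))" by (rule ext)
    have "has_bochner_integral lborel (\<lambda>x. indicator {0..<L-\<eta>} ((- \<eta>) + 1 * x) *\<^sub>R f ((- \<eta>) + 1 * x)) (b /\<^sub>R \<bar>1\<bar>)"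
      using b by (rule iffD1[OF lborel_has_bochner_integral_real_affine_iff, rotated]) simp
    then show ?thesis unfolding eq by simp
  qed
  have "(\<lambda>x. indicator {0..<L} x *\<^sub>R f (x - \<eta>)) =
      (\<lambda>x. indicator {0..<\<eta>} x *\<^sub>R f (x - \<eta>) + indicator {\<eta>..<L} x *\<^sub>R f (x - \<eta>))"
    using \<eta> by (auto simp: indicator_def fun_eq_iff)
  then have "has_bochner_integral lborel (\<lambda>x. indicator {0..<L} x *\<^sub>R f (x - \<eta>)) (a + b)"
    using has_bochner_integral_add[OF a' b'] by simp
  moreover have "(\<lambda>x. f (x - \<eta>)) \<in> borel_measurable borel" using f(2) by measurable
  ultimately show ?thesis unfolding ab by (intro has_bochner_integral_TL)
qed

lemma integral_TL_shift:
  fixes f :: "real \<Rightarrow> 'a::{banach,second_countable_topology}"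
  assumes "integrable TL f" "f \<in> borel_measurable borel" "\<And>x. f (x + L) = f x" "0 \<le> \<eta>" "\<eta> \<le> L"
  shows "integral\<^sup>L TL (\<lambda>x. f (x - \<eta>)) = integral\<^sup>L TL f"
  using has_bochner_integral_TL_shift[OF assms] by (rule has_bochner_integral_integral_eq)

lemma L2_shift:
  assumes "f \<in> L2" "0 \<le> \<eta>" "\<eta> \<le> L"
  shows "(\<lambda>x. f (x - \<eta>)) \<in> L2"
  unfolding L2_iff
proof (intro conjI allI)
  have m: "f \<in> borel_measurable borel" using assms(1) by (rule L2_measurable)
  then show "(\<lambda>x. f (x - \<eta>)) \<in> borel_measurable borel" by measurable
  show "f (x + L - \<eta>) = f (x - \<eta>)" for x
    using L2_periodic[OF assms(1), of "x - \<eta>"] by (simp add: algebra_simps)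
  show "integrable TL (\<lambda>x. (cmod (f (x - \<eta>)))\<^sup>2)"
    using has_bochner_integral_TL_shift[OF L2_sq[OF assms(1)] _ _ assms(2,3)] m
    by (auto simp: L2_periodic[OF assms(1)] has_bochner_integral_iff)
qed

lemma ip_shift:
  assumes "f \<in> L2" "g \<in> L2" "0 \<le> \<eta>" "\<eta> \<le> L"
  shows "ip (\<lambda>x. f (x - \<eta>)) (\<lambda>x. g (x - \<eta>)) = ip f g"
  unfolding ip_eq
proof (rule integral_TL_shift[OF ip_integrable[OF assms(1,2)] _ _ assms(3,4)])
  show "(\<lambda>x. f x * cnj (g x)) \<in> borel_measurable borel"
    using L2_measurable[OF assms(1)] L2_measurable[OF L2_cnj[OF assms(2)]] by measurable
qed (simp add: L2_periodic assms)

lemma nrm_shift: "f \<in> L2 \<Longrightarrow> 0 \<le> \<eta> \<Longrightarrow> \<eta> \<le> L \<Longrightarrow> nrm (\<lambda>x. f (x - \<eta>)) = nrm f"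
  by (simp add: nrm_def ip_shift)

lemma ip_shift_expo:
  assumes "f \<in> L2" "0 \<le> \<eta>" "\<eta> \<le> L"
  shows "ip (\<lambda>x. f (x - \<eta>)) (expo n) = expo n (- \<eta>) * ip f (expo n)"
proof -
  have "(expo n) = (\<lambda>x. expo n \<eta> * expo n (x - \<eta>))"
    by (auto simp: expo_shift[symmetric])
  then have "ip (\<lambda>x. f (x - \<eta>)) (expo n) = ip (\<lambda>x. f (x - \<eta>)) (\<lambda>x. expo n \<eta> * expo n (x - \<eta>))"
    by simp
  also have "\<dots> = cnj (expo n \<eta>) * ip f (expo n)"
    unfolding ip_cmult_right ip_shift[OF assms(1) L2_expo assms(2,3)] ..
  finally show ?thesis by (simp add: expo_def cis_cnj)
qed

lemma has_weak_deriv_shift: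
  assumes g: "has_weak_deriv u g" and u: "u \<in> L2" and \<eta>: "0 \<le> \<eta>" "\<eta> \<le> L"
  shows "has_weak_deriv (\<lambda>x. u (x - \<eta>)) (\<lambda>x. g (x - \<eta>))"
  unfolding has_weak_deriv_def weak_deriv_def
proof (intro conjI allI impI)
  have gL: "g \<in> L2" using g by (rule has_weak_deriv_L2)
  show "(\<lambda>x. g (x - \<eta>)) \<in> L2" by (intro L2_shift gL \<eta>)
  fix D assume D: "torus_periodic L (D 0)" "\<forall>n x. (D n has_vector_derivative D (Suc n) x) (at x)"
  define E where "E n x = D n (x + \<eta>)" for n x
  have E: "torus_periodic L (E 0)" "\<And>n x. (E n has_vector_derivative E (Suc n) x) (at x)"
  proof -
    show "torus_periodic L (E 0)" using D(1) unfolding torus_periodic_def E_def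
      by (metis add.assoc add.commute)
    fix n x
    have "((D n \<circ> (\<lambda>x. x + \<eta>)) has_vector_derivative 1 *\<^sub>R D (Suc n) (x + \<eta>)) (at x)"
      by (rule vector_diff_chain_at) (use D(2) in \<open>auto intro!: derivative_eq_intros\<close>)
    then show "(E n has_vector_derivative E (Suc n) x) (at x)"
      by (simp add: E_def[abs_def] o_def)
  qed
  have EL: "E n \<in> L2" for n using E by (rule test_function_L2)
  have sh: "integral\<^sup>L TL (\<lambda>x. f (x - \<eta>) * D n x) = integral\<^sup>L TL (\<lambda>x. f x * E n x)" if "f \<in> L2" for f n
  proof -
    have "integral\<^sup>L TL (\<lambda>x. f (x - \<eta>) * E n (x - \<eta>)) = integral\<^sup>L TL (\<lambda>x. f x * E n x)"
      using L2_measurable[OF that] L2_measurable[OF EL]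
      by (intro integral_TL_shift[where f = "\<lambda>x. f x * E n x"] L2_mult_integrable that EL \<eta>)
         (auto simp: L2_periodic[OF that] L2_periodic[OF EL])
    then show ?thesis by (simp add: E_def)
  qed
  have "torus_integral L (\<lambda>x. u x * E 1 x) = - torus_integral L (\<lambda>x. g x * E 0 x)"
    using g E unfolding has_weak_deriv_def weak_deriv_def by blast
  then show "torus_integral L (\<lambda>x. u (x - \<eta>) * D 1 x) = - torus_integral L (\<lambda>x. g (x - \<eta>) * D 0 x)"
    unfolding torus_integral_eq sh[OF u] sh[OF gL] .
qed

text \<open>It holds coefficient by coefficient: translation multiplies frequency q by
  e^{-iq\<eta>}, and |e^{-iq\<eta>} - 1| \<le> \<eta> |q|, which is \<eta> times the modulus of the
  symbol of the derivative.\<close>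

lemma nrm_shift_diff:
  assumes u: "continuous_on UNIV u" "\<And>x. u (x + L) = u x" and g: "has_weak_deriv u g"
    and \<eta>: "0 \<le> \<eta>" "\<eta> \<le> L"
  shows "nrm (\<lambda>x. u (x - \<eta>) - u x) \<le> \<eta> * nrm g"
proof (rule nrm_le_by_coeffs)
  have uL: "u \<in> L2" using u by (rule L2_continuous)
  show "continuous_on UNIV (\<lambda>x. u (x - \<eta>) - u x)"
    using u(1) by (intro continuous_intros continuous_on_compose2[OF u(1)]) auto
  show "u (x + L - \<eta>) - u (x + L) = u (x - \<eta>) - u x" for x
    using u(2)[of x] u(2)[of "x - \<eta>"] by (simp add: algebra_simps)
  show "g \<in> L2" using g by (rule has_weak_deriv_L2)
  fix n
  have "ip (\<lambda>x. u (x - \<eta>) - u x) (expo n) = (expo n (- \<eta>) - 1) * ip u (expo n)"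
    by (simp add: ip_diff_left L2_shift uL \<eta> L2_expo ip_shift_expo left_diff_distrib)
  then have "cmod (ip (\<lambda>x. u (x - \<eta>) - u x) (expo n)) = cmod (expo n (- \<eta>) - 1) * cmod (ip u (expo n))"
    by (simp add: norm_mult)
  also have "\<dots> \<le> \<bar>2 * pi / L * of_int n * (- \<eta>)\<bar> * cmod (ip u (expo n))"
    unfolding expo_def by (intro mult_right_mono cmod_cis_minus_1) auto
  also have "\<dots> = \<eta> * cmod (ip g (expo n))"
    unfolding weak_deriv_expo[OF g] using \<eta> L_pos by (simp add: norm_mult norm_divide abs_mult)
  finally show "cmod (ip (\<lambda>x. u (x - \<eta>) - u x) (expo n)) \<le> \<eta> * cmod (ip g (expo n))" .
qed (rule \<eta>)

text \<open>If |u| is large at one point then, the variation of \<open>u\<close> being controlled by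
  the integral of |g|, it is large everywhere, and so is the L2 norm.\<close>

lemma sup_bound:
  assumes u: "continuous_on UNIV u" "\<And>x. u (x + L) = u x" and g: "has_weak_deriv u g"
  shows "cmod (u x) \<le> nrm u / sqrt L + 2 * sqrt L * nrm g"
proof -
  have uL: "u \<in> L2" using u by (rule L2_continuous)
  have gL: "g \<in> L2" using g by (rule has_weak_deriv_L2)
  have G: "cmod (integral {0..x} g) \<le> sqrt L * nrm g" if x: "x \<in> {0..L}" for x
  proof -
    have "cmod (integral {0..x} g) \<le> integral\<^sup>L TL (\<lambda>y. cmod (indicator {..x} y *\<^sub>R g y))"
      unfolding integral_indicator_TL[OF gL x, symmetric] by (rule integral_norm_bound)
    also have "\<dots> \<le> integral\<^sup>L TL (\<lambda>y. cmod (g y) * cmod (expo 0 y))"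
    proof (rule Bochner_Integration.integral_mono_AE')
      show "integrable TL (\<lambda>y. cmod (g y) * cmod (expo 0 y))"
        by (intro L2_cmod_mult_integrable gL L2_expo)
    qed (auto simp: indicator_def intro!: AE_I2)
    also have "\<dots> \<le> nrm g * nrm (expo 0)" by (intro Cauchy_Schwarz_cmod gL L2_expo)
    also have "\<dots> \<le> nrm g * (1 * sqrt L)" by (intro mult_left_mono nrm_le_sup L2_expo) auto
    finally show ?thesis by (simp add: mult.commute)
  qed
  have main: "cmod (u x) \<le> nrm u / sqrt L + 2 * sqrt L * nrm g" if x: "x \<in> {0..L}" for x
  proof -
    \<comment> \<open>A lower bound for |u| on the whole cell: x and y are each reached from 0 at a
      cost of at most \<open>sqrt L * nrm g\<close>.\<close>
    define a where "a = cmod (u x) - 2 * sqrt L * nrm g"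
    have "a * sqrt L \<le> nrm u"
    proof (cases "a \<le> 0")
      case True
      then have "a * sqrt L \<le> 0" using L_pos by (simp add: mult_nonpos_nonneg)
      also have "0 \<le> nrm u" by simp
      finally show ?thesis .
    next
      case False
      have lower: "a \<le> cmod (u y)" if y: "y \<in> {0..L}" for y
      proof -
        have "u x = u y + integral {0..x} g - integral {0..y} g"
          using weak_deriv_FTC[OF u g x] weak_deriv_FTC[OF u g y] by simp
        then have "cmod (u x) \<le> cmod (u y) + cmod (integral {0..x} g) + cmod (integral {0..y} g)"
          using norm_triangle_ineq4[of "u y + integral {0..x} g" "integral {0..y} g"]
            norm_triangle_ineq[of "u y" "integral {0..x} g"] by simp
        then show ?thesis using G[OF x] G[OF y] by (simp add: a_def)
      qed
      interpret finite_measure TL by (rule finite_measure_TL)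
      have "a\<^sup>2 * L = integral\<^sup>L TL (\<lambda>y. a\<^sup>2)" by (simp add: mult.commute)
      also have "\<dots> \<le> integral\<^sup>L TL (\<lambda>y. (cmod (u y))\<^sup>2)"
        using lower False by (intro integral_mono L2_sq uL power_mono) auto
      finally have "(a * sqrt L)\<^sup>2 \<le> (nrm u)\<^sup>2" using L_pos by (simp add: nrm_sq power_mult_distrib)
      then show ?thesis by (rule power2_le_imp_le) simp
    qed
    then have "a \<le> nrm u / sqrt L" using L_pos by (simp add: pos_le_divide_eq)
    then show ?thesis by (simp add: a_def)
  qed
  obtain n where "x + of_int n * L \<in> {0..<L}" by (rule reduce_to_period)
  then show ?thesis using main[of "x + of_int n * L"] periodic_of_int[of u x n] u(2) by simp
qed

subsection \<open>The Sobolev space\<close>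

abbreviation dx :: "(real \<Rightarrow> complex) \<Rightarrow> real \<Rightarrow> complex" where
  "dx \<equiv> h1_deriv L"

lemma H1_iff: "u \<in> H1 \<longleftrightarrow> continuous_on UNIV u \<and> (\<forall>x. u (x + L) = u x) \<and> (\<exists>g. has_weak_deriv u g)"
  unfolding H1_torus_def has_weak_deriv_def using L2_continuous L2_periodic by auto

lemma H1I: "continuous_on UNIV u \<Longrightarrow> (\<And>x. u (x + L) = u x) \<Longrightarrow> has_weak_deriv u g \<Longrightarrow> u \<in> H1"
  unfolding H1_iff by blast

lemma H1_continuous: "u \<in> H1 \<Longrightarrow> continuous_on UNIV u"
  by (simp add: H1_iff)

lemma H1_periodic: "u \<in> H1 \<Longrightarrow> u (x + L) = u x"
  by (simp add: H1_iff)

lemma H1_L2: "u \<in> H1 \<Longrightarrow> u \<in> L2"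
  by (simp add: H1_torus_def)

lemma H1_dx: assumes "u \<in> H1" shows "has_weak_deriv u (dx u)"
proof -
  have "\<exists>g. g \<in> L2 \<and> weak_deriv L u g" using assms by (simp add: H1_iff has_weak_deriv_def)
  from someI_ex[OF this] show ?thesis by (simp add: has_weak_deriv_def h1_deriv_def)
qed

lemma dx_L2: "u \<in> H1 \<Longrightarrow> dx u \<in> L2"
  using H1_dx by (rule has_weak_deriv_L2)

text \<open>Lets any convenient weak derivative stand for the chosen \<open>dx u\<close> inside
  inner products and norms.\<close>

lemma dx_AE: "u \<in> H1 \<Longrightarrow> has_weak_deriv u g \<Longrightarrow> AE x in TL. dx u x = g x"
  using H1_dx by (intro weak_deriv_unique_AE) (auto simp: H1_iff)

lemma ip_dx: "u \<in> H1 \<Longrightarrow> has_weak_deriv u g \<Longrightarrow> h \<in> L2 \<Longrightarrow> ip (dx u) h = ip g h"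
  by (rule ip_cong_AE[OF dx_AE dx_L2 has_weak_deriv_L2])

lemma ip_dx_right: "u \<in> H1 \<Longrightarrow> has_weak_deriv u g \<Longrightarrow> h \<in> L2 \<Longrightarrow> ip h (dx u) = ip h g"
  using ip_dx[of u g h] ip_cnj by metis

lemma nrm_dx: "u \<in> H1 \<Longrightarrow> has_weak_deriv u g \<Longrightarrow> nrm (dx u) = nrm g"
  by (rule nrm_cong_AE[OF dx_AE dx_L2 has_weak_deriv_L2])

lemma dx_weak_diff: "u \<in> H1 \<Longrightarrow> v \<in> H1 \<Longrightarrow> has_weak_deriv (\<lambda>x. u x - v x) (\<lambda>x. dx u x - dx v x)"
  by (intro has_weak_deriv_diff H1_dx H1_L2)

lemma dx_weak_cmult: "u \<in> H1 \<Longrightarrow> has_weak_deriv (\<lambda>x. c * u x) (\<lambda>x. c * dx u x)"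
  by (intro has_weak_deriv_cmult H1_dx)

lemma dx_weak_shift: "u \<in> H1 \<Longrightarrow> 0 \<le> \<eta> \<Longrightarrow> \<eta> \<le> L \<Longrightarrow> has_weak_deriv (\<lambda>x. u (x - \<eta>)) (\<lambda>x. dx u (x - \<eta>))"
  by (intro has_weak_deriv_shift H1_dx H1_L2)

lemma H1_diff:
  assumes "u \<in> H1" "v \<in> H1"
  shows "(\<lambda>x. u x - v x) \<in> H1"
  by (rule H1I[OF continuous_on_diff[OF assms[THEN H1_continuous]] _ dx_weak_diff[OF assms]])
     (simp add: H1_periodic assms)

lemma H1_cmult:
  assumes "u \<in> H1"
  shows "(\<lambda>x. c * u x) \<in> H1"
  by (rule H1I[OF continuous_on_mult_left[OF H1_continuous[OF assms]] _ dx_weak_cmult[OF assms]])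
     (simp add: H1_periodic assms)

lemma H1_shift:
  assumes "u \<in> H1" "0 \<le> \<eta>" "\<eta> \<le> L"
  shows "(\<lambda>x. u (x - \<eta>)) \<in> H1"
proof (rule H1I[OF _ _ dx_weak_shift[OF assms]])
  show "continuous_on UNIV (\<lambda>x. u (x - \<eta>))"
    by (rule continuous_on_compose2[OF H1_continuous[OF assms(1)]]) (auto intro!: continuous_intros)
  show "u (x + L - \<eta>) = u (x - \<eta>)" for x
    using H1_periodic[OF assms(1), of "x - \<eta>"] by (simp add: algebra_simps)
qed

lemma H1_expo: "expo n \<in> H1"
  by (rule H1I[OF _ _ has_weak_deriv_expo]) (auto simp: continuous_expo expo_periodic)

lemma h1_norm_sq: assumes "u \<in> H1" shows "(h1_norm L u)\<^sup>2 = (nrm (dx u))\<^sup>2 + (nrm u)\<^sup>2"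
proof -
  have "h1_inner L u u = Re (ip (dx u) (dx u) + ip u u)"
    unfolding h1_inner_def torus_integral_eq ip_eq
    using assms by (subst Bochner_Integration.integral_add) (simp_all add: ip_integrable dx_L2 H1_L2)
  also have "\<dots> = (nrm (dx u))\<^sup>2 + (nrm u)\<^sup>2" by (simp add: ip_self_nrm)
  finally show ?thesis by (simp add: h1_norm_def)
qed

text \<open>The integrand is a nonnegative real at every point, and a non-integrable one integrates
  to 0, so this covers arbitrary functions. It is what bounds the infima in
  \<open>h1_setdist\<close> from below.\<close>

lemma h1_norm_nonneg: "0 \<le> h1_norm L u"
proof -
  have "0 \<le> h1_inner L u u"
  proof -
    have "h1_inner L u u = Re (integral\<^sup>L TL (\<lambda>x. of_real ((cmod (dx u x))\<^sup>2 + (cmod (u x))\<^sup>2)))"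
      unfolding h1_inner_def torus_integral_eq by (simp only: complex_norm_square[symmetric] of_real_add)
    also have "\<dots> = integral\<^sup>L TL (\<lambda>x. (cmod (dx u x))\<^sup>2 + (cmod (u x))\<^sup>2)"
      by (simp only: integral_complex_of_real Re_complex_of_real)
    also have "\<dots> \<ge> 0" by (rule integral_nonneg_AE) simp
    finally show ?thesis .
  qed
  then show ?thesis by (simp add: h1_norm_def)
qed

lemma h1_norm_eq: "u \<in> H1 \<Longrightarrow> h1_norm L u = sqrt ((nrm (dx u))\<^sup>2 + (nrm u)\<^sup>2)"
  using h1_norm_sq[of u] h1_norm_nonneg[of u] by (simp add: real_sqrt_unique)

lemma nrm_le_h1: "u \<in> H1 \<Longrightarrow> nrm u \<le> h1_norm L u"
  by (simp add: h1_norm_eq real_le_rsqrt)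

lemma nrm_dx_le_h1: "u \<in> H1 \<Longrightarrow> nrm (dx u) \<le> h1_norm L u"
  by (simp add: h1_norm_eq real_le_rsqrt)

lemma h1_norm_le: "u \<in> H1 \<Longrightarrow> h1_norm L u \<le> nrm (dx u) + nrm u"
  unfolding h1_norm_eq by (rule sqrt_sum_squares_le_sum) auto

lemma h1_norm_cmult: assumes "u \<in> H1" shows "h1_norm L (\<lambda>x. c * u x) = cmod c * h1_norm L u"
proof -
  have "nrm (dx (\<lambda>x. c * u x)) = cmod c * nrm (dx u)"
    unfolding nrm_dx[OF H1_cmult[OF assms] dx_weak_cmult[OF assms]] by (rule nrm_cmult)
  then show ?thesis
    unfolding h1_norm_eq[OF H1_cmult[OF assms]] h1_norm_eq[OF assms] nrm_cmult
    by (simp add: power_mult_distrib real_sqrt_mult flip: distrib_left)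
qed

lemma h1_norm_diff_triangle:
  assumes "u \<in> H1" "v \<in> H1"
  shows "h1_norm L (\<lambda>x. u x - v x) \<le> h1_norm L u + h1_norm L v"
proof -
  have tri: "nrm (\<lambda>x. f x - g x) \<le> nrm f + nrm g" if "f \<in> L2" "g \<in> L2" for f g
    using nrm_triangle[OF that(1) L2_cmult[OF that(2), of "-1"]] nrm_cmult[of "-1" g] by simp
  have "h1_norm L (\<lambda>x. u x - v x) = sqrt ((nrm (\<lambda>x. dx u x - dx v x))\<^sup>2 + (nrm (\<lambda>x. u x - v x))\<^sup>2)"
    unfolding h1_norm_eq[OF H1_diff[OF assms]] nrm_dx[OF H1_diff[OF assms] dx_weak_diff[OF assms]] ..
  also have "\<dots> \<le> sqrt ((nrm (dx u) + nrm (dx v))\<^sup>2 + (nrm u + nrm v)\<^sup>2)"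
    by (intro real_sqrt_le_mono add_mono power_mono tri dx_L2 H1_L2 assms nrm_nonneg)
  also have "\<dots> \<le> sqrt ((nrm (dx u))\<^sup>2 + (nrm u)\<^sup>2) + sqrt ((nrm (dx v))\<^sup>2 + (nrm v)\<^sup>2)"
    by (rule real_sqrt_sum_squares_triangle_ineq)
  finally show ?thesis unfolding h1_norm_eq[OF assms(1)] h1_norm_eq[OF assms(2)] .
qed

lemma h1_dist_nonneg: "0 \<le> h1_dist L u v"
  by (simp add: h1_dist_def h1_norm_nonneg)

lemma h1_dist_commute: assumes "u \<in> H1" "v \<in> H1" shows "h1_dist L u v = h1_dist L v u"
  using h1_norm_cmult[OF H1_diff[OF assms], of "-1"] by (simp add: h1_dist_def)

lemma h1_dist_triangle:
  assumes "u \<in> H1" "v \<in> H1" "w \<in> H1"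
  shows "h1_dist L u w \<le> h1_dist L u v + h1_dist L v w"
  using h1_norm_diff_triangle[OF H1_diff[OF assms(1,2)] H1_diff[OF assms(3,2)]]
    h1_dist_commute[OF assms(2,3)] by (simp add: h1_dist_def)

lemma h1_norm_dist: assumes "u \<in> H1" "v \<in> H1" shows "\<bar>h1_norm L u - h1_norm L v\<bar> \<le> h1_dist L u v"
proof -
  have *: "h1_norm L u \<le> h1_dist L u v + h1_norm L v" if "u \<in> H1" "v \<in> H1" for u v
    using h1_norm_diff_triangle[OF H1_diff[OF that] H1_cmult[OF that(2), of "-1"]] h1_norm_cmult[OF that(2), of "-1"]
    by (simp add: h1_dist_def)
  show ?thesis using *[OF assms] *[OF assms(2,1)] h1_dist_commute[OF assms] by linarith
qed

text \<open>The sum of the two coefficients in \<open>sup_bound\<close>, a constant for the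
  embedding of H1 into the bounded functions.\<close>

definition sobolev_const :: real where "sobolev_const = 1 / sqrt L + 2 * sqrt L"

lemma sobolev_const_pos: "sobolev_const > 0"
  unfolding sobolev_const_def using L_pos by (intro add_pos_pos) auto

lemma H1_sup: assumes "u \<in> H1" shows "cmod (u x) \<le> sobolev_const * h1_norm L u"
proof -
  have "cmod (u x) \<le> nrm u / sqrt L + 2 * sqrt L * nrm (dx u)"
    by (rule sup_bound[OF H1_continuous[OF assms] H1_periodic[OF assms] H1_dx[OF assms]])
  also have "\<dots> \<le> h1_norm L u / sqrt L + 2 * sqrt L * h1_norm L u"
    using L_pos assms by (intro add_mono divide_right_mono mult_left_mono nrm_le_h1 nrm_dx_le_h1) auto
  finally show ?thesis by (simp add: sobolev_const_def distrib_right)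
qed

lemma H1_sup_dist: "u \<in> H1 \<Longrightarrow> v \<in> H1 \<Longrightarrow> cmod (u x - v x) \<le> sobolev_const * h1_dist L u v"
  using H1_sup[OF H1_diff] by (simp add: h1_dist_def)

lemma nrm_diff_le_dist: "u \<in> H1 \<Longrightarrow> v \<in> H1 \<Longrightarrow> nrm (\<lambda>x. u x - v x) \<le> h1_dist L u v"
  using nrm_le_h1[OF H1_diff] by (simp add: h1_dist_def)

lemma nrm_dx_diff_le_dist: "u \<in> H1 \<Longrightarrow> v \<in> H1 \<Longrightarrow> nrm (\<lambda>x. dx u x - dx v x) \<le> h1_dist L u v"
  using nrm_dx_le_h1[OF H1_diff] nrm_dx[OF H1_diff dx_weak_diff] by (simp add: h1_dist_def)

lemma h1_dist_shift:
  assumes "u \<in> H1" "v \<in> H1" "0 \<le> \<eta>" "\<eta> \<le> L"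
  shows "h1_dist L (\<lambda>x. u (x - \<eta>)) (\<lambda>x. v (x - \<eta>)) = h1_dist L u v"
proof -
  note d = H1_diff[OF assms(1,2)]
  have "nrm (dx (\<lambda>x. u (x - \<eta>) - v (x - \<eta>))) = nrm (dx (\<lambda>x. u x - v x))"
    unfolding nrm_dx[OF H1_shift[OF d assms(3,4)] dx_weak_shift[OF d assms(3,4)]]
    by (rule nrm_shift[OF dx_L2[OF d] assms(3,4)])
  moreover have "nrm (\<lambda>x. u (x - \<eta>) - v (x - \<eta>)) = nrm (\<lambda>x. u x - v x)"
    by (rule nrm_shift[OF H1_L2[OF d] assms(3,4)])
  ultimately show ?thesis
    unfolding h1_dist_def h1_norm_eq[OF d] h1_norm_eq[OF H1_shift[OF d assms(3,4)]] by simp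
qed

section \<open>Difference quotients in space\<close>

lemma trig_dense_periodic:
  assumes f: "continuous_on UNIV f" "\<And>x. f (x + L) = f x" and e: "e > 0"
  obtains p where "trig p" "nrm (\<lambda>x. f x - p x) \<le> e"
proof -
  have "continuous_on {0..L} f" "f 0 = f L" "e / sqrt L > 0"
    using f(1) f(2)[of 0] e L_pos continuous_on_subset[of UNIV f] by auto
  then obtain p where p: "trig p" "\<And>x. x \<in> {0..L} \<Longrightarrow> cmod (f x - p x) < e / sqrt L"
    using trig_dense by metis
  have d: "(\<lambda>x. f x - p x) \<in> L2" by (intro L2_diff L2_continuous f L2_trig p)
  have "(nrm (\<lambda>x. f x - p x))\<^sup>2 \<le> (e / sqrt L)\<^sup>2 * L"
    unfolding nrm_sq
  proof (rule integral_TL_mono_const)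
    show "(\<lambda>x. (cmod (f x - p x))\<^sup>2) \<in> borel_measurable TL"
      by (rule borel_measurable_integrable[OF L2_sq[OF d]])
    show "(cmod (f x - p x))\<^sup>2 \<le> (e / sqrt L)\<^sup>2" if "x \<in> {0..L}" for x
      using p(2)[OF that] by (intro power_mono) auto
  qed simp
  also have "\<dots> = e\<^sup>2" using L_pos by (simp add: power_divide)
  finally have "nrm (\<lambda>x. f x - p x) \<le> e" by (rule power2_le_imp_le) (use e in simp)
  with p(1) show thesis by (rule that)
qed

text \<open>On one exponential the quotient is that of a scalar function of \<eta> at 0. The limit
  is one-sided because the shift lemmas cover 0 \<le> \<eta> \<le> L.\<close>

lemma shift_quotient_trig:
  assumes u: "u \<in> H1" and p: "trig p"
  shows "((\<lambda>\<eta>. ip (\<lambda>x. u (x - \<eta>) - u x) p / of_real \<eta>) \<longlongrightarrow> - ip (dx u) p) (at_right 0)"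
  using p
proof induction
  case (trig_expo c n)
  let ?d = "\<i> * complex_of_real (2 * pi / L * of_int n)"
  have "((\<lambda>\<eta>. expo n (- \<eta>)) has_vector_derivative - 1 *\<^sub>R (?d * expo n (- 0))) (at 0)"
  proof -
    have "((expo n \<circ> uminus) has_vector_derivative - 1 *\<^sub>R (?d * expo n (- 0))) (at 0)"
      by (rule vector_diff_chain_at[OF _ expo_deriv]) (auto intro!: derivative_eq_intros)
    then show ?thesis by (simp add: o_def)
  qed
  then have "((\<lambda>\<eta>. (expo n (- \<eta>) - 1) /\<^sub>R \<eta>) \<longlongrightarrow> - ?d) (at 0)"
    unfolding has_vector_derivative_iff_quotient by simp
  then have "((\<lambda>\<eta>. (expo n (- \<eta>) - 1) /\<^sub>R \<eta>) \<longlongrightarrow> - ?d) (at_right 0)"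
    by (rule tendsto_within_subset) simp
  then have "((\<lambda>\<eta>. cnj c * ((expo n (- \<eta>) - 1) /\<^sub>R \<eta> * ip u (expo n))) \<longlongrightarrow> cnj c * (- ?d * ip u (expo n))) (at_right 0)"
    by (intro tendsto_intros)
  then have "((\<lambda>\<eta>. cnj c * ((expo n (- \<eta>) - 1) /\<^sub>R \<eta> * ip u (expo n))) \<longlongrightarrow> - ip (dx u) (\<lambda>x. c * expo n x)) (at_right 0)"
    unfolding ip_cmult_right weak_deriv_expo[OF H1_dx[OF u]] by simp
  moreover have "eventually (\<lambda>\<eta>. cnj c * ((expo n (- \<eta>) - 1) /\<^sub>R \<eta> * ip u (expo n)) =
      ip (\<lambda>x. u (x - \<eta>) - u x) (\<lambda>x. c * expo n x) / of_real \<eta>) (at_right 0)"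
    unfolding eventually_at_right_field
  proof (intro exI[of _ L] conjI allI impI)
    fix \<eta> assume "0 < \<eta>" "\<eta> < L"
    then have "ip (\<lambda>x. u (x - \<eta>) - u x) (expo n) = (expo n (- \<eta>) - 1) * ip u (expo n)"
      by (simp add: ip_diff_left L2_shift H1_L2[OF u] L2_expo ip_shift_expo left_diff_distrib)
    then show "cnj c * ((expo n (- \<eta>) - 1) /\<^sub>R \<eta> * ip u (expo n)) =
      ip (\<lambda>x. u (x - \<eta>) - u x) (\<lambda>x. c * expo n x) / of_real \<eta>"
      unfolding ip_cmult_right by (simp add: scaleR_conv_of_real divide_inverse mult_ac)
  qed (rule L_pos)
  ultimately show ?case by (rule Lim_transform_eventually)
next
  case (trig_add f g)
  have "((\<lambda>\<eta>. ip (\<lambda>x. u (x - \<eta>) - u x) f / of_real \<eta> + ip (\<lambda>x. u (x - \<eta>) - u x) g / of_real \<eta>) \<longlongrightarrow>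
      - ip (dx u) f + - ip (dx u) g) (at_right 0)"
    by (intro tendsto_add trig_add)
  then have "((\<lambda>\<eta>. ip (\<lambda>x. u (x - \<eta>) - u x) f / of_real \<eta> + ip (\<lambda>x. u (x - \<eta>) - u x) g / of_real \<eta>) \<longlongrightarrow>
      - ip (dx u) (\<lambda>x. f x + g x)) (at_right 0)"
    using trig_add by (simp add: ip_add_right L2_trig dx_L2 u)
  moreover have "eventually (\<lambda>\<eta>. ip (\<lambda>x. u (x - \<eta>) - u x) f / of_real \<eta> + ip (\<lambda>x. u (x - \<eta>) - u x) g / of_real \<eta> =
      ip (\<lambda>x. u (x - \<eta>) - u x) (\<lambda>x. f x + g x) / of_real \<eta>) (at_right 0)"
    unfolding eventually_at_right_field
  proof (intro exI[of _ L] conjI allI impI)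
    fix \<eta> assume \<eta>: "0 < \<eta>" "\<eta> < L"
    then have "(\<lambda>x. u (x - \<eta>) - u x) \<in> L2" using u by (intro L2_diff L2_shift H1_L2) auto
    then show "ip (\<lambda>x. u (x - \<eta>) - u x) f / of_real \<eta> + ip (\<lambda>x. u (x - \<eta>) - u x) g / of_real \<eta> =
      ip (\<lambda>x. u (x - \<eta>) - u x) (\<lambda>x. f x + g x) / of_real \<eta>"
      using trig_add by (simp add: ip_add_right L2_trig add_divide_distrib)
  qed (rule L_pos)
  ultimately show ?case by (rule Lim_transform_eventually)
qed

text \<open>The difference quotients are bounded in L2 by \<open>nrm (dx u)\<close>, so convergence
  against a dense set of test functions is enough.\<close>

lemma shift_quotient:
  assumes u: "u \<in> H1" and v: "v \<in> H1"
  shows "((\<lambda>\<eta>. ip (\<lambda>x. u (x - \<eta>) - u x) v / of_real \<eta>) \<longlongrightarrow> - ip (dx u) v) (at_right 0)"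
proof (rule tendstoI)
  fix e :: real assume e: "e > 0"
  \<comment> \<open>Makes \<open>(nrm (dx u) + 1) * e'\<close> equal to e/4, a bound for each of the
    two errors caused by replacing v by p; the 1 keeps the denominator positive.\<close>
  define e' where "e' = e / (4 * (nrm (dx u) + 1))"
  have "0 < 4 * (nrm (dx u) + 1)" by (simp add: add_nonneg_pos)
  then have e': "e' > 0" using e by (simp only: e'_def divide_pos_pos)
  obtain p where p: "trig p" "nrm (\<lambda>x. v x - p x) \<le> e'"
    using trig_dense_periodic[OF H1_continuous[OF v] H1_periodic[OF v] e'] by metis
  have pL: "p \<in> L2" "(\<lambda>x. v x - p x) \<in> L2" "v \<in> L2" using p(1) v by (auto intro: L2_trig L2_diff H1_L2)
  have small: "nrm (dx u) * nrm (\<lambda>x. v x - p x) \<le> e / 4"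
  proof -
    have "nrm (dx u) * nrm (\<lambda>x. v x - p x) \<le> (nrm (dx u) + 1) * e'"
      using p(2) e' by (intro mult_mono) auto
    also have "\<dots> = e / 4"
    proof -
      have "t * (e / (4 * t)) = e / 4" if "0 < 4 * t" for t :: real using that by simp
      then show ?thesis using \<open>0 < 4 * (nrm (dx u) + 1)\<close> unfolding e'_def .
    qed
    finally show ?thesis .
  qed
  have "eventually (\<lambda>\<eta>. dist (ip (\<lambda>x. u (x - \<eta>) - u x) p / of_real \<eta>) (- ip (dx u) p) < e / 2) (at_right 0)"
    using shift_quotient_trig[OF u p(1)] e by (intro tendstoD) auto
  moreover have "eventually (\<lambda>\<eta>. 0 < \<eta> \<and> \<eta> < L) (at_right 0)"
    unfolding eventually_at_right_field using L_pos by blast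
  ultimately show "eventually (\<lambda>\<eta>. dist (ip (\<lambda>x. u (x - \<eta>) - u x) v / of_real \<eta>) (- ip (dx u) v) < e) (at_right 0)"
  proof eventually_elim
    case (elim \<eta>)
    let ?d = "\<lambda>x. u (x - \<eta>) - u x"
    have dL: "?d \<in> L2" using u elim by (intro L2_diff L2_shift H1_L2) auto
    have "cmod (ip ?d (\<lambda>x. v x - p x)) \<le> nrm ?d * nrm (\<lambda>x. v x - p x)"
      by (intro Cauchy_Schwarz dL pL)
    also have "\<dots> \<le> (\<eta> * nrm (dx u)) * nrm (\<lambda>x. v x - p x)"
      using elim H1_periodic[OF u] by (intro mult_right_mono nrm_shift_diff H1_continuous[OF u] H1_dx[OF u]) auto
    also have "\<dots> \<le> \<eta> * (e / 4)" using small elim by (simp add: mult.assoc)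
    finally have 1: "cmod (ip ?d (\<lambda>x. v x - p x) / of_real \<eta>) \<le> e / 4"
      using elim by (simp add: norm_divide pos_divide_le_eq mult.commute)
    have 2: "cmod (ip (dx u) (\<lambda>x. v x - p x)) \<le> e / 4"
      using Cauchy_Schwarz[OF dx_L2[OF u] pL(2)] small by linarith
    have eq: "ip ?d v / of_real \<eta> - (- ip (dx u) v) = (ip ?d p / of_real \<eta> - (- ip (dx u) p)) +
        (ip ?d (\<lambda>x. v x - p x) / of_real \<eta> + ip (dx u) (\<lambda>x. v x - p x))"
      by (simp add: ip_diff_right pL dL dx_L2 u diff_divide_distrib)
    have 3: "cmod (ip ?d p / of_real \<eta> - (- ip (dx u) p)) < e / 2" using elim by (simp add: dist_norm)
    have "cmod (ip ?d v / of_real \<eta> - (- ip (dx u) v)) \<le> cmod (ip ?d p / of_real \<eta> - (- ip (dx u) p)) +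
        (cmod (ip ?d (\<lambda>x. v x - p x) / of_real \<eta>) + cmod (ip (dx u) (\<lambda>x. v x - p x)))"
      unfolding eq by (intro order_trans[OF norm_triangle_ineq] add_left_mono norm_triangle_ineq)
    then show ?case using 1 2 3 unfolding dist_norm by linarith
  qed
qed

end

subsection \<open>The flow of the cubic equation\<close>

locale nls_torus = torus +
  fixes \<beta> lam :: real
begin

definition cubic :: "(real \<Rightarrow> complex) \<Rightarrow> real \<Rightarrow> complex" where
  "cubic u x = of_real ((cmod (u x))\<^sup>2) * u x"

text \<open>The time derivative i (\<beta> u_xx + lam |u|^2 u) paired with \<phi>, with one space
  derivative moved onto \<phi>.\<close>

definition nls_gen :: "(real \<Rightarrow> complex) \<Rightarrow> (real \<Rightarrow> complex) \<Rightarrow> complex" where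
  "nls_gen u \<phi> = - \<i> * of_real \<beta> * ip (dx u) (dx \<phi>) + \<i> * of_real lam * ip (cubic u) \<phi>"

text \<open>This is \<open>nls_solution\<close> with the datum dropped and the equation solved for
  the time derivative, a form that passes to translates in time and space.\<close>

definition flow :: "(real \<Rightarrow> real \<Rightarrow> complex) \<Rightarrow> bool" where
  "flow w \<longleftrightarrow> (\<forall>t. w t \<in> H1) \<and> (\<forall>t. ((\<lambda>s. h1_dist L (w s) (w t)) \<longlongrightarrow> 0) (at t)) \<and>
     (\<forall>\<phi>\<in>H1. \<forall>t. ((\<lambda>s. ip (w s) \<phi>) has_vector_derivative nls_gen (w t) \<phi>) (at t))"

lemma nls_solution_iff: "nls_solution L \<beta> lam v w \<longleftrightarrow> w 0 = v \<and> flow w"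
proof -
  have 1: "\<i> * d - of_real \<beta> * ip (dx (w t)) (dx \<phi>) + of_real lam * ip (cubic (w t)) \<phi> = 0 \<longleftrightarrow> d = nls_gen (w t) \<phi>" for d t \<phi>
  proof -
    have "\<i> * d - of_real \<beta> * ip (dx (w t)) (dx \<phi>) + of_real lam * ip (cubic (w t)) \<phi> = \<i> * (d - nls_gen (w t) \<phi>)"
      by (simp add: nls_gen_def algebra_simps)
    then show ?thesis by simp
  qed
  have "nls_solution L \<beta> lam v w \<longleftrightarrow> w 0 = v \<and> (\<forall>t. w t \<in> H1) \<and>
      (\<forall>t. ((\<lambda>s. h1_dist L (w s) (w t)) \<longlongrightarrow> 0) (at t)) \<and>
      (\<forall>\<phi>\<in>H1. \<forall>t. \<exists>d. ((\<lambda>s. ip (w s) \<phi>) has_vector_derivative d) (at t) \<and>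
        \<i> * d - of_real \<beta> * ip (dx (w t)) (dx \<phi>) + of_real lam * ip (cubic (w t)) \<phi> = 0)"
    by (simp only: nls_solution_def ip_def cubic_def)
  then show ?thesis unfolding 1 flow_def by simp
qed

lemma flow_H1: "flow w \<Longrightarrow> w t \<in> H1"
  by (simp add: flow_def)

lemma flow_deriv: "flow w \<Longrightarrow> \<phi> \<in> H1 \<Longrightarrow> ((\<lambda>s. ip (w s) \<phi>) has_vector_derivative nls_gen (w t) \<phi>) (at t)"
  by (simp add: flow_def)

lemma h1_dist_self: "u \<in> H1 \<Longrightarrow> h1_dist L u u = 0"
  using h1_norm_cmult[of u 0] by (simp add: h1_dist_def)

lemma flow_isCont: "flow w \<Longrightarrow> isCont (\<lambda>s. h1_dist L (w s) (w t)) t"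
  by (simp add: flow_def isCont_def h1_dist_self)

text \<open>The factor \<open>K\<close> may depend on s, because the quartic is Lipschitz only with
  a constant that grows with the norm.\<close>

lemma isCont_of_h1:
  assumes w: "flow w" and F: "\<And>s. dist (F s) (F t) \<le> K s * h1_dist L (w s) (w t)" and K: "isCont K t"
  shows "isCont F t"
proof -
  have "((\<lambda>s. K s * h1_dist L (w s) (w t)) \<longlongrightarrow> K t * 0) (at t)"
    using K w unfolding isCont_def flow_def by (intro tendsto_mult) auto
  then have lim: "((\<lambda>s. K s * h1_dist L (w s) (w t)) \<longlongrightarrow> 0) (at t)" by simp
  have "eventually (\<lambda>s. norm (dist (F s) (F t)) \<le> K s * h1_dist L (w s) (w t)) (at t)"
    by (rule always_eventually) (simp add: F)
  from Lim_null_comparison[OF this lim] have "((\<lambda>s. dist (F s) (F t)) \<longlongrightarrow> 0) (at t)" .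
  then show ?thesis unfolding isCont_def by (subst tendsto_dist_iff)
qed

lemma flow_norm_isCont: assumes w: "flow w" shows "isCont (\<lambda>s. h1_norm L (w s)) t"
proof (rule isCont_of_h1[OF w, where K = "\<lambda>_. 1"])
  show "dist (h1_norm L (w s)) (h1_norm L (w t)) \<le> 1 * h1_dist L (w s) (w t)" for s
    using h1_norm_dist[OF flow_H1[OF w] flow_H1[OF w]] by (simp add: dist_real_def)
qed simp

lemma flow_bounded:
  assumes w: "flow w"
  obtains R where "R > 0" "\<And>t. t \<in> {a..b} \<Longrightarrow> h1_norm L (w t) \<le> R"
proof -
  have "continuous_on {a..b} (\<lambda>t. h1_norm L (w t))"
    using flow_norm_isCont[OF w] by (simp add: continuous_at_imp_continuous_on)
  then have "bounded ((\<lambda>t. h1_norm L (w t)) ` {a..b})"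
    by (intro compact_imp_bounded compact_continuous_image) auto
  then obtain R where "R > 0" "\<forall>y\<in>(\<lambda>t. h1_norm L (w t)) ` {a..b}. norm y \<le> R"
    unfolding bounded_pos by blast
  then show thesis using that[of R] by force
qed

lemma cubic_L2_bound:
  assumes "u \<in> H1" "h1_norm L u \<le> R"
  shows "cubic u \<in> L2" "nrm (cubic u) \<le> (sobolev_const * R)\<^sup>2 * R"
proof -
  have R: "0 \<le> R" using assms(2) h1_norm_nonneg[of u] by linarith
  have sup: "cmod (u x) \<le> sobolev_const * R" for x
    using H1_sup[OF assms(1), of x] mult_left_mono[OF assms(2), of sobolev_const] sobolev_const_pos by linarith
  have m: "(\<lambda>x. complex_of_real ((cmod (u x))\<^sup>2)) \<in> borel_measurable borel"
    by (intro borel_measurable_continuous_onI continuous_intros H1_continuous assms)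
  have b: "cmod (complex_of_real ((cmod (u x))\<^sup>2)) \<le> (sobolev_const * R)\<^sup>2" for x
    using sup[of x] by (simp add: norm_power power_mono)
  have c: "cubic u = (\<lambda>x. complex_of_real ((cmod (u x))\<^sup>2) * u x)" by (simp add: cubic_def[abs_def])
  show "cubic u \<in> L2" unfolding c
    by (rule L2_bounded_mult(1)[OF m _ b H1_L2[OF assms(1)]]) (simp add: H1_periodic assms)
  have "nrm (cubic u) \<le> (sobolev_const * R)\<^sup>2 * nrm u" unfolding c
    by (rule L2_bounded_mult(2)[OF m _ b H1_L2[OF assms(1)]]) (simp add: H1_periodic assms)
  also have "\<dots> \<le> (sobolev_const * R)\<^sup>2 * R"
    using nrm_le_h1[OF assms(1)] assms(2) by (intro mult_left_mono) auto
  finally show "nrm (cubic u) \<le> (sobolev_const * R)\<^sup>2 * R" .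
qed

lemma cubic_L2: "u \<in> H1 \<Longrightarrow> cubic u \<in> L2"
  using cubic_L2_bound(1)[of u "h1_norm L u"] by simp

lemma nls_gen_bound:
  assumes "u \<in> H1" "h1_norm L u \<le> R" "\<phi> \<in> H1"
  shows "cmod (nls_gen u \<phi>) \<le> (\<bar>\<beta>\<bar> * R + \<bar>lam\<bar> * ((sobolev_const * R)\<^sup>2 * R)) * h1_norm L \<phi>"
proof -
  have R: "0 \<le> R" using assms(2) h1_norm_nonneg[of u] by linarith
  have "cmod (ip (dx u) (dx \<phi>)) \<le> R * h1_norm L \<phi>"
    using nrm_dx_le_h1[OF assms(1)] assms(2) R nrm_dx_le_h1[OF assms(3)]
    by (intro order_trans[OF Cauchy_Schwarz] mult_mono dx_L2 assms) auto
  moreover have "cmod (ip (cubic u) \<phi>) \<le> (sobolev_const * R)\<^sup>2 * R * h1_norm L \<phi>"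
    using cubic_L2_bound(2)[OF assms(1,2)] R nrm_le_h1[OF assms(3)]
    by (intro order_trans[OF Cauchy_Schwarz] mult_mono cubic_L2 H1_L2 assms) auto
  ultimately have "\<bar>\<beta>\<bar> * cmod (ip (dx u) (dx \<phi>)) + \<bar>lam\<bar> * cmod (ip (cubic u) \<phi>) \<le>
      \<bar>\<beta>\<bar> * (R * h1_norm L \<phi>) + \<bar>lam\<bar> * ((sobolev_const * R)\<^sup>2 * R * h1_norm L \<phi>)"
    by (intro add_mono mult_left_mono) auto
  moreover have "cmod (nls_gen u \<phi>) \<le> \<bar>\<beta>\<bar> * cmod (ip (dx u) (dx \<phi>)) + \<bar>lam\<bar> * cmod (ip (cubic u) \<phi>)"
    unfolding nls_gen_def by (rule order_trans[OF norm_triangle_ineq]) (simp add: norm_mult)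
  ultimately show ?thesis by (simp add: algebra_simps)
qed

text \<open>In H1 the curve is merely continuous, but its velocity is bounded in the dual, uniformly
  in \<phi>. This supplies the rate in time for all increments below.\<close>

lemma flow_weak_Lipschitz:
  assumes w: "flow w"
  shows "\<exists>C\<ge>0. \<forall>s\<in>{a..b}. \<forall>t\<in>{a..b}. \<forall>\<phi>\<in>H1.
    cmod (ip (\<lambda>x. w s x - w t x) \<phi>) \<le> C * \<bar>s - t\<bar> * h1_norm L \<phi>"
proof -
  obtain R where R: "R > 0" "\<And>t. t \<in> {a..b} \<Longrightarrow> h1_norm L (w t) \<le> R"
    using flow_bounded[OF w] by metis
  define C where "C = \<bar>\<beta>\<bar> * R + \<bar>lam\<bar> * ((sobolev_const * R)\<^sup>2 * R)"
  have "C \<ge> 0" using R(1) by (simp add: C_def)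
  moreover have "cmod (ip (\<lambda>x. w s x - w t x) \<phi>) \<le> C * \<bar>s - t\<bar> * h1_norm L \<phi>"
    if st: "s \<in> {a..b}" "t \<in> {a..b}" and \<phi>: "\<phi> \<in> H1" for s t \<phi>
  proof -
    have "norm (ip (w s) \<phi> - ip (w t) \<phi>) \<le> (C * h1_norm L \<phi>) * norm (s - t)"
    proof (rule differentiable_bound[where S = "{a..b}" and f' = "\<lambda>t h. h *\<^sub>R nls_gen (w t) \<phi>"])
      show "((\<lambda>s. ip (w s) \<phi>) has_derivative (\<lambda>h. h *\<^sub>R nls_gen (w t) \<phi>)) (at t within {a..b})" for t
        using flow_deriv[OF w \<phi>, of t] by (simp add: has_vector_derivative_def has_derivative_at_withinI)
      fix t assume t: "t \<in> {a..b}"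
      show "onorm (\<lambda>h. h *\<^sub>R nls_gen (w t) \<phi>) \<le> C * h1_norm L \<phi>"
      proof (rule onorm_bound)
        show "0 \<le> C * h1_norm L \<phi>" using \<open>C \<ge> 0\<close> h1_norm_nonneg by simp
        show "norm (h *\<^sub>R nls_gen (w t) \<phi>) \<le> C * h1_norm L \<phi> * norm h" for h
          using nls_gen_bound[OF flow_H1[OF w] R(2)[OF t] \<phi>]
          by (simp add: C_def mult.commute mult_left_mono)
      qed
    qed (use st in auto)
    then show ?thesis
      using w \<phi> by (simp add: ip_diff_left H1_L2 flow_H1 mult_ac)
  qed
  ultimately show ?thesis by (intro exI[of _ C] conjI ballI)
qed

lemma flow_time_shift: assumes w: "flow w" shows "flow (\<lambda>t. w (t + h))"
  unfolding flow_def
proof (intro conjI allI ballI)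
  show "w (t + h) \<in> H1" for t by (rule flow_H1[OF w])
  show "((\<lambda>s. h1_dist L (w (s + h)) (w (t + h))) \<longlongrightarrow> 0) (at t)" for t
  proof -
    have "isCont (\<lambda>s. h1_dist L (w (s + h)) (w (t + h))) t"
      by (rule isCont_o2[where f = "\<lambda>s. s + h" and g = "\<lambda>s. h1_dist L (w s) (w (t + h))"])
        (simp_all add: flow_isCont w)
    then show ?thesis by (simp add: isCont_def h1_dist_self flow_H1 w)
  qed
  fix \<phi> t assume \<phi>: "\<phi> \<in> H1"
  have "(((\<lambda>s. ip (w s) \<phi>) \<circ> (\<lambda>s. s + h)) has_vector_derivative 1 *\<^sub>R nls_gen (w (t + h)) \<phi>) (at t)"
    by (rule vector_diff_chain_at[OF _ flow_deriv[OF w \<phi>]]) (auto intro!: derivative_eq_intros)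
  then show "((\<lambda>s. ip (w (s + h)) \<phi>) has_vector_derivative nls_gen (w (t + h)) \<phi>) (at t)"
    by (simp add: o_def)
qed

lemma flow_space_shift:
  assumes w: "flow w" and \<eta>: "0 \<le> \<eta>" "\<eta> \<le> L"
  shows "flow (\<lambda>t x. w t (x - \<eta>))"
  unfolding flow_def
proof (intro conjI allI ballI)
  show "(\<lambda>x. w t (x - \<eta>)) \<in> H1" for t by (intro H1_shift flow_H1 w \<eta>)
  show "((\<lambda>s. h1_dist L (\<lambda>x. w s (x - \<eta>)) (\<lambda>x. w t (x - \<eta>))) \<longlongrightarrow> 0) (at t)" for t
    using w by (simp add: h1_dist_shift flow_H1 \<eta> flow_def)
  fix \<phi> t assume \<phi>: "\<phi> \<in> H1"
  \<comment> \<open>Translation by L - \<eta> is translation by -\<eta> up to a period, and it stays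
    in the range of the shift lemmas.\<close>
  define \<psi> where "\<psi> x = \<phi> (x - (L - \<eta>))" for x
  have \<psi>: "\<psi> \<in> H1" unfolding \<psi>_def using \<phi> \<eta> by (intro H1_shift) auto
  have \<phi>\<psi>: "\<phi> = (\<lambda>x. \<psi> (x - \<eta>))"
  proof
    show "\<phi> x = \<psi> (x - \<eta>)" for x using H1_periodic[OF \<phi>, of "x - L"] by (simp add: \<psi>_def)
  qed
  have 1: "ip (\<lambda>x. f (x - \<eta>)) \<phi> = ip f \<psi>" if "f \<in> L2" for f
    unfolding \<phi>\<psi> by (intro ip_shift that H1_L2 \<psi> \<eta>)
  have 2: "ip (dx (\<lambda>x. w t (x - \<eta>))) (dx \<phi>) = ip (dx (w t)) (dx \<psi>)"
  proof -
    note wt = flow_H1[OF w, of t]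
    have "ip (dx (\<lambda>x. w t (x - \<eta>))) (dx \<phi>) = ip (\<lambda>x. dx (w t) (x - \<eta>)) (dx \<phi>)"
      by (intro ip_dx H1_shift dx_weak_shift dx_L2 \<phi> wt \<eta>)
    also have "\<dots> = ip (\<lambda>x. dx (w t) (x - \<eta>)) (dx (\<lambda>x. \<psi> (x - \<eta>)))" unfolding \<phi>\<psi> ..
    also have "\<dots> = ip (\<lambda>x. dx (w t) (x - \<eta>)) (\<lambda>x. dx \<psi> (x - \<eta>))"
      by (intro ip_dx_right H1_shift dx_weak_shift L2_shift dx_L2 \<psi> wt \<eta>)
    also have "\<dots> = ip (dx (w t)) (dx \<psi>)" by (intro ip_shift dx_L2 \<psi> wt \<eta>)
    finally show ?thesis .
  qed
  have 3: "cubic (\<lambda>x. w t (x - \<eta>)) = (\<lambda>x. cubic (w t) (x - \<eta>))" by (simp add: cubic_def[abs_def])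
  have "nls_gen (\<lambda>x. w t (x - \<eta>)) \<phi> = nls_gen (w t) \<psi>"
    unfolding nls_gen_def 2 3 1[OF cubic_L2[OF flow_H1[OF w]]] ..
  moreover have "(\<lambda>s. ip (\<lambda>x. w s (x - \<eta>)) \<phi>) = (\<lambda>s. ip (w s) \<psi>)"
    by (simp add: 1 H1_L2 flow_H1 w)
  ultimately show "((\<lambda>s. ip (\<lambda>x. w s (x - \<eta>)) \<phi>) has_vector_derivative nls_gen (\<lambda>x. w t (x - \<eta>)) \<phi>) (at t)"
    using flow_deriv[OF w \<psi>] by simp
qed

text \<open>The dispersive terms cancel because \<open>\<i> \<partial>\<^sub>x\<^sub>x\<close> is skew-adjoint.\<close>

lemma flow_ip_deriv:
  assumes p: "flow p" and r: "flow r"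
  shows "((\<lambda>t. ip (p t) (r t)) has_vector_derivative
    \<i> * of_real lam * (ip (cubic (p t)) (r t) - ip (p t) (cubic (r t)))) (at t)"
proof -
  note pH = flow_H1[OF p] and rH = flow_H1[OF r]
  obtain C where C: "C \<ge> 0" "\<forall>s\<in>{t-1..t+1}. \<forall>s'\<in>{t-1..t+1}. \<forall>\<phi>\<in>H1.
    cmod (ip (\<lambda>x. p s x - p s' x) \<phi>) \<le> C * \<bar>s - s'\<bar> * h1_norm L \<phi>"
    using flow_weak_Lipschitz[OF p, of "t-1" "t+1"] by (elim exE conjE)
  have a: "((\<lambda>h. (ip (p (t + h)) (r t) - ip (p t) (r t)) /\<^sub>R h) \<longlongrightarrow> nls_gen (p t) (r t)) (at 0)"
    using flow_deriv[OF p rH] unfolding has_vector_derivative_iff_quotient .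
  have "((\<lambda>h. (ip (r (t + h)) (p t) - ip (r t) (p t)) /\<^sub>R h) \<longlongrightarrow> nls_gen (r t) (p t)) (at 0)"
    using flow_deriv[OF r pH] unfolding has_vector_derivative_iff_quotient .
  then have "((\<lambda>h. cnj ((ip (r (t + h)) (p t) - ip (r t) (p t)) /\<^sub>R h)) \<longlongrightarrow> cnj (nls_gen (r t) (p t))) (at 0)"
    by (rule tendsto_cnj)
  then have b: "((\<lambda>h. (ip (p t) (r (t + h)) - ip (p t) (r t)) /\<^sub>R h) \<longlongrightarrow> cnj (nls_gen (r t) (p t))) (at 0)"
    by (simp add: ip_cnj)
  \<comment> \<open>Second-order term of the product rule. One increment is O(h) in the dual norm
    and the other tends to 0 in H1, so the quotient by h vanishes without differentiability of the
    curves in H1.\<close>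
  let ?d = "\<lambda>h. ip (\<lambda>x. p (t + h) x - p t x) (\<lambda>x. r (t + h) x - r t x)"
  have c: "((\<lambda>h. ?d h /\<^sub>R h) \<longlongrightarrow> 0) (at 0)"
  proof (rule tendsto_0_le[where K = C])
    have "((\<lambda>s. h1_dist L (r s) (r t)) \<longlongrightarrow> 0) (at t)" using r by (simp add: flow_def)
    then show "((\<lambda>h. h1_dist L (r (t + h)) (r t)) \<longlongrightarrow> 0) (at 0)"
      by (subst (asm) LIM_offset_zero_iff) (simp_all)
    have "norm (?d h /\<^sub>R h) \<le> norm (h1_dist L (r (t + h)) (r t)) * C" if "h \<noteq> 0" "\<bar>h\<bar> < 1" for h
    proof -
      have "cmod (?d h) \<le> C * \<bar>h\<bar> * h1_dist L (r (t + h)) (r t)"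
      proof -
        have "t + h \<in> {t-1..t+1}" "t \<in> {t-1..t+1}" "(\<lambda>x. r (t + h) x - r t x) \<in> H1"
          using that(2) H1_diff[OF rH rH] by auto
        from C(2)[rule_format, OF this] show ?thesis by (simp add: h1_dist_def)
      qed
      then have "cmod (?d h) / \<bar>h\<bar> \<le> C * h1_dist L (r (t + h)) (r t)"
        using that(1) by (simp add: pos_divide_le_eq mult_ac)
      then show ?thesis by (simp add: h1_dist_nonneg divide_inverse mult_ac)
    qed
    then show "eventually (\<lambda>h. norm (?d h /\<^sub>R h) \<le> norm (h1_dist L (r (t + h)) (r t)) * C) (at 0)"
      unfolding eventually_at by (intro exI[of _ 1]) auto
  qed
  have "((\<lambda>h. (ip (p (t + h)) (r t) - ip (p t) (r t)) /\<^sub>R h + (ip (p t) (r (t + h)) - ip (p t) (r t)) /\<^sub>R h + ?d h /\<^sub>R h)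
      \<longlongrightarrow> nls_gen (p t) (r t) + cnj (nls_gen (r t) (p t)) + 0) (at 0)"
    by (intro tendsto_add a b c)
  moreover have "(ip (p (t + h)) (r t) - ip (p t) (r t)) /\<^sub>R h + (ip (p t) (r (t + h)) - ip (p t) (r t)) /\<^sub>R h + ?d h /\<^sub>R h
      = (ip (p (t + h)) (r (t + h)) - ip (p t) (r t)) /\<^sub>R h" for h
    by (simp add: ip_diff_left ip_diff_right L2_diff H1_L2 pH rH flip: scaleR_add_right)
  moreover have "nls_gen (p t) (r t) + cnj (nls_gen (r t) (p t)) + 0 =
      \<i> * of_real lam * (ip (cubic (p t)) (r t) - ip (p t) (cubic (r t)))"
    unfolding nls_gen_def complex_cnj_add complex_cnj_mult ip_cnj
    by (simp add: algebra_simps)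
  ultimately show ?thesis unfolding has_vector_derivative_iff_quotient by simp
qed

lemma mass_conserved:
  assumes w: "flow w"
  shows "nrm (w t) = nrm (w s)"
proof -
  have "ip (cubic (w t)) (w t) = ip (w t) (cubic (w t))" for t
    unfolding ip_eq by (intro Bochner_Integration.integral_cong) (auto simp: cubic_def mult_ac)
  then have "((\<lambda>t. ip (w t) (w t)) has_vector_derivative 0) (at t)" for t
    using flow_ip_deriv[OF w w, of t] by simp
  then have "((\<lambda>t. ip (w t) (w t)) has_derivative (\<lambda>h. 0)) (at t within UNIV)" for t
    by (simp add: has_vector_derivative_def)
  then obtain c where "\<And>t. ip (w t) (w t) = c"
    using has_derivative_zero_constant[of UNIV "\<lambda>t. ip (w t) (w t)"] by auto
  then show ?thesis by (simp add: nrm_def)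
qed

section \<open>The quartic functional and pairings of two solutions\<close>

definition quartic :: "(real \<Rightarrow> complex) \<Rightarrow> real" where
  "quartic u = integral\<^sup>L TL (\<lambda>x. (cmod (u x)) ^ 4)"

text \<open>The part of the nonlinear term that is quadratic in the increment u - v; the translation
  arguments live on this smallness.\<close>

definition quartic_rest :: "(real \<Rightarrow> complex) \<Rightarrow> (real \<Rightarrow> complex) \<Rightarrow> real" where
  "quartic_rest u v = integral\<^sup>L TL (\<lambda>x. ((cmod (u x))\<^sup>2 - (cmod (v x))\<^sup>2) * (cmod (u x - v x))\<^sup>2)"

text \<open>Pointwise the left side is (|a|^2 - |b|^2) Re(a cnj b), and polarization gives Re(a cnj
  b) = (|a|^2 + |b|^2 - |a - b|^2)/2.\<close>

lemma cubic_ip_diff: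
  assumes u: "u \<in> H1" and v: "v \<in> H1"
  shows "Re (ip (cubic u) v - ip u (cubic v)) = (quartic u - quartic v) / 2 - quartic_rest u v / 2"
proof -
  note c = H1_continuous[OF u] H1_continuous[OF v]
  have "ip (cubic u) v - ip u (cubic v) = integral\<^sup>L TL (\<lambda>x. cubic u x * cnj (v x) - u x * cnj (cubic v x))"
    unfolding ip_eq
    by (intro Bochner_Integration.integral_diff[symmetric] ip_integrable cubic_L2 H1_L2 u v)
  also have "Re \<dots> = integral\<^sup>L TL (\<lambda>x. Re (cubic u x * cnj (v x) - u x * cnj (cubic v x)))"
    by (rule integral_Re[symmetric])
       (intro Bochner_Integration.integrable_diff ip_integrable cubic_L2 H1_L2 u v)
  also have "\<dots> = integral\<^sup>L TL (\<lambda>x. ((cmod (u x)) ^ 4 - (cmod (v x)) ^ 4) / 2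
      - ((cmod (u x))\<^sup>2 - (cmod (v x))\<^sup>2) * (cmod (u x - v x))\<^sup>2 / 2)"
  proof (intro Bochner_Integration.integral_cong refl)
    fix x
    define a b where "a = u x" "b = v x"
    have 1: "Re (cubic u x * cnj (v x) - u x * cnj (cubic v x)) = ((cmod a)\<^sup>2 - (cmod b)\<^sup>2) * Re (a * cnj b)"
      by (simp add: cubic_def a_b_def algebra_simps)
    have "(cmod (a - b))\<^sup>2 = (cmod a)\<^sup>2 + (cmod b)\<^sup>2 - 2 * Re (a * cnj b)"
      unfolding cmod_power2 by (simp add: power2_eq_square algebra_simps)
    then have 2: "Re (a * cnj b) = ((cmod a)\<^sup>2 + (cmod b)\<^sup>2 - (cmod (a - b))\<^sup>2) / 2" by simp
    have 4: "y ^ 4 = (y\<^sup>2)\<^sup>2" for y :: real by (simp flip: power_mult)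
    show "Re (cubic u x * cnj (v x) - u x * cnj (cubic v x)) = ((cmod (u x)) ^ 4 - (cmod (v x)) ^ 4) / 2
      - ((cmod (u x))\<^sup>2 - (cmod (v x))\<^sup>2) * (cmod (u x - v x))\<^sup>2 / 2"
      unfolding 1 unfolding 2 a_b_def[symmetric] 4
      by (simp add: power2_eq_square[of "_\<^sup>2"] field_simps)
  qed
  also have "\<dots> = (quartic u - quartic v) / 2 - quartic_rest u v / 2"
  proof -
    have i: "integrable TL (\<lambda>x. (cmod (u x)) ^ 4)" "integrable TL (\<lambda>x. (cmod (v x)) ^ 4)"
      "integrable TL (\<lambda>x. ((cmod (u x))\<^sup>2 - (cmod (v x))\<^sup>2) * (cmod (u x - v x))\<^sup>2)"
      by (intro cont_integrable continuous_intros c)+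
    show ?thesis unfolding quartic_def quartic_rest_def using i by simp
  qed
  finally show ?thesis .
qed

lemma quartic_rest_bound:
  assumes u: "u \<in> H1" and v: "v \<in> H1" and B: "\<And>x. cmod (u x) \<le> B" "\<And>x. cmod (v x) \<le> B"
  shows "\<bar>quartic_rest u v\<bar> \<le> B\<^sup>2 * (nrm (\<lambda>x. u x - v x))\<^sup>2"
proof -
  note c = H1_continuous[OF u] H1_continuous[OF v]
  have "\<bar>quartic_rest u v\<bar> \<le> integral\<^sup>L TL (\<lambda>x. \<bar>((cmod (u x))\<^sup>2 - (cmod (v x))\<^sup>2) * (cmod (u x - v x))\<^sup>2\<bar>)"
    unfolding quartic_rest_def by (rule integral_abs_bound)
  also have "\<dots> \<le> integral\<^sup>L TL (\<lambda>x. B\<^sup>2 * (cmod (u x - v x))\<^sup>2)"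
  proof (rule integral_mono)
    show "integrable TL (\<lambda>x. \<bar>((cmod (u x))\<^sup>2 - (cmod (v x))\<^sup>2) * (cmod (u x - v x))\<^sup>2\<bar>)"
      "integrable TL (\<lambda>x. B\<^sup>2 * (cmod (u x - v x))\<^sup>2)"
      by (intro cont_integrable continuous_intros c)+
    fix x
    have "0 \<le> (cmod (u x))\<^sup>2" "(cmod (u x))\<^sup>2 \<le> B\<^sup>2" "0 \<le> (cmod (v x))\<^sup>2" "(cmod (v x))\<^sup>2 \<le> B\<^sup>2"
      using B by (auto intro: power_mono)
    then have "\<bar>(cmod (u x))\<^sup>2 - (cmod (v x))\<^sup>2\<bar> \<le> B\<^sup>2" by linarith
    then show "\<bar>((cmod (u x))\<^sup>2 - (cmod (v x))\<^sup>2) * (cmod (u x - v x))\<^sup>2\<bar> \<le> B\<^sup>2 * (cmod (u x - v x))\<^sup>2"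
      unfolding abs_mult by (simp add: mult_right_mono)
  qed
  also have "\<dots> = B\<^sup>2 * (nrm (\<lambda>x. u x - v x))\<^sup>2" by (simp add: nrm_sq)
  finally show ?thesis .
qed

text \<open>For a solution and its translate the first term vanishes or is an exact time derivative,
  which leaves the quadratic rest.\<close>

lemma flow_Im_deriv:
  assumes p: "flow p" and r: "flow r"
  shows "((\<lambda>t. Im (ip (p t) (r t))) has_real_derivative
    lam / 2 * (quartic (p t) - quartic (r t)) - lam / 2 * quartic_rest (p t) (r t)) (at t)"
proof -
  have "((\<lambda>t. Im (ip (p t) (r t))) has_vector_derivative
      Im (\<i> * of_real lam * (ip (cubic (p t)) (r t) - ip (p t) (cubic (r t))))) (at t)"
    using bounded_linear.has_vector_derivative[OF bounded_linear_Im flow_ip_deriv[OF p r]] .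
  moreover have "Im (\<i> * of_real lam * (ip (cubic (p t)) (r t) - ip (p t) (cubic (r t)))) =
      lam * Re (ip (cubic (p t)) (r t) - ip (p t) (cubic (r t)))"
    by (simp add: algebra_simps)
  moreover have "\<dots> = lam / 2 * (quartic (p t) - quartic (r t)) - lam / 2 * quartic_rest (p t) (r t)"
    unfolding cubic_ip_diff[OF flow_H1[OF p] flow_H1[OF r]] by (simp add: right_diff_distrib diff_divide_distrib)
  ultimately show ?thesis by (simp add: has_real_derivative_iff_has_vector_derivative)
qed

subsection \<open>Conservation of momentum and energy\<close>

lemma quartic_shift: "u \<in> H1 \<Longrightarrow> 0 \<le> \<eta> \<Longrightarrow> \<eta> \<le> L \<Longrightarrow> quartic (\<lambda>x. u (x - \<eta>)) = quartic u"
  unfolding quartic_def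
  by (rule integral_TL_shift[where f = "\<lambda>x. (cmod (u x)) ^ 4"])
     (auto intro!: cont_integrable borel_measurable_continuous_onI continuous_intros H1_continuous simp: H1_periodic)

lemma H1_sup_le:
  assumes "u \<in> H1" "h1_norm L u \<le> R"
  shows "cmod (u x) \<le> sobolev_const * R"
  using H1_sup[OF assms(1), of x] mult_left_mono[OF assms(2), of sobolev_const] sobolev_const_pos by linarith

definition momentum :: "(real \<Rightarrow> complex) \<Rightarrow> real" where
  "momentum u = Im (ip (dx u) u)"

text \<open>The pairing of \<open>u\<close> with itself is real, so the imaginary part of the
  pairing with a translate is already an increment.\<close>

lemma momentum_limit:
  assumes u: "u \<in> H1"
  shows "((\<lambda>\<eta>. Im (ip (\<lambda>x. u (x - \<eta>)) u) / \<eta>) \<longlongrightarrow> - momentum u) (at_right 0)"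
proof -
  have "((\<lambda>\<eta>. Im (ip (\<lambda>x. u (x - \<eta>) - u x) u / of_real \<eta>)) \<longlongrightarrow> Im (- ip (dx u) u)) (at_right 0)"
    by (intro tendsto_Im shift_quotient u)
  then have "((\<lambda>\<eta>. Im (ip (\<lambda>x. u (x - \<eta>) - u x) u / of_real \<eta>)) \<longlongrightarrow> - momentum u) (at_right 0)"
    by (simp add: momentum_def)
  moreover have "eventually (\<lambda>\<eta>. Im (ip (\<lambda>x. u (x - \<eta>) - u x) u / of_real \<eta>) = Im (ip (\<lambda>x. u (x - \<eta>)) u) / \<eta>) (at_right 0)"
    unfolding eventually_at_right_field
  proof (intro exI[of _ L] conjI allI impI)
    fix \<eta> assume "0 < \<eta>" "\<eta> < L"
    then have "ip (\<lambda>x. u (x - \<eta>) - u x) u = ip (\<lambda>x. u (x - \<eta>)) u - ip u u"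
      using u by (intro ip_diff_left L2_shift H1_L2) auto
    then show "Im (ip (\<lambda>x. u (x - \<eta>) - u x) u / of_real \<eta>) = Im (ip (\<lambda>x. u (x - \<eta>)) u) / \<eta>"
      by (simp add: ip_self_nrm flip: of_real_power)
  qed (rule L_pos)
  ultimately show ?thesis by (rule Lim_transform_eventually)
qed

text \<open>Space translates have the same quartic, so the pairing changes over the time interval
  only by O(\<eta>^2); after division by \<eta> the change tends to zero.\<close>

lemma momentum_conserved_less:
  assumes w: "flow w" and ab: "a < b"
  shows "momentum (w b) = momentum (w a)"
proof -
  note wH = flow_H1[OF w]
  obtain R where R: "R > 0" "\<And>t. t \<in> {a..b} \<Longrightarrow> h1_norm L (w t) \<le> R"
    using flow_bounded[OF w] by metis
  define K where "K = \<bar>lam\<bar> / 2 * ((sobolev_const * R)\<^sup>2 * R\<^sup>2) * (b - a)"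
  let ?J = "\<lambda>\<eta> t. Im (ip (\<lambda>x. w t (x - \<eta>)) (w t))"
  have J: "\<bar>?J \<eta> b - ?J \<eta> a\<bar> \<le> K * \<eta>\<^sup>2" if \<eta>: "0 < \<eta>" "\<eta> < L" for \<eta>
  proof -
    have fl: "flow (\<lambda>t x. w t (x - \<eta>))" using w \<eta> by (intro flow_space_shift) auto
    have "\<bar>?J \<eta> b - ?J \<eta> a\<bar> \<le> (\<bar>lam\<bar> / 2 * ((sobolev_const * R)\<^sup>2 * (\<eta> * R)\<^sup>2)) * (b - a)"
    proof (rule deriv_bound_diff[OF ab flow_Im_deriv[OF fl w]])
      fix t assume t: "t \<in> {a..b}"
      have "\<bar>quartic_rest (\<lambda>x. w t (x - \<eta>)) (w t)\<bar> \<le> (sobolev_const * R)\<^sup>2 * (nrm (\<lambda>x. w t (x - \<eta>) - w t x))\<^sup>2"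
        by (intro quartic_rest_bound flow_H1[OF fl] wH H1_sup_le[OF wH] R(2)[OF t])
      also have "\<dots> \<le> (sobolev_const * R)\<^sup>2 * (\<eta> * R)\<^sup>2"
      proof (intro mult_left_mono power_mono)
        have "nrm (\<lambda>x. w t (x - \<eta>) - w t x) \<le> \<eta> * nrm (dx (w t))"
          using \<eta> by (intro nrm_shift_diff H1_continuous H1_periodic H1_dx wH) auto
        also have "\<dots> \<le> \<eta> * R"
          using nrm_dx_le_h1[OF wH, of t] R(2)[OF t] \<eta> by (intro mult_left_mono) auto
        finally show "nrm (\<lambda>x. w t (x - \<eta>) - w t x) \<le> \<eta> * R" .
      qed auto
      finally have "\<bar>lam\<bar> / 2 * \<bar>quartic_rest (\<lambda>x. w t (x - \<eta>)) (w t)\<bar> \<le> \<bar>lam\<bar> / 2 * ((sobolev_const * R)\<^sup>2 * (\<eta> * R)\<^sup>2)"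
        by (intro mult_left_mono) auto
      moreover have "quartic (\<lambda>x. w t (x - \<eta>)) = quartic (w t)"
        using \<eta> by (intro quartic_shift wH) auto
      ultimately show "\<bar>lam / 2 * (quartic (\<lambda>x. w t (x - \<eta>)) - quartic (w t)) - lam / 2 * quartic_rest (\<lambda>x. w t (x - \<eta>)) (w t)\<bar>
          \<le> \<bar>lam\<bar> / 2 * ((sobolev_const * R)\<^sup>2 * (\<eta> * R)\<^sup>2)"
        by (simp add: abs_mult)
    qed
    then show ?thesis by (simp add: K_def power_mult_distrib mult_ac)
  qed
  have "((\<lambda>\<eta>. ?J \<eta> b / \<eta> - ?J \<eta> a / \<eta>) \<longlongrightarrow> - momentum (w b) - (- momentum (w a))) (at_right 0)"
    by (intro tendsto_diff momentum_limit wH)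
  moreover have "((\<lambda>\<eta>. ?J \<eta> b / \<eta> - ?J \<eta> a / \<eta>) \<longlongrightarrow> 0) (at_right 0)"
  proof (rule Lim_null_comparison)
    show "eventually (\<lambda>\<eta>. norm (?J \<eta> b / \<eta> - ?J \<eta> a / \<eta>) \<le> K * \<eta>) (at_right 0)"
      unfolding eventually_at_right_field
    proof (intro exI[of _ L] conjI allI impI)
      fix \<eta> assume \<eta>: "0 < \<eta>" "\<eta> < L"
      have "norm (?J \<eta> b / \<eta> - ?J \<eta> a / \<eta>) = \<bar>?J \<eta> b - ?J \<eta> a\<bar> / \<eta>"
        using \<eta> by (simp flip: diff_divide_distrib)
      also have "\<dots> \<le> (K * \<eta>\<^sup>2) / \<eta>" using J[OF \<eta>] \<eta> by (intro divide_right_mono) auto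
      also have "\<dots> = K * \<eta>" using \<eta> by (simp add: power2_eq_square)
      finally show "norm (?J \<eta> b / \<eta> - ?J \<eta> a / \<eta>) \<le> K * \<eta>" .
    qed (rule L_pos)
    have "((\<lambda>\<eta>. K * \<eta>) \<longlongrightarrow> K * 0) (at_right 0)" by (intro tendsto_intros)
    then show "((\<lambda>\<eta>. K * \<eta>) \<longlongrightarrow> 0) (at_right 0)" by simp
  qed
  ultimately have "- momentum (w b) - (- momentum (w a)) = 0"
    by (intro tendsto_unique[of "at_right (0::real)"]) auto
  then show ?thesis by simp
qed

lemma momentum_conserved: "flow w \<Longrightarrow> momentum (w t) = momentum (w s)"
  using momentum_conserved_less[of w s t] momentum_conserved_less[of w t s]
  by (cases s t rule: linorder_cases) auto

definition energy :: "(real \<Rightarrow> complex) \<Rightarrow> real" where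
  "energy u = \<beta> / 2 * (nrm (dx u))\<^sup>2 - lam / 4 * quartic u"

lemma nls_gen_self: "u \<in> H1 \<Longrightarrow> Im (nls_gen u u) = - \<beta> * (nrm (dx u))\<^sup>2 + lam * quartic u"
proof -
  assume "u \<in> H1"
  have "ip (cubic u) u = of_real (quartic u)"
  proof -
    have "ip (cubic u) u = integral\<^sup>L TL (\<lambda>x. of_real ((cmod (u x)) ^ 4))"
      unfolding ip_eq
    proof (intro Bochner_Integration.integral_cong refl)
      fix x
      have "cubic u x * cnj (u x) = of_real ((cmod (u x))\<^sup>2) * of_real ((cmod (u x))\<^sup>2)"
        unfolding cubic_def mult.assoc complex_norm_square[symmetric] ..
      also have "\<dots> = of_real ((cmod (u x)) ^ 4)"
        by (simp flip: power_add)
      finally show "cubic u x * cnj (u x) = of_real ((cmod (u x)) ^ 4)" .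
    qed
    then show ?thesis unfolding quartic_def by (simp only: integral_complex_of_real)
  qed
  then show ?thesis by (simp add: nls_gen_def ip_self_nrm flip: of_real_power)
qed

text \<open>The distance of two states of the flow is continuous in both times jointly and vanishes
  on the diagonal; uniform continuity on a compact square gives the claim.\<close>

lemma flow_uniform:
  assumes w: "flow w" and e: "e > 0"
  shows "\<exists>\<delta>>0. \<forall>t\<in>{a..b}. \<forall>h. 0 < h \<and> h < \<delta> \<longrightarrow> h1_dist L (w (t + h)) (w t) < e"
proof -
  note wH = flow_H1[OF w]
  let ?G = "\<lambda>z. h1_dist L (w (fst z)) (w (snd z))"
  have "continuous_on UNIV ?G"
  proof (intro continuous_at_imp_continuous_on ballI)
    fix z0 :: "real \<times> real"
    have f: "isCont (\<lambda>z. h1_dist L (w (fst z)) (w (fst z0))) z0"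
      by (rule isCont_o2[where f = fst and g = "\<lambda>s. h1_dist L (w s) (w (fst z0))"])
         (auto intro!: flow_isCont w continuous_intros)
    have s: "isCont (\<lambda>z. h1_dist L (w (snd z)) (w (snd z0))) z0"
      by (rule isCont_o2[where f = snd and g = "\<lambda>s. h1_dist L (w s) (w (snd z0))"])
         (auto intro!: flow_isCont w continuous_intros)
    have lim: "((\<lambda>z. h1_dist L (w (fst z)) (w (fst z0)) + h1_dist L (w (snd z)) (w (snd z0))) \<longlongrightarrow> 0 + 0) (at z0)"
      using f s unfolding isCont_def h1_dist_self[OF wH] by (rule tendsto_add)
    have "norm (?G z - ?G z0) \<le> h1_dist L (w (fst z)) (w (fst z0)) + h1_dist L (w (snd z)) (w (snd z0))" for z
      unfolding real_norm_def abs_le_iff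
      using h1_dist_triangle[OF wH wH wH, of "fst z" "snd z" "fst z0"] h1_dist_triangle[OF wH wH wH, of "fst z0" "snd z" "snd z0"]
        h1_dist_triangle[OF wH wH wH, of "fst z0" "snd z0" "fst z"] h1_dist_triangle[OF wH wH wH, of "fst z" "snd z0" "snd z"]
        h1_dist_commute[OF wH wH, of "fst z0" "fst z"] h1_dist_commute[OF wH wH, of "snd z0" "snd z"]
      by (intro conjI) linarith+
    then have "eventually (\<lambda>z. norm (?G z - ?G z0) \<le> h1_dist L (w (fst z)) (w (fst z0)) + h1_dist L (w (snd z)) (w (snd z0))) (at z0)"
      by (intro always_eventually allI)
    from Lim_null_comparison[OF this] lim have "((\<lambda>z. ?G z - ?G z0) \<longlongrightarrow> 0) (at z0)" by simp
    then show "isCont ?G z0" unfolding isCont_def LIM_zero_iff .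
  qed
  \<comment> \<open>The square is enlarged by 1 so that t + h stays inside for h < 1.\<close>
  then have "uniformly_continuous_on ({a..b+1} \<times> {a..b+1}) ?G"
    by (intro compact_uniformly_continuous compact_Times) (auto intro: continuous_on_subset)
  then obtain d where d: "d > 0" "\<And>x y. x \<in> {a..b+1} \<times> {a..b+1} \<Longrightarrow> y \<in> {a..b+1} \<times> {a..b+1} \<Longrightarrow>
      dist x y < d \<Longrightarrow> dist (?G x) (?G y) < e"
    using e unfolding uniformly_continuous_on_def by metis
  show ?thesis
  proof (intro exI[of _ "min d 1"] conjI ballI allI impI)
    show "0 < min d 1" using d(1) by simp
    fix t h assume t: "t \<in> {a..b}" and h: "0 < h \<and> h < min d 1"
    have "dist (?G (t + h, t)) (?G (t, t)) < e"
      by (rule d(2)) (use t h in \<open>auto simp: dist_Pair_Pair dist_real_def\<close>)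
    then show "h1_dist L (w (t + h)) (w t) < e"
      by (simp add: h1_dist_self wH dist_real_def h1_dist_nonneg)
  qed
qed

lemma quartic_diff_bound:
  assumes u: "u \<in> H1" and v: "v \<in> H1" and R: "h1_norm L u \<le> R" "h1_norm L v \<le> R"
  shows "\<bar>quartic u - quartic v\<bar> \<le> 4 * (sobolev_const * R) ^ 3 * sobolev_const * L * h1_dist L u v"
proof -
  have R0: "0 \<le> R" using R(1) h1_norm_nonneg[of u] by linarith
  note c = H1_continuous[OF u] H1_continuous[OF v]
  have i: "integrable TL (\<lambda>x. (cmod (u x)) ^ 4)" "integrable TL (\<lambda>x. (cmod (v x)) ^ 4)"
    by (intro cont_integrable continuous_intros c)+
  have "quartic u - quartic v = integral\<^sup>L TL (\<lambda>x. (cmod (u x)) ^ 4 - (cmod (v x)) ^ 4)"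
    unfolding quartic_def using i by simp
  then have "\<bar>quartic u - quartic v\<bar> \<le> integral\<^sup>L TL (\<lambda>x. \<bar>(cmod (u x)) ^ 4 - (cmod (v x)) ^ 4\<bar>)"
    using integral_abs_bound by metis
  also have "\<dots> \<le> (4 * (sobolev_const * R) ^ 3 * (sobolev_const * h1_dist L u v)) * L"
  proof (rule integral_TL_mono_const)
    show "(\<lambda>x. \<bar>(cmod (u x)) ^ 4 - (cmod (v x)) ^ 4\<bar>) \<in> borel_measurable TL"
      by (intro measurable_TL borel_measurable_continuous_onI continuous_intros c)
    show "0 \<le> 4 * (sobolev_const * R) ^ 3 * (sobolev_const * h1_dist L u v)"
      using sobolev_const_pos R0 h1_dist_nonneg by simp
    fix x
    define a b where "a = cmod (u x)" "b = cmod (v x)"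
    have ab: "0 \<le> a" "0 \<le> b" "a \<le> sobolev_const * R" "b \<le> sobolev_const * R"
      unfolding a_b_def using H1_sup_le[OF u R(1)] H1_sup_le[OF v R(2)] by auto
    have "\<bar>a - b\<bar> \<le> cmod (u x - v x)" unfolding a_b_def by (rule norm_triangle_ineq3)
    then have d: "\<bar>a - b\<bar> \<le> sobolev_const * h1_dist L u v" using H1_sup_dist[OF u v, of x] by linarith
    have eq: "a ^ 4 - b ^ 4 = (a ^ 3 + a\<^sup>2 * b + a * b\<^sup>2 + b ^ 3) * (a - b)"
      by (simp add: power2_eq_square power3_eq_cube power4_eq_xxxx algebra_simps)
    define S where "S = sobolev_const * R"
    have pows: "a ^ 3 \<le> S ^ 3" "b ^ 3 \<le> S ^ 3" "a\<^sup>2 * b \<le> S\<^sup>2 * S" "a * b\<^sup>2 \<le> S * S\<^sup>2"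
      using ab unfolding S_def[symmetric] by (auto intro!: power_mono mult_mono)
    have "a ^ 3 + a\<^sup>2 * b + a * b\<^sup>2 + b ^ 3 \<le> S ^ 3 + S\<^sup>2 * S + S * S\<^sup>2 + S ^ 3"
      by (intro add_mono pows)
    also have "\<dots> = 4 * S ^ 3" by (simp add: power2_eq_square power3_eq_cube)
    finally have s: "a ^ 3 + a\<^sup>2 * b + a * b\<^sup>2 + b ^ 3 \<le> 4 * S ^ 3" .
    have "0 \<le> a ^ 3 + a\<^sup>2 * b + a * b\<^sup>2 + b ^ 3" using ab by simp
    then have "\<bar>a ^ 4 - b ^ 4\<bar> = (a ^ 3 + a\<^sup>2 * b + a * b\<^sup>2 + b ^ 3) * \<bar>a - b\<bar>"
      unfolding eq by (simp add: abs_mult)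
    also have "\<dots> \<le> 4 * (sobolev_const * R) ^ 3 * (sobolev_const * h1_dist L u v)"
      using s[unfolded S_def] d sobolev_const_pos R0 by (intro mult_mono) auto
    finally show "\<bar>(cmod (u x)) ^ 4 - (cmod (v x)) ^ 4\<bar> \<le> 4 * (sobolev_const * R) ^ 3 * (sobolev_const * h1_dist L u v)"
      by (simp add: a_b_def)
  qed
  finally show ?thesis by (simp add: mult_ac)
qed

lemma quartic_isCont: assumes w: "flow w" shows "isCont (\<lambda>t. quartic (w t)) t"
proof -
  note wH = flow_H1[OF w]
  define M where "M s = max (h1_norm L (w s)) (h1_norm L (w t))" for s
  show ?thesis
  proof (rule isCont_of_h1[OF w])
    show "dist (quartic (w s)) (quartic (w t)) \<le> 4 * (sobolev_const * M s) ^ 3 * sobolev_const * L * h1_dist L (w s) (w t)" for s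
      unfolding dist_real_def by (rule quartic_diff_bound[OF wH wH]) (auto simp: M_def)
    show "isCont (\<lambda>s. 4 * (sobolev_const * M s) ^ 3 * sobolev_const * L) t"
      unfolding M_def by (intro continuous_intros flow_norm_isCont w)
  qed
qed

text \<open>Time translation plays here the role that space translation plays for the momentum:
  the limit of \<open>Im \<langle>w(t + h), w(t)\<rangle> / h\<close>, corrected by the average of \<open>\<integral>|w|\<^sup>4\<close>, is \<open>- 2\<close> times the energy.\<close>

lemma energy_conserved_less:
  assumes w: "flow w" and ab: "a < b"
  shows "energy (w b) = energy (w a)"
proof -
  note wH = flow_H1[OF w]
  obtain R where R: "R > 0" "\<And>t. t \<in> {a..b+1} \<Longrightarrow> h1_norm L (w t) \<le> R"
    using flow_bounded[OF w] by metis
  obtain C where C: "C \<ge> 0" "\<forall>s\<in>{a..b+1}. \<forall>t\<in>{a..b+1}. \<forall>\<phi>\<in>H1.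
    cmod (ip (\<lambda>x. w s x - w t x) \<phi>) \<le> C * \<bar>s - t\<bar> * h1_norm L \<phi>"
    using flow_weak_Lipschitz[OF w, of a "b+1"] by (elim exE conjE)
  \<comment> \<open>An antiderivative of the quartic along the flow: lam/2 times the t-derivative of
    \<open>N (t + h) - N t\<close> cancels the difference of quartics in
    \<open>flow_Im_deriv\<close> exactly.\<close>
  obtain N where N: "\<And>t. (N has_real_derivative quartic (w t)) (at t)"
  proof -
    have "\<exists>F. \<forall>x::real. -\<infinity> < ereal x \<longrightarrow> ereal x < \<infinity> \<longrightarrow> (F has_vector_derivative quartic (w x)) (at x)"
      by (rule einterval_antiderivative) (auto intro: quartic_isCont w)
    then show thesis using that by (auto simp: has_real_derivative_iff_has_vector_derivative)
  qed
  define K where "K = \<bar>lam\<bar> / 2 * ((sobolev_const * R)\<^sup>2 * C) * (b - a)"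
  let ?Y = "\<lambda>h t. Im (ip (w (t + h)) (w t)) - lam / 2 * (N (t + h) - N t)"
  \<comment> \<open>In contrast to space translation, no O(h) bound in L2 is at hand for the
    increment. Pairing it with itself gives at most C h times its H1 norm, which is o(h) uniformly
    in t.\<close>
  have Y: "\<exists>\<delta>>0. \<forall>h. 0 < h \<and> h < \<delta> \<longrightarrow> \<bar>?Y h b - ?Y h a\<bar> \<le> K * h * e" if e: "e > 0" for e
  proof -
    obtain \<delta> where \<delta>: "\<delta> > 0" "\<forall>t\<in>{a..b}. \<forall>h. 0 < h \<and> h < \<delta> \<longrightarrow> h1_dist L (w (t + h)) (w t) < e"
      using flow_uniform[OF w e, of a b] by (elim exE conjE)
    show ?thesis
    proof (intro exI[of _ "min \<delta> 1"] conjI allI impI)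
      show "0 < min \<delta> 1" using \<delta>(1) by simp
      fix h assume h: "0 < h \<and> h < min \<delta> 1"
      note fl = flow_time_shift[OF w, of h]
      have "\<bar>?Y h b - ?Y h a\<bar> \<le> (\<bar>lam\<bar> / 2 * ((sobolev_const * R)\<^sup>2 * (C * h * e))) * (b - a)"
      proof (rule deriv_bound_diff[OF ab])
        have "((\<lambda>t. N (t + h)) has_real_derivative quartic (w (t + h))) (at t)" for t
          using DERIV_shift[of N "quartic (w (t + h))" t h] N by blast
        then show "(?Y h has_real_derivative
            lam / 2 * (quartic (w (t + h)) - quartic (w t)) - lam / 2 * quartic_rest (w (t + h)) (w t)
            - lam / 2 * (quartic (w (t + h)) - quartic (w t))) (at t)" for t
          by (intro DERIV_diff flow_Im_deriv[OF fl w] DERIV_cmult N)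
        fix t assume t: "t \<in> {a..b}"
        let ?d = "\<lambda>x. w (t + h) x - w t x"
        have tt: "t + h \<in> {a..b+1}" "t \<in> {a..b+1}" using t h by auto
        have "(nrm ?d)\<^sup>2 = cmod (ip ?d ?d)" by (simp add: ip_self_nrm norm_power)
        also have "\<dots> \<le> C * \<bar>(t + h) - t\<bar> * h1_norm L ?d"
          by (rule C(2)[rule_format, OF tt H1_diff[OF wH wH]])
        also have "\<dots> \<le> C * h * e"
        proof -
          have "h1_norm L ?d \<le> e" using \<delta>(2) t h unfolding h1_dist_def by force
          then show ?thesis using h C(1) by (simp add: mult_left_mono)
        qed
        finally have d: "(nrm ?d)\<^sup>2 \<le> C * h * e" .
        have "\<bar>quartic_rest (w (t + h)) (w t)\<bar> \<le> (sobolev_const * R)\<^sup>2 * (nrm ?d)\<^sup>2"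
          by (intro quartic_rest_bound wH H1_sup_le[OF wH] R(2) tt)
        also have "\<dots> \<le> (sobolev_const * R)\<^sup>2 * (C * h * e)" by (intro mult_left_mono d) auto
        finally have "\<bar>lam\<bar> / 2 * \<bar>quartic_rest (w (t + h)) (w t)\<bar> \<le> \<bar>lam\<bar> / 2 * ((sobolev_const * R)\<^sup>2 * (C * h * e))"
          by (intro mult_left_mono) auto
        then show "\<bar>lam / 2 * (quartic (w (t + h)) - quartic (w t)) - lam / 2 * quartic_rest (w (t + h)) (w t)
            - lam / 2 * (quartic (w (t + h)) - quartic (w t))\<bar> \<le> \<bar>lam\<bar> / 2 * ((sobolev_const * R)\<^sup>2 * (C * h * e))"
          by (simp add: abs_mult)
      qed
      then show "\<bar>?Y h b - ?Y h a\<bar> \<le> K * h * e" by (simp add: K_def mult_ac)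
    qed
  qed
  have lim: "((\<lambda>h. ?Y h t / h) \<longlongrightarrow> - 2 * energy (w t)) (at_right 0)" for t
  proof -
    have "((\<lambda>h. (ip (w (t + h)) (w t) - ip (w t) (w t)) /\<^sub>R h) \<longlongrightarrow> nls_gen (w t) (w t)) (at 0)"
      using flow_deriv[OF w wH] unfolding has_vector_derivative_iff_quotient .
    then have 1: "((\<lambda>h. Im ((ip (w (t + h)) (w t) - ip (w t) (w t)) /\<^sub>R h)) \<longlongrightarrow> Im (nls_gen (w t) (w t))) (at 0)"
      by (rule tendsto_Im)
    have 2: "((\<lambda>h. (N (t + h) - N t) / h) \<longlongrightarrow> quartic (w t)) (at 0)"
      using N[of t] by (simp add: DERIV_def)
    have "((\<lambda>h. Im ((ip (w (t + h)) (w t) - ip (w t) (w t)) /\<^sub>R h) - lam / 2 * ((N (t + h) - N t) / h))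
        \<longlongrightarrow> Im (nls_gen (w t) (w t)) - lam / 2 * quartic (w t)) (at 0)"
      by (rule tendsto_diff[OF 1 tendsto_mult_left[OF 2]])
    \<comment> \<open>The pairing contributes the full \<open>lam * quartic\<close>; the average
      removes half of it and so produces the coefficient of the energy.\<close>
    moreover have "Im (nls_gen (w t) (w t)) - lam / 2 * quartic (w t) = - 2 * energy (w t)"
      unfolding nls_gen_self[OF wH] energy_def by (simp add: algebra_simps)
    moreover have "Im ((ip (w (t + h)) (w t) - ip (w t) (w t)) /\<^sub>R h) - lam / 2 * ((N (t + h) - N t) / h) = ?Y h t / h" for h
    proof -
      have "Im (ip (w t) (w t)) = 0" by (simp add: ip_self_nrm flip: of_real_power)
      moreover have "Im (z /\<^sub>R h) = Im z / h" for z by (simp add: divide_inverse mult.commute)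
      ultimately show ?thesis
        by (simp only: minus_complex.simps diff_0_right diff_divide_distrib[of "Im _"] times_divide_eq_right)
    qed
    ultimately have "((\<lambda>h. ?Y h t / h) \<longlongrightarrow> - 2 * energy (w t)) (at 0)" by simp
    then show ?thesis by (rule tendsto_within_subset) simp
  qed
  have "((\<lambda>h. ?Y h b / h - ?Y h a / h) \<longlongrightarrow> - 2 * energy (w b) - (- 2 * energy (w a))) (at_right 0)"
    by (intro tendsto_diff lim)
  moreover have "((\<lambda>h. ?Y h b / h - ?Y h a / h) \<longlongrightarrow> 0) (at_right 0)"
  proof (rule tendstoI)
    fix e :: real assume e: "e > 0"
    have K0: "K \<ge> 0" using C(1) ab by (simp add: K_def)
    define e' where "e' = e / (K + 1)"
    have e': "e' > 0" using e K0 by (simp add: e'_def)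
    obtain \<delta> where \<delta>: "\<delta> > 0" "\<forall>h. 0 < h \<and> h < \<delta> \<longrightarrow> \<bar>?Y h b - ?Y h a\<bar> \<le> K * h * e'"
      using Y[OF e'] by (elim exE conjE)
    show "eventually (\<lambda>h. dist (?Y h b / h - ?Y h a / h) 0 < e) (at_right 0)"
      unfolding eventually_at_right_field
    proof (intro exI[of _ \<delta>] conjI allI impI \<delta>(1))
      fix h assume h: "0 < h" "h < \<delta>"
      have "dist (?Y h b / h - ?Y h a / h) 0 = \<bar>?Y h b - ?Y h a\<bar> / h"
        using h unfolding dist_real_def diff_divide_distrib[symmetric] by simp
      also have "\<dots> \<le> (K * h * e') / h" using \<delta>(2) h by (intro divide_right_mono) auto
      also have "\<dots> = K * e'" using h by simp
      also have "\<dots> < (K + 1) * e'" using e' by simp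
      also have "\<dots> = e" using K0 by (simp add: e'_def)
      finally show "dist (?Y h b / h - ?Y h a / h) 0 < e" .
    qed
  qed
  ultimately have "- 2 * energy (w b) - (- 2 * energy (w a)) = 0"
    by (intro tendsto_unique[of "at_right (0::real)"]) auto
  then show ?thesis by simp
qed

lemma energy_conserved: "flow w \<Longrightarrow> energy (w t) = energy (w s)"
  using energy_conserved_less[of w s t] energy_conserved_less[of w t s]
  by (cases s t rule: linorder_cases) auto

end

subsection \<open>Stability of plane waves\<close>

locale plane_wave = nls_torus +
  fixes n :: int
begin

text \<open>The plane wave with \<open>e\<^sup>-\<^sup>i\<^sup>k\<^sup>x\<close> is \<open>expo n\<close> with \<open>n = - k L / 2\<pi>\<close>, so that \<open>\<kappa> = - k\<close>.\<close>

abbreviation "\<kappa> \<equiv> 2 * pi / L * of_int n"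

text \<open>Up to null sets this is e times the derivative of v/e, where e is \<open>expo n\<close>;
  it vanishes on the multiples of e.\<close>

definition twist :: "(real \<Rightarrow> complex) \<Rightarrow> real \<Rightarrow> complex" where
  "twist v x = dx v x - \<i> * of_real \<kappa> * v x"

definition defect :: "(real \<Rightarrow> complex) \<Rightarrow> real" where
  "defect v = nrm (twist v)"

definition amp :: "(real \<Rightarrow> complex) \<Rightarrow> complex" where
  "amp v = fcoeff v n"

definition fluct :: "(real \<Rightarrow> complex) \<Rightarrow> real \<Rightarrow> complex" where
  "fluct v x = v x - amp v * expo n x"

definition density :: "(real \<Rightarrow> complex) \<Rightarrow> real" where
  "density v = (nrm v)\<^sup>2 / L"

text \<open>By \<open>variance\<close> with the density as centre, the bracket is the integral of
  (|v|^2 - density)^2. In the present form it is a combination of energy, momentum and powers of the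
  mass.\<close>

definition lyap :: "(real \<Rightarrow> complex) \<Rightarrow> real" where
  "lyap v = \<beta> / 2 * (defect v)\<^sup>2 - lam / 4 * (quartic v - (density v)\<^sup>2 * L)"

lemma twist_L2: "v \<in> H1 \<Longrightarrow> twist v \<in> L2"
  unfolding twist_def[abs_def] by (intro L2_diff L2_cmult dx_L2 H1_L2)

lemma defect_nonneg: "0 \<le> defect v"
  by (simp add: defect_def)

text \<open>Expanding the square leaves, besides the kinetic term, only mass and momentum, which is
  why the defect can enter a conserved quantity.\<close>

lemma defect_sq:
  assumes v: "v \<in> H1"
  shows "(defect v)\<^sup>2 = (nrm (dx v))\<^sup>2 + \<kappa>\<^sup>2 * (nrm v)\<^sup>2 - 2 * \<kappa> * momentum v"
proof -
  let ?c = "- (\<i> * complex_of_real \<kappa>)"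
  have e: "twist v = (\<lambda>x. dx v x + ?c * v x)" by (simp add: twist_def fun_eq_iff)
  have n: "nrm (\<lambda>x. ?c * v x) = \<bar>\<kappa>\<bar> * nrm v"
    unfolding nrm_cmult by (simp only: norm_minus_cancel norm_mult norm_ii norm_of_real mult_1)
  have i: "Re (ip (dx v) (\<lambda>x. ?c * v x)) = - \<kappa> * momentum v"
    unfolding ip_cmult_right momentum_def by simp
  have "x + (\<bar>k\<bar> * y)\<^sup>2 + 2 * (- k * z) = x + k\<^sup>2 * y\<^sup>2 - 2 * k * z" for x y z k :: real
    by (simp add: power_mult_distrib)
  then show ?thesis
    unfolding defect_def e nrm_add_sq[OF dx_L2[OF v] L2_cmult[OF H1_L2[OF v]]] n i .
qed

lemma lyap_conserved:
  assumes w: "flow w"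
  shows "lyap (w t) = lyap (w s)" "density (w t) = density (w s)"
proof -
  show "density (w t) = density (w s)"
    using mass_conserved[OF w, of t s] by (simp add: density_def)
  have "lyap v = energy v + \<beta> / 2 * (\<kappa>\<^sup>2 * (nrm v)\<^sup>2 - 2 * \<kappa> * momentum v) + lam / 4 * ((density v)\<^sup>2 * L)"
    if "v \<in> H1" for v
    unfolding lyap_def defect_sq[OF that] energy_def by (simp add: algebra_simps)
  then show "lyap (w t) = lyap (w s)"
    using \<open>density (w t) = density (w s)\<close> mass_conserved[OF w, of t s] momentum_conserved[OF w, of t s]
      energy_conserved[OF w, of t s] flow_H1[OF w] by simp
qed

lemma fluct_nrm_sq: "v \<in> H1 \<Longrightarrow> (nrm (fluct v))\<^sup>2 = (nrm v)\<^sup>2 - L * (cmod (amp v))\<^sup>2"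
  using nrm_minus_sum_expo[of v "{n}" "fcoeff v"] H1_L2[of v]
  by (simp add: fluct_def[abs_def] amp_def)

lemma fluct_H1: "v \<in> H1 \<Longrightarrow> fluct v \<in> H1"
  unfolding fluct_def[abs_def] by (intro H1_diff H1_cmult H1_expo)

text \<open>On frequency m the twist multiplies by i (2\<pi>/L) (m - n), and \<open>fluct v\<close>
  has no component at m = n; the nearest other frequencies determine the constant
  L/(2\<pi>).\<close>

lemma fluct_Wirtinger:
  assumes v: "v \<in> H1"
  shows "nrm (fluct v) \<le> L / (2 * pi) * defect v"
  unfolding defect_def
proof (rule nrm_le_by_coeffs)
  show "continuous_on UNIV (fluct v)" by (intro H1_continuous fluct_H1 v)
  show "fluct v (x + L) = fluct v x" for x by (intro H1_periodic fluct_H1 v)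
  show "twist v \<in> L2" by (intro twist_L2 v)
  show "0 \<le> L / (2 * pi)" using L_pos by simp
  fix m
  have 1: "ip (fluct v) (expo m) = ip v (expo m) - amp v * ip (expo n) (expo m)"
    unfolding fluct_def[abs_def]
    by (simp add: ip_diff_left H1_L2 v L2_cmult L2_expo ip_cmult_left)
  have 2: "ip (twist v) (expo m) = \<i> * of_real (2 * pi / L * of_int (m - n)) * ip v (expo m)"
  proof -
    have "ip (twist v) (expo m) = ip (dx v) (expo m) - \<i> * of_real \<kappa> * ip v (expo m)"
      unfolding twist_def[abs_def] ip_diff_left[OF dx_L2[OF v] L2_cmult[OF H1_L2[OF v]] L2_expo] ip_cmult_left ..
    also have "ip (dx v) (expo m) = \<i> * of_real (2 * pi / L * of_int m) * ip v (expo m)"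
      by (rule weak_deriv_expo[OF H1_dx[OF v]])
    finally show ?thesis by (simp add: algebra_simps diff_divide_distrib)
  qed
  show "cmod (ip (fluct v) (expo m)) \<le> L / (2 * pi) * cmod (ip (twist v) (expo m))"
  proof (cases "m = n")
    case True
    then have "ip (fluct v) (expo m) = 0"
      unfolding 1 using L_pos by (simp add: ip_expo_expo amp_def fcoeff_def)
    then show ?thesis using L_pos by simp
  next
    case False
    have "\<bar>real_of_int (m - n)\<bar> \<ge> 1" using False by linarith
    then have "cmod (ip v (expo m)) \<le> \<bar>real_of_int (m - n)\<bar> * cmod (ip v (expo m))"
      by (simp add: mult_left_le mult_le_cancel_right1)
    also have "\<dots> = L / (2 * pi) * cmod (ip (twist v) (expo m))"
    proof -
      have "cmod (ip (twist v) (expo m)) = \<bar>2 * pi / L * of_int (m - n)\<bar> * cmod (ip v (expo m))"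
        unfolding 2 norm_mult norm_of_real by simp
      also have "\<bar>2 * pi / L * of_int (m - n)\<bar> = 2 * pi / L * \<bar>real_of_int (m - n)\<bar>"
        using L_pos by (simp only: abs_mult) simp
      finally show ?thesis using L_pos by simp
    qed
    finally show ?thesis unfolding 1 using False by (simp add: ip_expo_expo)
  qed
qed

text \<open>The weak derivative of \<open>fluct v\<close> is \<open>twist v\<close> plus i\<kappa>
  times \<open>fluct v\<close>; the three summands bound the twist, this second term, and
  \<open>fluct v\<close> itself by the defect.\<close>

definition fluct_const :: real where "fluct_const = 1 + \<bar>\<kappa>\<bar> * (L / (2 * pi)) + L / (2 * pi)"

lemma fluct_const_pos: "fluct_const > 0"
  unfolding fluct_const_def using L_pos by (intro add_pos_pos add_pos_nonneg mult_nonneg_nonneg) auto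

lemma fluct_h1_norm:
  assumes v: "v \<in> H1"
  shows "h1_norm L (fluct v) \<le> fluct_const * defect v"
proof -
  have wd: "has_weak_deriv (fluct v) (\<lambda>x. dx v x - amp v * (\<i> * of_real \<kappa> * expo n x))"
    unfolding fluct_def[abs_def]
    by (intro has_weak_deriv_diff has_weak_deriv_cmult has_weak_deriv_expo H1_dx H1_L2 L2_cmult L2_expo v)
  have eq: "(\<lambda>x. dx v x - amp v * (\<i> * of_real \<kappa> * expo n x)) = (\<lambda>x. twist v x + (\<i> * of_real \<kappa>) * fluct v x)"
    unfolding twist_def fluct_def by (rule ext) (simp only: right_diff_distrib mult_ac, simp)
  have "nrm (dx (fluct v)) = nrm (\<lambda>x. twist v x + (\<i> * of_real \<kappa>) * fluct v x)"
    using nrm_dx[OF fluct_H1[OF v] wd] unfolding eq .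
  also have "\<dots> \<le> nrm (twist v) + nrm (\<lambda>x. (\<i> * of_real \<kappa>) * fluct v x)"
    by (intro nrm_triangle twist_L2 L2_cmult H1_L2 fluct_H1 v)
  also have "nrm (\<lambda>x. (\<i> * of_real \<kappa>) * fluct v x) = \<bar>\<kappa>\<bar> * nrm (fluct v)"
    unfolding nrm_cmult by (simp only: norm_mult norm_ii norm_of_real mult_1)
  finally have "h1_norm L (fluct v) \<le> defect v + \<bar>\<kappa>\<bar> * nrm (fluct v) + nrm (fluct v)"
    using h1_norm_le[OF fluct_H1[OF v]] unfolding defect_def by linarith
  also have "\<dots> \<le> defect v + \<bar>\<kappa>\<bar> * (L / (2 * pi) * defect v) + L / (2 * pi) * defect v"
    by (intro add_mono mult_left_mono fluct_Wirtinger v) auto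
  also have "\<dots> = fluct_const * defect v" unfolding fluct_const_def by (simp only: distrib_right mult_1 mult.assoc)
  finally show ?thesis .
qed

lemma fluct_sup: "v \<in> H1 \<Longrightarrow> cmod (fluct v x) \<le> sobolev_const * (fluct_const * defect v)"
  using H1_sup_le[OF fluct_H1 fluct_h1_norm] .

section \<open>Variance of |v|^2 and coercivity of the conserved functional\<close>

lemma amp_le_density: assumes v: "v \<in> H1" shows "(cmod (amp v))\<^sup>2 \<le> density v"
proof -
  have "0 \<le> (nrm (fluct v))\<^sup>2" by simp
  then have "L * (cmod (amp v))\<^sup>2 \<le> (nrm v)\<^sup>2" unfolding fluct_nrm_sq[OF v] by simp
  then show ?thesis unfolding density_def using L_pos by (simp add: pos_le_divide_eq mult.commute)
qed

text \<open>Steiner's identity: recentring from the mean to \<open>c\<close> adds L times the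
  squared distance. The centre is left free for the choice c = |amp v|^2.\<close>

lemma variance:
  assumes v: "v \<in> H1"
  shows "integral\<^sup>L TL (\<lambda>x. ((cmod (v x))\<^sup>2 - c)\<^sup>2) = quartic v - (density v)\<^sup>2 * L + L * (density v - c)\<^sup>2"
proof -
  interpret finite_measure TL by (rule finite_measure_TL)
  note cv = H1_continuous[OF v]
  have i: "integrable TL (\<lambda>x. (cmod (v x)) ^ 4)" "integrable TL (\<lambda>x. (cmod (v x))\<^sup>2)"
    by (intro cont_integrable continuous_intros cv)+
  have "((cmod z)\<^sup>2 - c)\<^sup>2 = (cmod z) ^ 4 - 2 * c * (cmod z)\<^sup>2 + c\<^sup>2" for z :: complex
    by (simp add: power2_diff flip: power_mult)
  then have "integral\<^sup>L TL (\<lambda>x. ((cmod (v x))\<^sup>2 - c)\<^sup>2) =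
      integral\<^sup>L TL (\<lambda>x. (cmod (v x)) ^ 4 - 2 * c * (cmod (v x))\<^sup>2 + c\<^sup>2)" by simp
  also have "\<dots> = quartic v - 2 * c * (nrm v)\<^sup>2 + L * c\<^sup>2"
    using i by (simp add: quartic_def nrm_sq)
  also have "(nrm v)\<^sup>2 = L * density v" using L_pos by (simp add: density_def)
  finally show ?thesis by (simp add: power2_diff algebra_simps power2_eq_square)
qed

lemma variance_nonneg: assumes v: "v \<in> H1" shows "0 \<le> quartic v - (density v)\<^sup>2 * L"
proof -
  have "0 \<le> integral\<^sup>L TL (\<lambda>x. ((cmod (v x))\<^sup>2 - density v)\<^sup>2)" by (rule integral_nonneg_AE) simp
  then show ?thesis unfolding variance[OF v] by simp
qed

text \<open>The mean minimizes the second moment, so the variance may be bounded about |amp v|^2.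
  There the square root of the integrand factors into ||v| - |amp v||, at most |fluct v|, and |v| +
  |amp v|, at most 2 |amp v| + |fluct v|.\<close>

lemma variance_le:
  assumes v: "v \<in> H1" and r: "density v \<le> r" and y: "defect v \<le> y"
  shows "quartic v - (density v)\<^sup>2 * L \<le> (2 * sqrt r + sobolev_const * (fluct_const * y))\<^sup>2 * (L / (2 * pi))\<^sup>2 * (defect v)\<^sup>2"
proof -
  let ?B = "2 * sqrt r + sobolev_const * (fluct_const * y)"
  let ?c = "cmod (amp v)"
  have y0: "0 \<le> y" using y defect_nonneg[of v] by linarith
  have c: "?c \<le> sqrt r" using amp_le_density[OF v] r by (intro real_le_rsqrt) linarith
  have S: "cmod (fluct v x) \<le> sobolev_const * (fluct_const * y)" for x
    using fluct_sup[OF v, of x] mult_left_mono[OF mult_left_mono[OF y, of fluct_const], of sobolev_const] fluct_const_pos sobolev_const_pos by linarith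
  have "0 \<le> sqrt r" using c norm_ge_zero[of "amp v"] by linarith
  then have B0: "0 \<le> ?B" using y0 fluct_const_pos sobolev_const_pos by simp
  have "quartic v - (density v)\<^sup>2 * L \<le> integral\<^sup>L TL (\<lambda>x. ((cmod (v x))\<^sup>2 - ?c\<^sup>2)\<^sup>2)"
    unfolding variance[OF v] using L_pos by simp
  also have "\<dots> \<le> integral\<^sup>L TL (\<lambda>x. ?B\<^sup>2 * (cmod (fluct v x))\<^sup>2)"
  proof (rule integral_mono)
    show "integrable TL (\<lambda>x. ((cmod (v x))\<^sup>2 - ?c\<^sup>2)\<^sup>2)" "integrable TL (\<lambda>x. ?B\<^sup>2 * (cmod (fluct v x))\<^sup>2)"
      by (intro cont_integrable continuous_intros H1_continuous[OF v] H1_continuous[OF fluct_H1[OF v]])+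
    fix x
    let ?m = "cmod (v x)"
    have "\<bar>?m - cmod (amp v * expo n x)\<bar> \<le> cmod (fluct v x)"
      unfolding fluct_def by (rule norm_triangle_ineq3)
    then have d: "\<bar>?m - ?c\<bar> \<le> cmod (fluct v x)" by (simp add: norm_mult)
    have "\<bar>?m\<^sup>2 - ?c\<^sup>2\<bar> = \<bar>?m - ?c\<bar> * (?m + ?c)"
      by (simp add: power2_eq_square square_diff_square_factored abs_mult mult.commute)
    also have "\<dots> \<le> cmod (fluct v x) * ?B"
    proof (rule mult_mono[OF d])
      show "?m + ?c \<le> ?B" using d c S[of x] by linarith
    qed auto
    finally have "\<bar>?m\<^sup>2 - ?c\<^sup>2\<bar>\<^sup>2 \<le> (cmod (fluct v x) * ?B)\<^sup>2" by (intro power_mono) auto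
    then show "(?m\<^sup>2 - ?c\<^sup>2)\<^sup>2 \<le> ?B\<^sup>2 * (cmod (fluct v x))\<^sup>2"
      by (simp add: power_mult_distrib mult.commute)
  qed
  also have "\<dots> = ?B\<^sup>2 * (nrm (fluct v))\<^sup>2" by (simp add: nrm_sq)
  also have "\<dots> \<le> ?B\<^sup>2 * (L / (2 * pi) * defect v)\<^sup>2"
    by (intro mult_left_mono power_mono fluct_Wirtinger v) auto
  finally show ?thesis by (simp only: power_mult_distrib mult.assoc)
qed

text \<open>Coercivity coefficient for states with density at most r and defect at most y. Only the
  focusing sign lam > 0 can lower it, hence the maximum.\<close>

definition lyap_lower :: "real \<Rightarrow> real \<Rightarrow> real" where
  "lyap_lower r y = \<beta> / 2 - max lam 0 / 4 * ((2 * sqrt r + sobolev_const * (fluct_const * y))\<^sup>2 * (L / (2 * pi))\<^sup>2)"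

definition lyap_upper :: "real \<Rightarrow> real \<Rightarrow> real" where
  "lyap_upper r y = \<beta> / 2 + \<bar>lam\<bar> / 4 * ((2 * sqrt r + sobolev_const * (fluct_const * y))\<^sup>2 * (L / (2 * pi))\<^sup>2)"

lemma lyap_bounds:
  assumes v: "v \<in> H1" and r: "density v \<le> r" and y: "defect v \<le> y"
  shows "lyap_lower r y * (defect v)\<^sup>2 \<le> lyap v" "lyap v \<le> lyap_upper r y * (defect v)\<^sup>2"
proof -
  define W where "W = quartic v - (density v)\<^sup>2 * L"
  define P where "P = (2 * sqrt r + sobolev_const * (fluct_const * y))\<^sup>2 * (L / (2 * pi))\<^sup>2"
  have W: "0 \<le> W" "W \<le> P * (defect v)\<^sup>2"
    unfolding W_def P_def using variance_nonneg[OF v] variance_le[OF assms] by auto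
  have ly: "lyap v = \<beta> / 2 * (defect v)\<^sup>2 - lam / 4 * W" by (simp add: lyap_def W_def)
  have "lam / 4 * W \<le> max lam 0 / 4 * W" using W(1) by (intro mult_right_mono) auto
  also have "\<dots> \<le> max lam 0 / 4 * (P * (defect v)\<^sup>2)" using W(2) by (intro mult_left_mono) auto
  finally show "lyap_lower r y * (defect v)\<^sup>2 \<le> lyap v"
    unfolding ly lyap_lower_def P_def[symmetric] left_diff_distrib by (simp only: mult.assoc)
  have "- (lam / 4) * W \<le> \<bar>lam\<bar> / 4 * W" using W(1) by (intro mult_right_mono) auto
  also have "\<dots> \<le> \<bar>lam\<bar> / 4 * (P * (defect v)\<^sup>2)" using W(2) by (intro mult_left_mono) auto
  finally show "lyap v \<le> lyap_upper r y * (defect v)\<^sup>2"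
    unfolding ly lyap_upper_def P_def[symmetric] distrib_right by (simp only: mult.assoc)
qed

lemma defect_dist:
  assumes u: "u \<in> H1" and v: "v \<in> H1"
  shows "\<bar>defect u - defect v\<bar> \<le> (1 + \<bar>\<kappa>\<bar>) * h1_dist L u v"
proof -
  have "\<bar>defect u - defect v\<bar> \<le> nrm (\<lambda>x. twist u x - twist v x)"
    unfolding defect_def by (intro nrm_diff_le twist_L2 u v)
  also have "(\<lambda>x. twist u x - twist v x) = (\<lambda>x. (dx u x - dx v x) + (- (\<i> * of_real \<kappa>)) * (u x - v x))"
    unfolding twist_def by (rule ext) (simp only: minus_mult_left[symmetric] right_diff_distrib, simp)
  also have "nrm \<dots> \<le> nrm (\<lambda>x. dx u x - dx v x) + nrm (\<lambda>x. (- (\<i> * of_real \<kappa>)) * (u x - v x))"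
    by (intro nrm_triangle L2_diff L2_cmult dx_L2 H1_L2 u v)
  also have "nrm (\<lambda>x. (- (\<i> * of_real \<kappa>)) * (u x - v x)) = \<bar>\<kappa>\<bar> * nrm (\<lambda>x. u x - v x)"
    unfolding nrm_cmult by (simp only: norm_minus_cancel norm_mult norm_ii norm_of_real mult_1)
  also have "nrm (\<lambda>x. dx u x - dx v x) + \<bar>\<kappa>\<bar> * nrm (\<lambda>x. u x - v x) \<le> h1_dist L u v + \<bar>\<kappa>\<bar> * h1_dist L u v"
    by (intro add_mono mult_left_mono nrm_dx_diff_le_dist nrm_diff_le_dist u v) auto
  finally show ?thesis by (simp only: distrib_right mult_1)
qed

lemma defect_isCont: assumes w: "flow w" shows "isCont (\<lambda>t. defect (w t)) t"
  by (rule isCont_of_h1[OF w, where K = "\<lambda>_. 1 + \<bar>\<kappa>\<bar>"])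
     (simp_all only: dist_real_def defect_dist[OF flow_H1[OF w] flow_H1[OF w]] continuous_const)

text \<open>Coercivity is available only while the defect is at most y. If it ever exceeded y, it
  would equal y at some time by continuity, and there conservation would contradict the barrier
  \<open>y0\<close>. The resulting bound is proportional to the squared initial defect, so it also
  shows that a zero defect persists.\<close>

lemma trapping:
  assumes w: "flow w" and r: "density (w 0) \<le> r" and low: "0 < lyap_lower r y"
    and y0: "defect (w 0) < y" "lyap_upper r y * (defect (w 0))\<^sup>2 < lyap_lower r y * y\<^sup>2"
  shows "lyap_lower r y * (defect (w t))\<^sup>2 \<le> lyap_upper r y * (defect (w 0))\<^sup>2"
proof -
  note wH = flow_H1[OF w]
  have r': "density (w t) \<le> r" for t using r lyap_conserved(2)[OF w, of t 0] by simp
  have bd: "lyap_lower r y * (defect (w t))\<^sup>2 \<le> lyap_upper r y * (defect (w 0))\<^sup>2" if "defect (w t) \<le> y" for t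
    using lyap_bounds(1)[OF wH r' that] lyap_bounds(2)[OF wH r less_imp_le[OF y0(1)]]
      lyap_conserved(1)[OF w, of t 0] by linarith
  have "defect (w t) \<le> y"
  proof (rule ccontr)
    assume neg: "\<not> defect (w t) \<le> y"
    have c: "continuous_on S (\<lambda>t. defect (w t))" for S
      using defect_isCont[OF w] by (simp add: continuous_at_imp_continuous_on)
    have "\<exists>s. defect (w s) = y"
    proof (cases "0 \<le> t")
      case True
      then show ?thesis using IVT'[of "\<lambda>t. defect (w t)" 0 y t, OF _ _ _ c] neg y0(1) by auto
    next
      case False
      then show ?thesis using IVT2'[of "\<lambda>t. defect (w t)" 0 y t, OF _ _ _ c] neg y0(1) by auto
    qed
    then obtain s where s: "defect (w s) = y" by blast
    then show False using bd[of s] y0(2) by simp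
  qed
  then show ?thesis by (rule bd)
qed

text \<open>\<open>lyap_lower\<close> is continuous in y, and its limit at density \<alpha>^2 and y
  = 0 is positive by the stability condition. One number y serves both as slack for the density and
  as height of the barrier.\<close>

lemma stable_constants:
  assumes "\<beta> > 0" "\<beta> * (2 * pi / L)\<^sup>2 - 2 * lam * \<alpha>\<^sup>2 > 0"
  shows "\<exists>y>0. 0 < lyap_lower (\<alpha>\<^sup>2 + y) y"
proof -
  have "((\<lambda>y. lyap_lower (\<alpha>\<^sup>2 + y) y) \<longlongrightarrow> lyap_lower (\<alpha>\<^sup>2 + 0) 0) (at_right 0)"
    unfolding lyap_lower_def by (intro tendsto_intros)
  moreover have "0 < lyap_lower (\<alpha>\<^sup>2 + 0) 0"
  proof -
    have l: "lyap_lower (\<alpha>\<^sup>2 + 0) 0 = \<beta> / 2 - max lam 0 * \<alpha>\<^sup>2 * (L / (2 * pi))\<^sup>2"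
      by (simp add: lyap_lower_def power_mult_distrib)
    show ?thesis
    proof (cases "lam \<le> 0")
      case True
      then show ?thesis unfolding l using assms(1) by simp
    next
      case False
      have "2 * lam * \<alpha>\<^sup>2 * (L / (2 * pi))\<^sup>2 < \<beta> * (2 * pi / L)\<^sup>2 * (L / (2 * pi))\<^sup>2"
        using assms(2) L_pos by (intro mult_strict_right_mono) auto
      also have "\<dots> = \<beta>" using L_pos by (simp add: mult.assoc flip: power_mult_distrib)
      finally show ?thesis unfolding l using False by simp
    qed
  qed
  ultimately have "eventually (\<lambda>y. 0 < lyap_lower (\<alpha>\<^sup>2 + y) y) (at_right 0)"
    by (rule order_tendstoD(1))
  then obtain b where "b > 0" "\<forall>y. 0 < y \<and> y < b \<longrightarrow> 0 < lyap_lower (\<alpha>\<^sup>2 + y) y"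
    unfolding eventually_at_right_field by auto
  then show ?thesis by (intro exI[of _ "b / 2"]) auto
qed

text \<open>The difference from a plane wave is \<open>fluct v\<close> plus a multiple of the
  exponential, and the phase is chosen optimally. The estimate ||amp v| - |\<alpha>||^2 \<le> ||amp
  v|^2 - \<alpha>^2| brings in the density through |amp v|^2 = density - |fluct v|^2/L, with the L2
  norm of \<open>fluct v\<close>. It avoids division by |\<alpha>|, so that \<alpha> = 0 is
  covered.\<close>

lemma orbit_dist:
  assumes v: "v \<in> H1"
  shows "\<exists>\<theta>. h1_dist L v (\<lambda>x. of_real \<alpha> * cis \<theta> * expo n x) \<le>
    fluct_const * defect v + sqrt (\<bar>density v - \<alpha>\<^sup>2\<bar> + (L / (2 * pi) * defect v)\<^sup>2 / L) * h1_norm L (expo n)"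
proof -
  obtain \<theta> where \<theta>: "cmod (amp v - of_real \<alpha> * cis \<theta>) = \<bar>cmod (amp v) - \<bar>\<alpha>\<bar>\<bar>"
    using phase_alignment by blast
  let ?c = "of_real \<alpha> * cis \<theta> - amp v"
  have "(\<lambda>x. v x - of_real \<alpha> * cis \<theta> * expo n x) = (\<lambda>x. fluct v x - ?c * expo n x)"
    by (simp add: fluct_def fun_eq_iff algebra_simps)
  then have "h1_dist L v (\<lambda>x. of_real \<alpha> * cis \<theta> * expo n x) = h1_norm L (\<lambda>x. fluct v x - ?c * expo n x)"
    by (simp add: h1_dist_def)
  also have "\<dots> \<le> h1_norm L (fluct v) + h1_norm L (\<lambda>x. ?c * expo n x)"
    by (intro h1_norm_diff_triangle fluct_H1 H1_cmult H1_expo v)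
  also have "\<dots> = h1_norm L (fluct v) + \<bar>cmod (amp v) - \<bar>\<alpha>\<bar>\<bar> * h1_norm L (expo n)"
    unfolding h1_norm_cmult[OF H1_expo] \<theta>[symmetric] norm_minus_commute[of "amp v"] ..
  also have "\<dots> \<le> fluct_const * defect v + sqrt (\<bar>density v - \<alpha>\<^sup>2\<bar> + (L / (2 * pi) * defect v)\<^sup>2 / L) * h1_norm L (expo n)"
  proof (intro add_mono mult_right_mono fluct_h1_norm v h1_norm_nonneg real_le_rsqrt)
    let ?a = "cmod (amp v)"
    have "\<bar>x - \<bar>\<alpha>\<bar>\<bar> \<le> x + \<bar>\<alpha>\<bar>" if "0 \<le> x" for x :: real using that by linarith
    then have "\<bar>?a - \<bar>\<alpha>\<bar>\<bar>\<^sup>2 \<le> \<bar>?a - \<bar>\<alpha>\<bar>\<bar> * (?a + \<bar>\<alpha>\<bar>)"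
      unfolding power2_eq_square by (intro mult_left_mono) simp_all
    also have "\<dots> = \<bar>?a\<^sup>2 - \<alpha>\<^sup>2\<bar>"
    proof -
      have "?a\<^sup>2 - \<alpha>\<^sup>2 = (?a - \<bar>\<alpha>\<bar>) * (?a + \<bar>\<alpha>\<bar>)"
        by (simp add: power2_eq_square algebra_simps)
      then show ?thesis by (simp add: abs_mult)
    qed
    also have "?a\<^sup>2 - \<alpha>\<^sup>2 = (density v - \<alpha>\<^sup>2) - (nrm (fluct v))\<^sup>2 / L"
      unfolding fluct_nrm_sq[OF v] density_def using L_pos by (simp add: diff_divide_distrib)
    also have "\<bar>\<dots>\<bar> \<le> \<bar>density v - \<alpha>\<^sup>2\<bar> + (nrm (fluct v))\<^sup>2 / L"
      using abs_triangle_ineq4[of "density v - \<alpha>\<^sup>2" "(nrm (fluct v))\<^sup>2 / L"] L_pos by simp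
    also have "\<dots> \<le> \<bar>density v - \<alpha>\<^sup>2\<bar> + (L / (2 * pi) * defect v)\<^sup>2 / L"
      using L_pos by (intro add_left_mono divide_right_mono power_mono fluct_Wirtinger v) auto
    finally show "\<bar>?a - \<bar>\<alpha>\<bar>\<bar>\<^sup>2 \<le> \<bar>density v - \<alpha>\<^sup>2\<bar> + (L / (2 * pi) * defect v)\<^sup>2 / L" .
  qed
  finally show ?thesis by blast
qed

section \<open>Plane waves: membership, invariants, evolution and stability\<close>

lemma plane_H1: "(\<lambda>x. c * expo n x) \<in> H1"
  by (intro H1_cmult H1_expo)

lemma plane_defect: "defect (\<lambda>x. c * expo n x) = 0"
proof -
  have "\<bar>defect (\<lambda>x. c * expo n x)\<bar> \<le> 0"
  proof -
    have "AE x in TL. twist (\<lambda>x. c * expo n x) x = 0"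
      using dx_AE[OF plane_H1 has_weak_deriv_cmult[OF has_weak_deriv_expo], of c]
      by (rule eventually_mono) (simp add: twist_def mult_ac)
    then have "nrm (twist (\<lambda>x. c * expo n x)) = nrm (\<lambda>x. 0)"
      by (intro nrm_cong_AE twist_L2 plane_H1 L2_continuous) auto
    then show ?thesis by (simp add: defect_def nrm_def Re_ip_self)
  qed
  then show ?thesis by simp
qed

lemma nrm_expo: "nrm (expo m) = sqrt L"
proof -
  have "ip (expo m) (expo m) = of_real L" by (simp add: ip_expo_expo)
  then show ?thesis by (simp add: nrm_def)
qed

lemma plane_density: "density (\<lambda>x. c * expo n x) = (cmod c)\<^sup>2"
  unfolding density_def nrm_cmult nrm_expo using L_pos by (simp add: power_mult_distrib)

text \<open>The frequency \<xi> is given by the dispersion relation \<xi> + \<beta>\<kappa>^2 = lam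
  |c|^2. This supplies the existence half of \<open>relative_equilibrium\<close>.\<close>

lemma plane_flow:
  "flow (\<lambda>t x. c * cis ((lam * (cmod c)\<^sup>2 - \<beta> * \<kappa>\<^sup>2) * t) * expo n x)"
proof -
  define \<xi> where "\<xi> = lam * (cmod c)\<^sup>2 - \<beta> * \<kappa>\<^sup>2"
  let ?C = "\<lambda>t. c * cis (\<xi> * t)"
  have dist: "h1_dist L (\<lambda>x. ?C s * expo n x) (\<lambda>x. ?C t * expo n x) = cmod (?C s - ?C t) * h1_norm L (expo n)" for s t
    unfolding h1_dist_def left_diff_distrib[symmetric] by (rule h1_norm_cmult[OF H1_expo])
  have "flow (\<lambda>t x. ?C t * expo n x)"
    unfolding flow_def
  proof (intro conjI allI ballI)
    show "(\<lambda>x. ?C t * expo n x) \<in> H1" for t by (rule plane_H1)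
    show "((\<lambda>s. h1_dist L (\<lambda>x. ?C s * expo n x) (\<lambda>x. ?C t * expo n x)) \<longlongrightarrow> 0) (at t)" for t
    proof -
      have "((\<lambda>s. cmod (?C s - ?C t) * h1_norm L (expo n)) \<longlongrightarrow> cmod (?C t - ?C t) * h1_norm L (expo n)) (at t)"
        by (intro tendsto_intros)
      then show ?thesis unfolding dist by simp
    qed
    fix \<phi> t assume \<phi>: "\<phi> \<in> H1"
    have C': "((\<lambda>s. ?C s) has_vector_derivative \<i> * of_real \<xi> * ?C t) (at t)"
    proof -
      have "((\<lambda>s. c * exp (\<i> * of_real \<xi> * of_real s)) has_vector_derivative \<i> * of_real \<xi> * (c * exp (\<i> * of_real \<xi> * of_real t))) (at t)"
        by (rule has_vector_derivative_real_field) (auto intro!: derivative_eq_intros)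
      then show ?thesis by (simp add: cis_conv_exp mult.assoc)
    qed
    have 1: "ip (dx (\<lambda>x. ?C t * expo n x)) (dx \<phi>) = of_real (\<kappa>\<^sup>2) * (?C t * ip (expo n) \<phi>)"
    proof -
      have "ip (dx (\<lambda>x. ?C t * expo n x)) (dx \<phi>) = ip (\<lambda>x. ?C t * (\<i> * of_real \<kappa> * expo n x)) (dx \<phi>)"
        by (intro ip_dx plane_H1 has_weak_deriv_cmult has_weak_deriv_expo dx_L2 \<phi>)
      also have "\<dots> = ?C t * (\<i> * of_real \<kappa> * ip (expo n) (dx \<phi>))" by (simp only: ip_cmult_left)
      also have "ip (expo n) (dx \<phi>) = cnj (\<i> * of_real \<kappa> * ip \<phi> (expo n))"
        unfolding weak_deriv_expo[OF H1_dx[OF \<phi>], symmetric] by (rule ip_cnj[symmetric])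
      also have "\<dots> = - \<i> * of_real \<kappa> * ip (expo n) \<phi>"
        by (simp only: complex_cnj_mult complex_cnj_i complex_cnj_complex_of_real ip_cnj)
      finally show ?thesis by (simp add: power2_eq_square mult_ac)
    qed
    have 2: "ip (cubic (\<lambda>x. ?C t * expo n x)) \<phi> = of_real ((cmod c)\<^sup>2) * (?C t * ip (expo n) \<phi>)"
    proof -
      have "cubic (\<lambda>x. ?C t * expo n x) = (\<lambda>x. (of_real ((cmod c)\<^sup>2) * ?C t) * expo n x)"
        by (simp add: cubic_def fun_eq_iff norm_mult)
      then show ?thesis by (simp add: ip_cmult_left)
    qed
    have skew: "- \<i> * b * (k * X) + \<i> * l * (m * X) = \<i> * (l * m - b * k) * X" for b k l m X :: complex
      by (simp add: algebra_simps)
    have "- \<i> * of_real \<beta> * (of_real (\<kappa>\<^sup>2) * X) + \<i> * of_real lam * (of_real ((cmod c)\<^sup>2) * X) = \<i> * of_real \<xi> * X" for X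
      unfolding \<xi>_def of_real_diff of_real_mult by (rule skew)
    then have "nls_gen (\<lambda>x. ?C t * expo n x) \<phi> = \<i> * of_real \<xi> * ?C t * ip (expo n) \<phi>"
      unfolding nls_gen_def 1 2 by (simp only: mult.assoc)
    moreover have "((\<lambda>s. ?C s * ip (expo n) \<phi>) has_vector_derivative \<i> * of_real \<xi> * ?C t * ip (expo n) \<phi>) (at t)"
      by (rule has_vector_derivative_mult_left[OF C'])
    ultimately show "((\<lambda>s. ip (\<lambda>x. ?C s * expo n x) \<phi>) has_vector_derivative nls_gen (\<lambda>x. ?C t * expo n x) \<phi>) (at t)"
      by (simp add: ip_cmult_left)
  qed
  then show ?thesis by (simp add: \<xi>_def)
qed

lemma plane_wave_stability:
  assumes "\<beta> > 0" "\<beta> * (2 * pi / L)\<^sup>2 - 2 * lam * \<alpha>\<^sup>2 > 0" and \<epsilon>: "\<epsilon> > 0" and c: "cmod c = \<bar>\<alpha>\<bar>"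
  shows "\<exists>\<delta>>0. \<forall>w t. flow w \<longrightarrow> h1_dist L (w 0) (\<lambda>x. c * expo n x) \<le> \<delta> \<longrightarrow>
    (\<exists>\<theta>. h1_dist L (w t) (\<lambda>x. of_real \<alpha> * cis \<theta> * expo n x) \<le> \<epsilon>)"
proof -
  obtain y where y: "y > 0" "0 < lyap_lower (\<alpha>\<^sup>2 + y) y" using stable_constants[OF assms(1,2)] by blast
  define cl cu where "cl = lyap_lower (\<alpha>\<^sup>2 + y) y" and "cu = lyap_upper (\<alpha>\<^sup>2 + y) y"
  have cl: "cl > 0" using y(2) by (simp add: cl_def)
  have cu: "cu \<ge> 0" unfolding cu_def lyap_upper_def using assms(1) by simp
  \<comment> \<open>For data at distance at most d, \<open>A d\<close> bounds the initial defect,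
    \<open>r d\<close> the deviation of the density, \<open>Y d\<close> the defect at all times and
    \<open>B d\<close> the distance to the orbit; all tend to 0 with d.\<close>
  define A where "A d = (1 + \<bar>\<kappa>\<bar>) * d" for d
  \<comment> \<open>From |p^2 - q^2| = |p - q| (p + q), where q = |\<alpha>| sqrt L is the norm of
    the plane wave and |p - q| \<le> d.\<close>
  define r where "r d = (d * (2 * (\<bar>\<alpha>\<bar> * sqrt L) + d)) / L" for d
  define Y where "Y d = sqrt (cu * (A d)\<^sup>2 / cl)" for d
  define B where "B d = fluct_const * Y d + sqrt (r d + (L / (2 * pi) * Y d)\<^sup>2 / L) * h1_norm L (expo n)" for d
  have tA: "(A \<longlongrightarrow> (1 + \<bar>\<kappa>\<bar>) * 0) (at_right 0)" unfolding A_def[abs_def] by (intro tendsto_intros)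
  have tr: "(r \<longlongrightarrow> (0 * (2 * (\<bar>\<alpha>\<bar> * sqrt L) + 0)) / L) (at_right 0)"
    unfolding r_def[abs_def] using L_pos by (intro tendsto_intros) auto
  have tY: "(Y \<longlongrightarrow> sqrt (cu * ((1 + \<bar>\<kappa>\<bar>) * 0)\<^sup>2 / cl)) (at_right 0)"
    unfolding Y_def[abs_def] using cl by (intro tendsto_intros tA) auto
  have tB: "(B \<longlongrightarrow> fluct_const * sqrt (cu * ((1 + \<bar>\<kappa>\<bar>) * 0)\<^sup>2 / cl) + sqrt ((0 * (2 * (\<bar>\<alpha>\<bar> * sqrt L) + 0)) / L +
      (L / (2 * pi) * sqrt (cu * ((1 + \<bar>\<kappa>\<bar>) * 0)\<^sup>2 / cl))\<^sup>2 / L) * h1_norm L (expo n)) (at_right 0)"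
    unfolding B_def[abs_def] using L_pos by (intro tendsto_intros tY tr) auto
  have tC: "((\<lambda>d. cu * (A d)\<^sup>2) \<longlongrightarrow> cu * ((1 + \<bar>\<kappa>\<bar>) * 0)\<^sup>2) (at_right 0)"
    by (intro tendsto_intros tA)
  \<comment> \<open>The requirements on d: start below the barrier, keep the density within the
    slack, end within \<epsilon> of the orbit, and have too little of the conserved quantity to
    reach the barrier.\<close>
  have "eventually (\<lambda>d. A d < y) (at_right 0)" using tA y(1) by (intro order_tendstoD(2)) auto
  moreover have "eventually (\<lambda>d. r d < y) (at_right 0)" using tr y(1) by (intro order_tendstoD(2)) auto
  moreover have "eventually (\<lambda>d. B d < \<epsilon>) (at_right 0)" using tB \<epsilon> by (intro order_tendstoD(2)) auto
  moreover have "eventually (\<lambda>d. cu * (A d)\<^sup>2 < cl * y\<^sup>2) (at_right 0)"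
    using tC cl y(1) by (intro order_tendstoD(2)) auto
  moreover have "eventually (\<lambda>d::real. 0 < d) (at_right 0)" by (rule eventually_at_right_less)
  ultimately have "eventually (\<lambda>d. A d < y \<and> r d < y \<and> B d < \<epsilon> \<and> cu * (A d)\<^sup>2 < cl * y\<^sup>2 \<and> 0 < d) (at_right 0)"
    by (intro eventually_conj)
  then obtain d where d: "A d < y" "r d < y" "B d < \<epsilon>" "cu * (A d)\<^sup>2 < cl * y\<^sup>2" "0 < d"
    using eventually_happens'[OF trivial_limit_at_right_real] by blast
  show ?thesis
  proof (rule exI[of _ d], intro conjI allI impI d(5))
    fix w t assume w: "flow w" and dist: "h1_dist L (w 0) (\<lambda>x. c * expo n x) \<le> d"
    note wH = flow_H1[OF w]
    let ?u = "\<lambda>x. c * expo n x"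
    have def0: "defect (w 0) \<le> A d"
    proof -
      have "defect (w 0) \<le> (1 + \<bar>\<kappa>\<bar>) * h1_dist L (w 0) ?u"
        using defect_dist[OF wH[of 0] plane_H1, of c] unfolding plane_defect by simp
      also have "\<dots> \<le> A d" unfolding A_def by (intro mult_left_mono dist) auto
      finally show ?thesis .
    qed
    have dens: "\<bar>density (w 0) - \<alpha>\<^sup>2\<bar> \<le> r d"
    proof -
      have u: "nrm ?u = \<bar>\<alpha>\<bar> * sqrt L" unfolding nrm_cmult nrm_expo c ..
      have nd: "\<bar>nrm (w 0) - nrm ?u\<bar> \<le> d"
        using nrm_diff_le[OF H1_L2[OF wH[of 0]] H1_L2[OF plane_H1, of c]] nrm_diff_le_dist[OF wH[of 0] plane_H1, of c] dist
        by linarith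
      have "\<alpha>\<^sup>2 = (nrm ?u)\<^sup>2 / L" unfolding u using L_pos by (simp add: power_mult_distrib)
      then have "density (w 0) - \<alpha>\<^sup>2 = ((nrm (w 0) - nrm ?u) * (nrm (w 0) + nrm ?u)) / L"
        unfolding density_def by (simp add: power2_eq_square square_diff_square_factored diff_divide_distrib[symmetric] mult.commute)
      then have "\<bar>density (w 0) - \<alpha>\<^sup>2\<bar> = (\<bar>nrm (w 0) - nrm ?u\<bar> * (nrm (w 0) + nrm ?u)) / L"
        using L_pos by (simp add: abs_mult)
      also have "\<dots> \<le> (d * (2 * nrm ?u + d)) / L"
        using nd L_pos d(5) by (intro divide_right_mono mult_mono) auto
      finally show ?thesis unfolding r_def u .
    qed
    have "lyap_lower (\<alpha>\<^sup>2 + y) y * (defect (w t))\<^sup>2 \<le> lyap_upper (\<alpha>\<^sup>2 + y) y * (defect (w 0))\<^sup>2"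
    proof (rule trapping[OF w _ y(2)])
      show "density (w 0) \<le> \<alpha>\<^sup>2 + y" using dens d(2) by linarith
      show "defect (w 0) < y" using def0 d(1) by linarith
      have "cu * (defect (w 0))\<^sup>2 \<le> cu * (A d)\<^sup>2"
        using def0 defect_nonneg cu by (intro mult_left_mono power_mono) auto
      then show "lyap_upper (\<alpha>\<^sup>2 + y) y * (defect (w 0))\<^sup>2 < lyap_lower (\<alpha>\<^sup>2 + y) y * y\<^sup>2"
        using d(4) unfolding cl_def cu_def by linarith
    qed
    also have "\<dots> \<le> cu * (A d)\<^sup>2"
      unfolding cu_def[symmetric] using def0 defect_nonneg cu by (intro mult_left_mono power_mono) auto
    finally have "(defect (w t))\<^sup>2 \<le> cu * (A d)\<^sup>2 / cl"
      using cl unfolding cl_def[symmetric] by (simp add: pos_le_divide_eq mult.commute)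
    then have defY: "defect (w t) \<le> Y d" unfolding Y_def by (rule real_le_rsqrt)
    obtain \<theta> where "h1_dist L (w t) (\<lambda>x. of_real \<alpha> * cis \<theta> * expo n x) \<le>
      fluct_const * defect (w t) + sqrt (\<bar>density (w t) - \<alpha>\<^sup>2\<bar> + (L / (2 * pi) * defect (w t))\<^sup>2 / L) * h1_norm L (expo n)"
      using orbit_dist[OF wH] by blast
    also have "\<dots> \<le> B d"
      unfolding B_def lyap_conserved(2)[OF w, of t 0]
      using fluct_const_pos L_pos defect_nonneg
      by (intro add_mono mult_mono mult_right_mono mult_left_mono real_sqrt_le_mono divide_right_mono power_mono dens defY)
         (auto simp: h1_norm_nonneg)
    finally show "\<exists>\<theta>. h1_dist L (w t) (\<lambda>x. of_real \<alpha> * cis \<theta> * expo n x) \<le> \<epsilon>" using d(3) by (intro exI[of _ \<theta>]) linarith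
  qed
qed

text \<open>\<open>trapping\<close> with zero initial defect keeps the defect at 0, so the state
  stays a multiple of \<open>expo n\<close>, and conservation of mass fixes its modulus. This
  concerns every solution with the datum, as \<open>relative_equilibrium\<close> demands.\<close>

lemma plane_wave_invariance:
  assumes "\<beta> > 0" "\<beta> * (2 * pi / L)\<^sup>2 - 2 * lam * \<alpha>\<^sup>2 > 0" and c: "cmod c = \<bar>\<alpha>\<bar>"
    and w: "flow w" "w 0 = (\<lambda>x. c * expo n x)"
  shows "\<exists>\<theta>. w t = (\<lambda>x. of_real \<alpha> * cis \<theta> * expo n x)"
proof -
  note wH = flow_H1[OF w(1)]
  obtain y where y: "y > 0" "0 < lyap_lower (\<alpha>\<^sup>2 + y) y" using stable_constants[OF assms(1,2)] by blast
  have "lyap_lower (\<alpha>\<^sup>2 + y) y * (defect (w t))\<^sup>2 \<le> lyap_upper (\<alpha>\<^sup>2 + y) y * (defect (w 0))\<^sup>2"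
    by (rule trapping[OF w(1) _ y(2)]) (use y in \<open>simp_all add: w(2) plane_density plane_defect c\<close>)
  then have "defect (w t) = 0"
    using y(2) unfolding w(2) plane_defect by (simp add: mult_le_0_iff)
  then have f0: "nrm (fluct (w t)) = 0"
    using fluct_Wirtinger[OF wH, of t] nrm_nonneg[of "fluct (w t)"] by simp
  have fl: "fluct (w t) x = 0" for x
    by (rule nrm_zero_continuous[OF H1_continuous[OF fluct_H1[OF wH]] H1_periodic[OF fluct_H1[OF wH]] f0])
  have "(nrm (w t))\<^sup>2 = L * (cmod (amp (w t)))\<^sup>2" using fluct_nrm_sq[OF wH, of t] f0 by simp
  moreover have "(nrm (w t))\<^sup>2 = L * \<alpha>\<^sup>2"
    unfolding mass_conserved[OF w(1), of t 0] w(2) nrm_cmult nrm_expo c using L_pos by (simp add: power_mult_distrib)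
  ultimately have "(cmod (amp (w t)))\<^sup>2 = \<bar>\<alpha>\<bar>\<^sup>2" using L_pos by simp
  then have "cmod (amp (w t)) = \<bar>\<alpha>\<bar>" by (rule power2_eq_imp_eq) auto
  then obtain \<theta> where "amp (w t) = of_real \<alpha> * cis \<theta>"
    using phase_alignment[of "amp (w t)" \<alpha>] by auto
  then show ?thesis using fl by (intro exI[of _ \<theta>]) (auto simp: fluct_def)
qed

end

section \<open>From phases of plane waves to group orbits\<close>

lemma h1_setdist_le:
  assumes "0 < L" "w \<in> S"
  shows "h1_setdist L v S \<le> h1_dist L v w"
  unfolding h1_setdist_def
proof (rule cINF_lower[OF _ assms(2)])
  interpret torus L by unfold_locales fact
  show "bdd_below (h1_dist L v ` S)" by (rule bdd_belowI[of _ 0]) (auto simp: h1_dist_nonneg)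
qed

theorem theorem9p1:
  fixes L \<beta> lam \<alpha> k :: real
  assumes "L > 0" and "\<beta> > 0"
    and "k \<in> {2 * pi / L * of_int m | m :: int. True}"
    and "\<beta> * (2 * pi / L)\<^sup>2 - 2 * lam * \<bar>\<alpha>\<bar>\<^sup>2 > 0"
  shows "\<forall>u \<in> {(\<lambda>x :: real. of_real \<alpha> * exp (\<i> * of_real \<gamma>) * exp (- \<i> * of_real (k * (x - a)))) | a \<gamma>. True}.
           relative_equilibrium L \<beta> lam u \<and> orbitally_stable L \<beta> lam u"
proof
  fix u assume "u \<in> {(\<lambda>x :: real. of_real \<alpha> * exp (\<i> * of_real \<gamma>) * exp (- \<i> * of_real (k * (x - a)))) | a \<gamma>. True}"
  then obtain a \<gamma> where u0: "u = (\<lambda>x. of_real \<alpha> * exp (\<i> * of_real \<gamma>) * exp (- \<i> * of_real (k * (x - a))))" by blast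
  obtain m :: int where m: "k = 2 * pi / L * of_int m" using assms(3) by blast
  \<comment> \<open>The wave is e^{-ikx}, so its frequency index is the negative of that of
    k.\<close>
  interpret plane_wave L \<beta> lam "- m" by unfold_locales fact
  \<comment> \<open>Translating a plane wave only turns its phase, so both group parameters merge
    into one angle.\<close>
  define \<phi> where "\<phi> = \<gamma> + k * a"
  define c where "c = of_real \<alpha> * cis \<phi>"
  have u: "u = (\<lambda>x. c * expo (- m) x)"
  proof
    fix x
    have "exp (\<i> * of_real \<gamma>) * exp (- \<i> * of_real (k * (x - a))) = cis \<gamma> * cis (- (k * (x - a)))"
      by (simp add: cis_conv_exp)
    also have "\<dots> = cis \<phi> * expo (- m) x"
      unfolding \<phi>_def expo_def cis_mult m by (rule arg_cong[where f = cis]) (simp add: algebra_simps diff_divide_distrib)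
    finally show "u x = c * expo (- m) x" unfolding u0 c_def by (simp only: mult.assoc)
  qed
  have c: "cmod c = \<bar>\<alpha>\<bar>" by (simp add: c_def norm_mult)
  have cond: "\<beta> * (2 * pi / L)\<^sup>2 - 2 * lam * \<alpha>\<^sup>2 > 0" using assms(4) by simp
  have orbit: "(\<lambda>x. of_real \<alpha> * cis \<theta> * expo (- m) x) \<in> sym_orbit u" for \<theta>
  proof -
    \<comment> \<open>For the same reason phase rotations alone reach every point of the
      orbit.\<close>
    have "(\<lambda>x. of_real \<alpha> * cis \<theta> * expo (- m) x) = sym_action 0 (\<theta> - \<phi>) u"
    proof
      fix x
      have "exp (\<i> * of_real (\<theta> - \<phi>)) * cis \<phi> = cis \<theta>"
        unfolding cis_conv_exp[symmetric] cis_mult by simp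
      then show "of_real \<alpha> * cis \<theta> * expo (- m) x = sym_action 0 (\<theta> - \<phi>) u x"
        unfolding sym_action_def u c_def by (simp add: mult_ac)
    qed
    then show ?thesis unfolding sym_orbit_def by blast
  qed
  show "relative_equilibrium L \<beta> lam u \<and> orbitally_stable L \<beta> lam u"
  proof
    show "relative_equilibrium L \<beta> lam u"
      unfolding relative_equilibrium_def
    proof (intro conjI allI impI)
      show "u \<in> H1_torus L" unfolding u by (rule plane_H1)
      have "nls_solution L \<beta> lam u
          (\<lambda>t x. c * cis ((lam * (cmod c)\<^sup>2 - \<beta> * (2 * pi / L * of_int (- m))\<^sup>2) * t) * expo (- m) x)"
        unfolding nls_solution_iff using plane_flow[of c] by (simp add: u)
      then show "\<exists>U. nls_solution L \<beta> lam u U" by blast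
      fix U t assume "nls_solution L \<beta> lam u U"
      then have "flow U" "U 0 = (\<lambda>x. c * expo (- m) x)" unfolding nls_solution_iff u by auto
      from plane_wave_invariance[OF assms(2) cond c this, of t]
      show "U t \<in> sym_orbit u" using orbit by auto
    qed
    show "orbitally_stable L \<beta> lam u"
      unfolding orbitally_stable_def
    proof (intro allI impI)
      fix \<epsilon> :: real assume "\<epsilon> > 0"
      from plane_wave_stability[OF assms(2) cond this c] obtain \<delta> where \<delta>: "\<delta> > 0"
        "\<forall>w t. flow w \<longrightarrow> h1_dist L (w 0) (\<lambda>x. c * expo (- m) x) \<le> \<delta> \<longrightarrow>
          (\<exists>\<theta>. h1_dist L (w t) (\<lambda>x. of_real \<alpha> * cis \<theta> * expo (- m) x) \<le> \<epsilon>)" by (elim exE conjE)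
      show "\<exists>\<delta>>0. \<forall>v\<in>H1_torus L. h1_dist L v u \<le> \<delta> \<longrightarrow>
        (\<forall>U V. nls_solution L \<beta> lam u U \<longrightarrow> nls_solution L \<beta> lam v V \<longrightarrow>
           (\<forall>t. (INF t'. h1_setdist L (V t) (sym_orbit (U t'))) \<le> \<epsilon>))"
      proof (intro exI[of _ \<delta>] conjI \<delta>(1) ballI allI impI)
        fix v U V t
        assume v: "h1_dist L v u \<le> \<delta>" and U: "nls_solution L \<beta> lam u U" and V: "nls_solution L \<beta> lam v V"
        have "flow V" "h1_dist L (V 0) (\<lambda>x. c * expo (- m) x) \<le> \<delta>"
          using V v unfolding nls_solution_iff u by auto
        then obtain \<theta> where \<theta>: "h1_dist L (V t) (\<lambda>x. of_real \<alpha> * cis \<theta> * expo (- m) x) \<le> \<epsilon>"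
          using \<delta>(2) by blast
        \<comment> \<open>A real infimum lies below its members only for sets bounded below; this
          licenses the choice t' = 0 in the infimum over times.\<close>
        have nonneg: "0 \<le> h1_setdist L (V t) (sym_orbit (U t'))" for t'
          unfolding h1_setdist_def
          by (rule cINF_greatest) (auto simp: sym_orbit_def h1_dist_nonneg)
        have "(INF t'. h1_setdist L (V t) (sym_orbit (U t'))) \<le> h1_setdist L (V t) (sym_orbit (U 0))"
          by (rule cINF_lower) (auto intro!: bdd_belowI[of _ 0] nonneg)
        also have "U 0 = u" using U by (simp add: nls_solution_def)
        also have "h1_setdist L (V t) (sym_orbit u) \<le> h1_dist L (V t) (\<lambda>x. of_real \<alpha> * cis \<theta> * expo (- m) x)"
          by (rule h1_setdist_le[OF assms(1) orbit])
        also note \<theta>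
        finally show "(INF t'. h1_setdist L (V t) (sym_orbit (U t'))) \<le> \<epsilon>" .
      qed
    qed
  qed
qed

end
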